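(* Let $I=[a,b]\subset\mathbb{R}$ be a closed interval and let $f:I\to I$ be a continuous map with zero topological entropy. Then the M\"obius function $\mu$ is linearly disjoint from the flow $\mathcal{X}=\{f^n:I\to I\}_{n\in\{0\}\cup\mathbb{N}}$ generated by $f$, that is, $$\lim_{N\to\infty}\frac1N\sum_{n=1}^N \mu(n)\,\varphi(f^nx)=0$$ for every continuous function $\varphi:I\to\mathbb{C}$ and every $x\in I$.
   Context: Here $\mathbb{N}=\{1,2,3,\dots\}$ and $f^n$ denotes the $n$-th iterate of $f$. The M\"obius function $\mu:\mathbb{N}\to\{-1,0,1\}$ is defined by $\mu(1)=1$, $\mu(n)=(-1)^r$ if $n=p_1\cdots p_r$ is a product of $r$ distinct primes, and $\mu(n)=0$ if $p^2\mid n$ for some prime $p$. *)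

theory Defs
  imports "HOL-Analysis.Analysis" "HOL-Computational_Algebra.Computational_Algebra"
begin

(* The value at 0 is 0 and plays no role. *)
definition moebius_mu :: "nat \<Rightarrow> int" where
  "moebius_mu n =
     (if \<exists>p. prime p \<and> p\<^sup>2 dvd n then 0 else (- 1) ^ card (prime_factors n))"

definition separated_orbits ::
    "('a::metric_space \<Rightarrow> 'a) \<Rightarrow> nat \<Rightarrow> real \<Rightarrow> 'a set \<Rightarrow> bool" where
  "separated_orbits f n \<epsilon> S \<longleftrightarrow>
     (\<forall>x\<in>S. \<forall>y\<in>S. x \<noteq> y \<longrightarrow> (\<exists>k<n. dist ((f ^^ k) x) ((f ^^ k) y) > \<epsilon>))"

(* ln of the maximal cardinality of an (n, \<epsilon>)-separated subset of X.
   The supremum is taken in ereal so that it is meaningful without knowing that these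
   cardinalities are bounded (on compact X with f continuous they are). *)
definition ln_separated :: "'a::metric_space set \<Rightarrow> ('a \<Rightarrow> 'a) \<Rightarrow> nat \<Rightarrow> real \<Rightarrow> ereal" where
  "ln_separated X f n \<epsilon> =
     (SUP S\<in>{S. S \<subseteq> X \<and> finite S \<and> S \<noteq> {} \<and> separated_orbits f n \<epsilon> S}. ereal (ln (real (card S))))"

definition separated_growth :: "'a::metric_space set \<Rightarrow> ('a \<Rightarrow> 'a) \<Rightarrow> real \<Rightarrow> ereal" where
  "separated_growth X f \<epsilon> = limsup (\<lambda>n. ln_separated X f n \<epsilon> / ereal (real n))"

(* Bowen-Dinaburg entropy of f restricted to a compact f-invariant set X. The limit as
   \<epsilon> tends to 0 from above is a supremum by monotonicity: see the lemma
   tendsto_topological_entropy below. *)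
definition topological_entropy :: "'a::metric_space set \<Rightarrow> ('a \<Rightarrow> 'a) \<Rightarrow> ereal" where
  "topological_entropy X f = (SUP \<epsilon>\<in>{0<..}. separated_growth X f \<epsilon>)"

lemma separated_growth_antimono:
  assumes "\<delta> \<le> \<epsilon>"
  shows "separated_growth X f \<epsilon> \<le> separated_growth X f \<delta>"
proof -
  have "ln_separated X f n \<epsilon> \<le> ln_separated X f n \<delta>" for n
    unfolding ln_separated_def separated_orbits_def
    by (rule SUP_subset_mono) (use assms in \<open>auto intro: le_less_trans\<close>, meson le_less_trans)
  then show ?thesis
    unfolding separated_growth_def
    by (intro Limsup_mono eventually_sequentiallyI[of 1] ereal_divide_right_mono) auto
qed

lemma tendsto_topological_entropy:
  "(separated_growth X f \<longlongrightarrow> topological_entropy X f) (at_right 0)"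
proof (rule increasing_tendsto)
  show "\<forall>\<^sub>F \<epsilon> in at_right 0. separated_growth X f \<epsilon> \<le> topological_entropy X f"
    unfolding topological_entropy_def
    by (auto simp: eventually_at_right_less intro!: SUP_upper
        eventually_mono[OF eventually_at_right_less[of 0]])
next
  fix l assume "l < topological_entropy X f"
  then obtain \<epsilon> where "\<epsilon> > 0" "l < separated_growth X f \<epsilon>"
    unfolding topological_entropy_def less_SUP_iff by auto
  then show "\<forall>\<^sub>F \<delta> in at_right 0. l < separated_growth X f \<delta>"
    unfolding eventually_at_right_field
    by (meson less_le_trans less_imp_le separated_growth_antimono)
qed

(* The flow generated by f on X: all observables are continuous on X only, and only the
   values of f on X matter when f maps X to X. *)
definition linearly_disjoint ::
    "(nat \<Rightarrow> complex) \<Rightarrow> 'a::topological_space set \<Rightarrow> ('a \<Rightarrow> 'a) \<Rightarrow> bool" where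
  "linearly_disjoint \<nu> X f \<longleftrightarrow>
     (\<forall>\<phi> :: 'a \<Rightarrow> complex. continuous_on X \<phi> \<longrightarrow>
        (\<forall>x\<in>X. (\<lambda>N. (1 / of_nat N) * (\<Sum>n=1..N. \<nu> n * \<phi> ((f ^^ n) x))) \<longlonglongrightarrow> 0))"

end

theory Submission
  imports Defs "HOL-Complex_Analysis.Complex_Analysis" "HOL-Number_Theory.Number_Theory" "HOL-Real_Asymp.Real_Asymp"
begin

text \<open>
The proof splits into a dynamical and an arithmetical half that meet in one notion: a sequence is
almost periodic if, for every \<open>\<epsilon>\<close>, it agrees up to \<open>\<epsilon>\<close> and outside a set of residues of proportion
at most \<open>\<epsilon>\<close> with a periodic sequence, from some index on.

Dynamics (\<open>orbit_almost_periodic\<close>). Two disjoint compact sets, each mapped by one iterate of \<open>f\<close> onto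
a superset of both, give orbits that follow every word in two letters, hence positive entropy. So
zero entropy excludes such horseshoes for all iterates. Without horseshoes a fixed point has no
homoclinic orbit (\<open>no_homoclinic\<close>): if \<open>f\<close> moves \<open>[d, z)\<close> down and fixes \<open>z\<close>, then the orbit of \<open>d\<close>
never reaches \<open>z\<close>. From this single fact it follows that an orbit that is not attracted by a
periodic orbit eventually jumps from one side of some fixed point to the other at each step
(\<open>alternation\<close>). Applied to the iterates \<open>f^(2^k)\<close>, it shows that the points \<open>f^n x\<close> with \<open>n\<close> in
different residue classes modulo \<open>2^k\<close> eventually occupy \<open>2^k\<close> pairwise disjoint intervals in
\<open>[a, b]\<close>. Only boundedly many of these can be longer than a given \<open>\<delta>\<close>, so for large \<open>k\<close> the position
of \<open>f^n x\<close> is determined up to \<open>\<delta>\<close> by \<open>n\<close> modulo \<open>2^k\<close> for all but a small proportion of residues.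
An orbit that is attracted by a periodic orbit is almost periodic for trivial reasons.

Arithmetic (\<open>moebius_periodic\<close>). The averages of \<open>\<mu>(n) c(n)\<close> tend to \<open>0\<close> for periodic \<open>c\<close>, which is a
form of the prime number theorem in arithmetic progressions. For a Dirichlet character \<open>\<xi>\<close> the series
\<open>\<Sum> \<mu>(n) \<xi>(n) / n^s\<close> is \<open>1 / L(s, \<xi>)\<close>. The \<open>L\<close>-series continues to the half plane \<open>Re s > 0\<close>, up to a pole
at \<open>1\<close> for the principal character, and has no zero on the line \<open>Re s = 1\<close>: the
inequality \<open>3 + 4 cos \<theta> + cos 2\<theta> \<ge> 0\<close> covers everything but real characters at \<open>s = 1\<close>, which are
treated with a Lambert series. Newman's contour argument then gives convergence of
\<open>\<Sum> \<mu>(n) \<xi>(n) / n\<close>, and Kronecker's lemma turns this into averages tending to \<open>0\<close>. Every function on the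
residues prime to \<open>q\<close> is a sum of joint eigenfunctions of the dilations \<open>n \<mapsto> g n\<close>, that is, of multiples
of characters; residues not prime to \<open>q\<close> are reduced to these by removing the common divisor.

The two halves are joined by \<open>almost_periodic_negligible\<close>, applied to \<open>\<phi>(f^n x)\<close>, which inherits almost
periodicity from the orbit because \<open>\<phi>\<close> is uniformly continuous on \<open>[a, b]\<close>.
\<close>

section \<open>Horseshoes force positive entropy\<close>

text \<open>Arbitrary disjoint compact sets take the place of the intervals of the usual picture: only their
positive distance and the mutual covering enter the construction of orbits.\<close>

definition horseshoe :: "real set \<Rightarrow> (real \<Rightarrow> real) \<Rightarrow> bool" where
  "horseshoe X g \<longleftrightarrow> (\<exists>J K. compact J \<and> compact K \<and> J \<subseteq> X \<and> K \<subseteq> X \<and> J \<noteq> {} \<and> J \<inter> K = {} \<and>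
     J \<union> K \<subseteq> g ` J \<and> J \<union> K \<subseteq> g ` K)"

text \<open>Words are realised from the last letter backwards: a point that follows the tail of the word lies in
\<open>J \<union> K\<close>, hence has a preimage in the set prescribed by the first letter.\<close>

lemma horseshoe_itinerary:
  assumes "J \<union> K \<subseteq> g ` J" "J \<union> K \<subseteq> g ` K" "y \<in> J"
  shows "\<exists>x\<in>J \<union> K. \<forall>i<length w. (g ^^ i) x \<in> (if w ! i then J else K)"
proof (induction w)
  case Nil
  then show ?case using assms by auto
next
  case (Cons c w)
  then obtain x' where x': "x' \<in> J \<union> K" "\<forall>i<length w. (g ^^ i) x' \<in> (if w ! i then J else K)"
    by blast
  have "x' \<in> g ` (if c then J else K)" using x' assms by auto
  then obtain x where x: "x \<in> (if c then J else K)" "g x = x'" by blast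
  have "(g ^^ i) x \<in> (if (c # w) ! i then J else K)" if "i < length (c # w)" for i
  proof (cases i)
    case (Suc j)
    then show ?thesis using x x' that by (simp add: funpow_swap1)
  qed (use x in auto)
  then show ?case using x by (intro bexI[of _ x]) (auto split: if_splits)
qed

text \<open>Points that follow different words are at some time in different sets, so \<open>\<epsilon>\<close> can be half the
distance of \<open>J\<close> and \<open>K\<close>.\<close>

lemma horseshoe_imp_separated:
  fixes f :: "real \<Rightarrow> real"
  assumes "compact J" "compact K" "J \<inter> K = {}" "J \<noteq> {}" "J \<subseteq> X" "K \<subseteq> X"
    and cov: "J \<union> K \<subseteq> (f ^^ m) ` J" "J \<union> K \<subseteq> (f ^^ m) ` K" and m: "m > 0"
  shows "\<exists>\<epsilon>>0. \<forall>n. \<exists>S. S \<subseteq> X \<and> finite S \<and> card S = 2 ^ n \<and> separated_orbits f (m * n) \<epsilon> S"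
proof -
  have "\<exists>d>0. \<forall>x\<in>J. \<forall>y\<in>K. d \<le> dist x y"
    by (rule separate_compact_closed) (use assms compact_imp_closed in auto)
  then obtain d where d: "d > 0" "\<And>x y. x \<in> J \<Longrightarrow> y \<in> K \<Longrightarrow> d \<le> dist x y" by blast
  obtain y0 where y0: "y0 \<in> J" using assms by auto
  define pt where "pt = (\<lambda>w. SOME x. x \<in> J \<union> K \<and>
     (\<forall>i<length w. ((f ^^ m) ^^ i) x \<in> (if w ! i then J else K)))"
  have pt: "pt w \<in> J \<union> K" "\<And>i. i < length w \<Longrightarrow> ((f ^^ m) ^^ i) (pt w) \<in> (if w ! i then J else K)" for w
    using someI_ex[OF horseshoe_itinerary[OF cov y0, of w, unfolded Bex_def]] unfolding pt_def by auto
  have sep: "\<exists>k<m * n. dist ((f ^^ k) (pt w)) ((f ^^ k) (pt w')) > d / 2"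
    if len: "length w = n" "length w' = n" and ne: "w \<noteq> w'" for w w' n
  proof -
    obtain i where i: "i < n" "w ! i \<noteq> w' ! i" using len ne nth_equalityI[of w w'] by auto
    have "dist (((f ^^ m) ^^ i) (pt w)) (((f ^^ m) ^^ i) (pt w')) \<ge> d"
      using pt(2)[of i w] pt(2)[of i w'] i len
        d(2)[of "((f ^^ m) ^^ i) (pt w)" "((f ^^ m) ^^ i) (pt w')"]
        d(2)[of "((f ^^ m) ^^ i) (pt w')" "((f ^^ m) ^^ i) (pt w)"]
      by (cases "w ! i") (auto simp: dist_commute)
    moreover have "m * i < m * n" using i m by simp
    ultimately show ?thesis using d(1) by (intro exI[of _ "m * i"]) (simp add: funpow_mult)
  qed
  have "\<exists>S. S \<subseteq> X \<and> finite S \<and> card S = 2 ^ n \<and> separated_orbits f (m * n) (d / 2) S" for n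
  proof -
    define W where "W = {w :: bool list. length w = n}"
    have W: "finite W" "card W = 2 ^ n"
      using finite_lists_length_eq[of "UNIV :: bool set" n] card_lists_length_eq[of "UNIV :: bool set" n]
      by (auto simp: W_def)
    have inj: "inj_on pt W"
    proof (rule inj_onI)
      fix w w' assume "w \<in> W" "w' \<in> W" "pt w = pt w'"
      then show "w = w'" using sep[of w n w'] d(1) by (auto simp: W_def)
    qed
    show ?thesis
    proof (intro exI[of _ "pt ` W"] conjI)
      show "pt ` W \<subseteq> X" using pt(1) assms by blast
      show "card (pt ` W) = 2 ^ n" using W inj by (simp add: card_image)
      show "separated_orbits f (m * n) (d / 2) (pt ` W)"
        unfolding separated_orbits_def using sep by (auto simp: W_def)
    qed (use W in auto)
  qed
  then show ?thesis using d(1) by (intro exI[of _ "d/2"]) auto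
qed

lemma horseshoe_imp_positive_entropy:
  fixes f :: "real \<Rightarrow> real"
  assumes "horseshoe X (f ^^ m)" "m > 0"
  shows "topological_entropy X f > 0"
proof -
  obtain J K where JK: "compact J" "compact K" "J \<subseteq> X" "K \<subseteq> X" "J \<noteq> {}" "J \<inter> K = {}"
     "J \<union> K \<subseteq> (f ^^ m) ` J" "J \<union> K \<subseteq> (f ^^ m) ` K"
    using assms(1) unfolding horseshoe_def by auto
  obtain \<epsilon> where \<epsilon>: "\<epsilon> > 0"
    "\<And>n. \<exists>S. S \<subseteq> X \<and> finite S \<and> card S = 2 ^ n \<and> separated_orbits f (m * n) \<epsilon> S"
    using horseshoe_imp_separated[OF JK(1,2,6,5,3,4,7,8) assms(2)] by blast
  have low: "ln_separated X f (m * n) \<epsilon> \<ge> ereal (n * ln 2)" for n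
  proof -
    obtain S where S: "S \<subseteq> X" "finite S" "card S = 2 ^ n" "separated_orbits f (m * n) \<epsilon> S"
      using \<epsilon>(2) by blast
    have "S \<noteq> {}" using S(3) by auto
    then have "ereal (ln (real (card S))) \<le> ln_separated X f (m * n) \<epsilon>"
      unfolding ln_separated_def using S by (intro SUP_upper) auto
    then show ?thesis using S(3) by (simp add: ln_realpow)
  qed
  have low': "ereal (ln 2 / m) \<le> ln_separated X f (m * n) \<epsilon> / ereal (real (m * n))" if "n > 0" for n
  proof -
    have "ereal (ln 2 / m) = ereal (n * ln 2) / ereal (real (m * n))"
      using that assms(2) by simp
    also have "\<dots> \<le> ln_separated X f (m * n) \<epsilon> / ereal (real (m * n))"
      using low[of n] that assms(2) by (intro ereal_divide_right_mono) auto
    finally show ?thesis .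
  qed
  have "0 < ereal (ln 2 / m)" using assms(2) by simp
  also have "ereal (ln 2 / m) \<le> limsup ((\<lambda>n. ln_separated X f n \<epsilon> / ereal (real n)) \<circ> (\<lambda>n. m * n))"
    using low' by (intro le_Limsup eventually_sequentiallyI[of 1]) (auto simp: o_def)
  also have "\<dots> \<le> separated_growth X f \<epsilon>"
    unfolding separated_growth_def using assms(2) by (intro limsup_subseq_mono strict_monoI) auto
  also have "\<dots> \<le> topological_entropy X f"
    unfolding topological_entropy_def using \<epsilon>(1) by (intro SUP_upper) auto
  finally show ?thesis .
qed

section \<open>Interval maps without horseshoes\<close>

lemma ivt_on:
  fixes g :: "real \<Rightarrow> real"
  assumes "continuous_on {l..u} g" "p \<in> {l..u}" "q \<in> {l..u}" "g p \<le> y" "y \<le> g q"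
  shows "\<exists>x\<in>{l..u}. g x = y"
proof -
  have "connected (g ` {l..u})" by (rule connected_continuous_image[OF assms(1) connected_Icc])
  then have "y \<in> g ` {l..u}"
    using connectedD_interval[of "g ` {l..u}" "g p" "g q" y] assms by auto
  then show ?thesis by blast
qed

lemma first_zero:
  fixes g :: "real \<Rightarrow> real"
  assumes "continuous_on {d..u} g" "g d < 0" "g u \<ge> 0" "d < u"
  obtains z where "d < z" "z \<le> u" "g z = 0" "\<And>x. x \<in> {d..<z} \<Longrightarrow> g x < 0"
proof -
  define T where "T = {d..u} \<inter> g -` {0..}"
  have "closed T" unfolding T_def by (rule continuous_closed_preimage) (use assms in auto)
  then have "compact T" by (simp add: T_def compact_eq_bounded_closed bounded_Int)
  moreover have "u \<in> T" using assms by (auto simp: T_def)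
  ultimately obtain z where z: "z \<in> T" "\<And>t. t \<in> T \<Longrightarrow> z \<le> t" using compact_attains_inf[of T] by auto
  have neg: "g x < 0" if "x \<in> {d..<z}" for x using z(2)[of x] z(1) that by (force simp: T_def)
  have "z \<noteq> d" using z(1) assms(2) by (auto simp: T_def)
  moreover have "g z = 0"
  proof -
    have "continuous_on {d..z} g" using assms(1) z(1) by (auto simp: T_def intro: continuous_on_subset)
    then obtain y where "y \<in> {d..z}" "g y = 0"
      using ivt_on[of d z g d z 0] z(1) assms(2) by (auto simp: T_def)
    then show ?thesis using neg[of y] by (cases "y = z") auto
  qed
  ultimately show ?thesis using that[of z] z(1) neg by (auto simp: T_def)
qed

locale no_horseshoe =
  fixes a b :: real and f :: "real \<Rightarrow> real"
  assumes cont: "continuous_on {a..b} f"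
    and maps: "f ` {a..b} \<subseteq> {a..b}"
    and no: "m > 0 \<Longrightarrow> \<not> horseshoe {a..b} (f ^^ m)"
begin

lemma funpow_maps: "x \<in> {a..b} \<Longrightarrow> (f ^^ n) x \<in> {a..b}"
proof (induction n)
  case (Suc n)
  then have "f ((f ^^ n) x) \<in> {a..b}" using maps by blast
  then show ?case by simp
qed simp

lemma funpow_cont: "continuous_on {a..b} (f ^^ n)"
proof (induction n)
  case (Suc n)
  then show ?case
    unfolding funpow.simps using funpow_maps cont
    by (intro continuous_on_compose) (auto intro: continuous_on_subset[OF cont])
qed auto

lemma no_horseshoe_funpow: "k > 0 \<Longrightarrow> no_horseshoe a b (f ^^ k)"
  using funpow_cont funpow_maps no by unfold_locales (auto simp: funpow_mult)

lemma funpow_reflect: "((\<lambda>x. - f (- x)) ^^ n) x = - (f ^^ n) (- x)"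
  by (induction n) auto

text \<open>Conjugation with \<open>x \<mapsto> - x\<close> exchanges left and right. It halves the case distinctions below.\<close>

lemma no_horseshoe_reflect: "no_horseshoe (- b) (- a) (\<lambda>x. - f (- x))"
proof
  show "continuous_on {- b..- a} (\<lambda>x. - f (- x))"
    by (intro continuous_intros continuous_on_compose2[OF cont]) auto
  show "(\<lambda>x. - f (- x)) ` {- b..- a} \<subseteq> {- b..- a}"
  proof
    fix y assume "y \<in> (\<lambda>x. - f (- x)) ` {- b..- a}"
    then obtain x where "x \<in> {- b..- a}" "y = - f (- x)" by blast
    then have "- x \<in> {a..b}" "y = - f (- x)" by auto
    then show "y \<in> {- b..- a}" using maps by (metis atLeastAtMost_iff image_subset_iff neg_le_iff_le)
  qed
next
  fix m :: nat assume m: "m > 0"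
  show "\<not> horseshoe {- b..- a} ((\<lambda>x. - f (- x)) ^^ m)"
  proof
    assume "horseshoe {- b..- a} ((\<lambda>x. - f (- x)) ^^ m)"
    then obtain J K where JK: "compact J" "compact K" "J \<subseteq> {- b..- a}" "K \<subseteq> {- b..- a}" "J \<noteq> {}" "J \<inter> K = {}"
     "J \<union> K \<subseteq> ((\<lambda>x. - f (- x)) ^^ m) ` J" "J \<union> K \<subseteq> ((\<lambda>x. - f (- x)) ^^ m) ` K"
      unfolding horseshoe_def by auto
    have im: "uminus ` ((\<lambda>x. - f (- x)) ^^ m) ` J = (f ^^ m) ` uminus ` J" for J
      by (auto simp: funpow_reflect image_image)
    have "horseshoe {a..b} (f ^^ m)"
      unfolding horseshoe_def
    proof (rule exI[of _ "uminus ` J"], rule exI[of _ "uminus ` K"], intro conjI)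
      show "compact (uminus ` J)" "compact (uminus ` K)"
        by (intro compact_continuous_image continuous_on_minus continuous_on_id JK)+
      show "uminus ` J \<subseteq> {a..b}" "uminus ` K \<subseteq> {a..b}" using JK(3,4) by fastforce+
      show "uminus ` J \<noteq> {}" using JK by auto
      show "uminus ` J \<inter> uminus ` K = {}" using JK(6) by (auto simp: disjoint_iff)
      have "uminus ` (J \<union> K) \<subseteq> uminus ` ((\<lambda>x. - f (- x)) ^^ m) ` J" using JK(7) by blast
      then show "uminus ` J \<union> uminus ` K \<subseteq> (f ^^ m) ` uminus ` J" unfolding im by (simp add: image_Un)
      have "uminus ` (J \<union> K) \<subseteq> uminus ` ((\<lambda>x. - f (- x)) ^^ m) ` K" using JK(8) by blast
      then show "uminus ` J \<union> uminus ` K \<subseteq> (f ^^ m) ` uminus ` K" unfolding im by (simp add: image_Un)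
    qed
    then show False using no[OF m] by blast
  qed
qed

text \<open>If the orbit of \<open>d\<close> reached \<open>z\<close>, there would be a horseshoe in \<open>[d, z]\<close>. Pulling \<open>d\<close> back along
the branch of \<open>f\<close> to the left of \<open>z\<close> gives a sequence \<open>d = e 0 < e 1 < \<dots> < z\<close> with \<open>f (e (i + 1)) = e i\<close>. The
interval \<open>K = [e (n + 2), z]\<close> expands to \<open>[d, z]\<close> in \<open>n + 2\<close> steps. The interval
\<open>J = [d, e (n + 1)]\<close> does the same: after \<open>n\<close> steps its ends are at or beyond \<open>z\<close> and at
\<open>e 1\<close>, so one of its points has arrived at \<open>z\<close>, and its right end is mapped to \<open>f d < d\<close> two steps
later.\<close>

lemma no_homoclinic:
  assumes z: "z \<in> {a..b}" "f z = z" and d: "d \<in> {a..b}" "d < z"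
    and down: "\<And>x. x \<in> {d..<z} \<Longrightarrow> f x < x"
  shows "(f ^^ n) d < z"
proof (rule ccontr)
  assume "\<not> (f ^^ n) d < z"
  then have ge: "(f ^^ n) d \<ge> z" by simp
  have pre: "\<exists>x. y < x \<and> x < z \<and> f x = y" if "d \<le> y" "y < z" for y
  proof -
    note yz = that
    have "continuous_on {y..z} f" using that z d by (intro continuous_on_subset[OF cont]) auto
    moreover have "f y < y" using that down[of y] by auto
    ultimately obtain x where "x \<in> {y..z}" "f x = y"
      using ivt_on[of y z f y z y] yz z by auto
    then show ?thesis using that z down[of y] by (intro exI[of _ x]) (auto simp: le_less)
  qed
  have "\<exists>e. \<forall>i. (d \<le> e i \<and> e i < z \<and> (i = 0 \<longrightarrow> e i = d)) \<and> (e i < e (Suc i) \<and> f (e (Suc i)) = e i)"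
  proof (rule dependent_nat_choice[where P = "\<lambda>i x. d \<le> x \<and> x < z \<and> (i = 0 \<longrightarrow> x = d)" and Q = "\<lambda>_ x y. x < y \<and> f y = x"])
    show "\<exists>x. d \<le> x \<and> x < z \<and> ((0::nat) = 0 \<longrightarrow> x = d)" using d by auto
  next
    fix x and n :: nat assume "d \<le> x \<and> x < z \<and> (n = 0 \<longrightarrow> x = d)"
    then obtain y where "x < y" "y < z" "f y = x" "d \<le> x" using pre[of x] by blast
    then show "\<exists>y. (d \<le> y \<and> y < z \<and> (Suc n = 0 \<longrightarrow> y = d)) \<and> x < y \<and> f y = x"
      by (intro exI[of _ y]) auto
  qed
  then obtain e where e: "\<And>i. d \<le> e i" "\<And>i. e i < z" "e 0 = d" "\<And>i. e i < e (Suc i)" "\<And>i. f (e (Suc i)) = e i"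
    by blast
  have pull: "(f ^^ i) (e (i + j)) = e j" for i j
    by (induction i) (simp_all add: funpow_swap1 e(5))
  have backd: "(f ^^ i) (e i) = d" for i using pull[of i 0] e(3) by simp
  have fz: "(f ^^ i) z = z" for i using z(2) by (induction i) auto
  have sub: "{l..u} \<subseteq> {a..b}" if "d \<le> l" "u \<le> z" for l u using that d z by auto
  define J K where "J = {d..e (n + 1)}" and "K = {e (n + 2)..z}"
  have covK: "{d..z} \<subseteq> (f ^^ (n + 2)) ` K"
  proof
    fix y assume y: "y \<in> {d..z}"
    have "\<exists>x\<in>{e (n+2)..z}. (f ^^ (n + 2)) x = y"
      by (rule ivt_on[where p = "e (n+2)" and q = z])
        (use y e(1,2)[of "n+2"] fz[of "n+2"] backd[of "n+2"] in \<open>auto intro!: continuous_on_subset[OF funpow_cont] simp del: funpow.simps add_2_eq_Suc' intro: sub[THEN subsetD]\<close>)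
    then show "y \<in> (f ^^ (n + 2)) ` K" unfolding K_def by blast
  qed
  have covJ: "{d..z} \<subseteq> (f ^^ (n + 2)) ` J"
  proof
    fix y assume y: "y \<in> {d..z}"
    have cJ: "continuous_on {d..e (n+1)} (f ^^ m)" for m
      using e(1,2)[of "n+1"] d z by (intro continuous_on_subset[OF funpow_cont]) auto
    have b1: "(f ^^ n) (e (n + 1)) = e 1" by (rule pull)
    have "\<exists>w\<in>{d..e (n+1)}. (f ^^ n) w = z"
      by (rule ivt_on[OF cJ, where p = "e (n+1)" and q = d]) (use e(1)[of "n+1"] e(2)[of 1] b1 ge in auto)
    then obtain w where w: "w \<in> {d..e (n+1)}" "(f ^^ n) w = z" by blast
    have "(f ^^ (n+2)) w = z" using w z(2) by simp
    moreover have "(f ^^ (n+2)) (e (n+1)) = f d"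
      using backd[of "n+1"] by simp
    moreover have "f d < d" using down[of d] d by auto
    ultimately have "\<exists>x\<in>{d..e (n+1)}. (f ^^ (n+2)) x = y"
      by (intro ivt_on[OF cJ, where p = "e (n+1)" and q = w]) (use w y e(1)[of "n+1"] in auto)
    then show "y \<in> (f ^^ (n + 2)) ` J" unfolding J_def by blast
  qed
  have "J \<subseteq> {d..z}" "K \<subseteq> {d..z}" unfolding J_def K_def using e(1,2) by (auto intro: order_trans less_imp_le)
  moreover have "J \<inter> K = {}" unfolding J_def K_def using e(4)[of "n+1"] by auto
  moreover have "J \<noteq> {}" unfolding J_def using e(1) by auto
  ultimately have "horseshoe {a..b} (f ^^ (n+2))"
    unfolding horseshoe_def using covJ covK sub[of d z]
    by (intro exI[of _ J] exI[of _ K]) (auto simp: J_def K_def)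
  then show False using no[of "n+2"] by simp
qed

text \<open>If a down-moving point \<open>d\<close> were to the left of a later up-moving point \<open>u\<close>, its orbit would have to get past the
fixed point between them that is nearest to \<open>d\<close>, against \<open>no_homoclinic\<close>.\<close>

lemma step_up_left_of_down:
  assumes x: "x \<in> {a..b}" and up: "(f ^^ Suc n) x > (f ^^ n) x"
    and down: "(f ^^ Suc m) x < (f ^^ m) x" and nm: "m < n"
  shows "(f ^^ n) x < (f ^^ m) x"
proof (rule ccontr)
  define d u where "d = (f ^^ m) x" and "u = (f ^^ n) x"
  assume "\<not> (f ^^ n) x < (f ^^ m) x"
  moreover have "d \<noteq> u" using up down unfolding d_def u_def by auto
  ultimately have du: "d < u" unfolding d_def u_def by auto
  have mem: "d \<in> {a..b}" "u \<in> {a..b}" unfolding d_def u_def using x funpow_maps by blast+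
  have fd: "f d < d" and fu: "f u > u" using up down unfolding d_def u_def by auto
  have "continuous_on {d..u} (\<lambda>x. f x - x)"
    using mem by (intro continuous_intros continuous_on_subset[OF cont]) auto
  then obtain z where z: "d < z" "z \<le> u" "f z - z = 0" "\<And>x. x \<in> {d..<z} \<Longrightarrow> f x - x < 0"
    using first_zero[of d u "\<lambda>x. f x - x"] fd fu du by auto
  have "(f ^^ (n - m)) d < z"
    using z mem by (intro no_homoclinic) auto
  moreover have "(f ^^ (n - m)) d = u"
    using nm unfolding d_def u_def by (metis funpow_add comp_apply le_add_diff_inverse2 less_imp_le)
  ultimately show False using z by auto
qed

end

context no_horseshoe
begin

text \<open>If the up-moving point comes first, reflection reverses the roles.\<close>

lemma up_left_of_down:
  assumes x: "x \<in> {a..b}" and up: "(f ^^ Suc n) x > (f ^^ n) x"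
    and down: "(f ^^ Suc m) x < (f ^^ m) x"
  shows "(f ^^ n) x < (f ^^ m) x"
proof -
  consider "m < n" | "n < m" using up down by (cases m n rule: linorder_cases) auto
  then show ?thesis
  proof cases
    case 2
    interpret r: no_horseshoe "- b" "- a" "\<lambda>x. - f (- x)" by (rule no_horseshoe_reflect)
    show ?thesis
      using r.step_up_left_of_down[of "- x" m n] x up down 2 unfolding funpow_reflect by auto
  qed (use step_up_left_of_down assms in blast)
qed

end

section \<open>Orbits alternate around a fixed point\<close>

text \<open>Convergence along the multiples of \<open>p\<close> entails convergence along each residue class modulo \<open>p\<close>, by
continuity of \<open>f\<close>.\<close>

definition asymptotically_periodic :: "(real \<Rightarrow> real) \<Rightarrow> real \<Rightarrow> bool" where
  "asymptotically_periodic f x \<longleftrightarrow> (\<exists>p>0. convergent (\<lambda>n. (f ^^ (p * n)) x))"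

context no_horseshoe
begin

lemma convergent_funpow:
  assumes "convergent (\<lambda>n. X n)" "\<And>n. X n \<in> {a..b}"
  shows "convergent (\<lambda>n. (f ^^ s) (X n))"
proof -
  obtain L where L: "X \<longlonglongrightarrow> L" using assms(1) by (auto simp: convergent_def)
  have "L \<in> {a..b}" using closed_sequentially[OF closed_real_atLeastAtMost _ L] assms(2) by auto
  then have "(\<lambda>n. (f ^^ s) (X n)) \<longlonglongrightarrow> (f ^^ s) L"
    using continuous_on_tendsto_compose[OF funpow_cont L] assms(2) by auto
  then show ?thesis by (auto simp: convergent_def)
qed

lemma asymptotically_periodic_if_subseq:
  assumes x: "x \<in> {a..b}" and p: "p > 0" and c: "convergent (\<lambda>i. (f ^^ (r + p * i)) x)"
  shows "asymptotically_periodic f x"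
proof -
  have "convergent (\<lambda>i. (f ^^ (p * r - r)) ((f ^^ (r + p * i)) x))"
    by (rule convergent_funpow) (use c x funpow_maps in auto)
  moreover have "(f ^^ (p * r - r)) ((f ^^ (r + p * i)) x) = (f ^^ (p * (i + r))) x" for i
  proof -
    have "r \<le> p * r" using p by simp
    then have "p * r - r + (r + p * i) = p * (i + r)" by (simp add: add_mult_distrib2 del: mult_le_cancel1)
    then show ?thesis by (metis funpow_add comp_apply)
  qed
  ultimately have "convergent (\<lambda>i. (f ^^ (p * (i + r))) x)" by simp
  then have "convergent (\<lambda>i. (f ^^ (p * i)) x)"
    using convergent_ignore_initial_segment[of "\<lambda>i. (f ^^ (p * i)) x" r] by simp
  then show ?thesis unfolding asymptotically_periodic_def using p by blast
qed

lemma asymptotically_periodic_funpow: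
  assumes x: "x \<in> {a..b}" and p: "p > 0" and c: "asymptotically_periodic (f ^^ p) ((f ^^ r) x)"
  shows "asymptotically_periodic f x"
proof -
  obtain q where q: "q > 0" "convergent (\<lambda>n. ((f ^^ p) ^^ (q * n)) ((f ^^ r) x))"
    using c unfolding asymptotically_periodic_def by blast
  have "((f ^^ p) ^^ (q * n)) ((f ^^ r) x) = (f ^^ (r + (p * q) * n)) x" for n
    by (simp only: funpow_mult add.commute[of r] funpow_add comp_apply mult.assoc)
  then show ?thesis using q p asymptotically_periodic_if_subseq[OF x, of "p * q" r] by simp
qed

lemma orbit_moves:
  assumes x: "x \<in> {a..b}" and na: "\<not> asymptotically_periodic f x" and p: "p > 0"
  shows "(f ^^ (n + p)) x \<noteq> (f ^^ n) x"
proof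
  assume eq: "(f ^^ (n + p)) x = (f ^^ n) x"
  have "(f ^^ (n + p * i)) x = (f ^^ n) x" for i
  proof (induction i)
    case (Suc i)
    have "n + p * Suc i = p + (n + p * i)" by simp
    then have "(f ^^ (n + p * Suc i)) x = (f ^^ p) ((f ^^ (n + p * i)) x)" by (metis funpow_add comp_apply)
    also have "\<dots> = (f ^^ (n + p)) x" using Suc by (metis add.commute funpow_add comp_apply)
    finally show ?case using eq by simp
  qed simp
  then show False using asymptotically_periodic_if_subseq[OF x p, of n] na by (simp add: convergent_const)
qed

lemma orbit_descends:
  assumes x: "x \<in> {a..b}" and na: "\<not> asymptotically_periodic f x" and p: "p > 0"
  shows "\<exists>i. (f ^^ (r + p * i + p)) x < (f ^^ (r + p * i)) x"
proof (rule ccontr)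
  assume "\<not> ?thesis"
  then have le: "(f ^^ (r + p * i)) x \<le> (f ^^ (r + p * i + p)) x" for i by (auto simp: not_less)
  have "incseq (\<lambda>i. (f ^^ (r + p * i)) x)"
    using le by (intro incseq_SucI) (metis add.assoc add.commute mult_Suc_right)
  moreover have "(f ^^ (r + p * i)) x \<le> b" for i using funpow_maps[OF x] by auto
  ultimately have "convergent (\<lambda>i. (f ^^ (r + p * i)) x)"
    unfolding convergent_def by (metis incseq_convergent)
  then show False using asymptotically_periodic_if_subseq[OF x p] na by blast
qed

text \<open>The up-moving points of the orbit lie to the left of the down-moving ones; the fixed point is the
largest point that is moved up weakly and lies to the left of all the down-moving ones.\<close>

lemma separating_fixed_point:
  assumes x: "x \<in> {a..b}" and na: "\<not> asymptotically_periodic f x"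
  obtains z where "z \<in> {a..b}" "f z = z" "\<And>n. (f ^^ n) x \<noteq> z"
    "\<And>n. (f ^^ n) x < z \<Longrightarrow> (f ^^ n) x < (f ^^ Suc n) x"
    "\<And>n. (f ^^ n) x > z \<Longrightarrow> (f ^^ n) x > (f ^^ Suc n) x"
proof -
  define X where "X n = (f ^^ n) x" for n
  have X: "X n \<in> {a..b}" for n using funpow_maps[OF x] by (simp add: X_def)
  have fX: "f (X n) = X (Suc n)" for n by (simp add: X_def)
  have move: "X (Suc n) \<noteq> X n" for n using orbit_moves[OF x na, of 1 n] by (simp add: X_def)
  have ud: "X n < X m" if "X n < X (Suc n)" "X (Suc m) < X m" for n m
    using up_left_of_down[OF x, of n m] that by (simp add: X_def)
  interpret r: no_horseshoe "- b" "- a" "\<lambda>x. - f (- x)" by (rule no_horseshoe_reflect)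
  obtain i where i: "X (Suc i) < X i"
    using orbit_descends[OF x na, of 1 0] by (auto simp: X_def)
  have "\<not> asymptotically_periodic (\<lambda>x. - f (- x)) (- x)"
    using na unfolding asymptotically_periodic_def funpow_reflect by (simp add: convergent_minus_iff[symmetric])
  then obtain j where j: "X j < X (Suc j)"
    using r.orbit_descends[of "- x" 1 0] x by (auto simp: X_def funpow_reflect)
  define T where "T = {t \<in> {a..b}. f t \<ge> t \<and> (\<forall>m. X (Suc m) < X m \<longrightarrow> t \<le> X m)}"
  have "T = {a..b} \<inter> (\<lambda>t. f t - t) -` {0..} \<inter> (\<Inter>m\<in>{m. X (Suc m) < X m}. {..X m})"
    by (auto simp: T_def)
  also have "closed \<dots>"
    by (intro closed_Int closed_INT ballI continuous_closed_preimage continuous_intros cont) auto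
  finally have "compact T" by (auto simp: compact_eq_bounded_closed T_def intro: bounded_subset[OF bounded_closed_interval[of a b]])
  moreover have UT: "X n \<in> T" if "X n < X (Suc n)" for n
    using that ud[OF that] X fX[of n] by (auto simp: T_def intro: less_imp_le)
  ultimately obtain z where z: "z \<in> T" "\<And>t. t \<in> T \<Longrightarrow> t \<le> z"
    using compact_attains_sup[of T] j by blast
  have zab: "z \<in> {a..b}" using z(1) by (simp add: T_def)
  have "f z = z"
  proof (rule ccontr)
    assume "f z \<noteq> z"
    then have fz: "f z > z" using z(1) by (auto simp: T_def)
    have zX: "z < X m" if "X (Suc m) < X m" for m
      using z(1) fz fX[of m] that by (force simp: T_def le_less)
    have "continuous_on {z..X i} (\<lambda>x. x - f x)"
      using zab X[of i] by (intro continuous_intros continuous_on_subset[OF cont]) auto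
    then obtain y where y: "z < y" "y \<le> X i" "y - f y = 0" "\<And>x. x \<in> {z..<y} \<Longrightarrow> x - f x < 0"
      using first_zero[of z "X i" "\<lambda>x. x - f x"] fz i fX[of i] zX[OF i] by auto
    have "y \<le> X m" if "X (Suc m) < X m" for m
      using y(4)[of "X m"] zX[OF that] fX[of m] that by (cases "X m < y") auto
    then have "y \<in> T" using y zab X[of i] by (auto simp: T_def)
    then show False using z(2) y(1) by fastforce
  qed
  moreover have "X n \<noteq> z" for n using move[of n] fX[of n] \<open>f z = z\<close> by auto
  moreover have "X n < X (Suc n)" if "X n < z" for n
    using that z(1) move[of n] by (metis (mono_tags, lifting) T_def linorder_not_less mem_Collect_eq order_le_less)
  moreover have "X n > X (Suc n)" if "X n > z" for n
    using that z(2)[OF UT, of n] move[of n] by force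
  ultimately show ?thesis using that[of z] zab unfolding X_def by blast
qed

lemma f_funpow2: "(f ^^ 2) x = f (f x)"
  by (simp add: numeral_2_eq_2)

text \<open>This is \<open>no_homoclinic\<close> for \<open>f\<^sup>2\<close>, with \<open>z'\<close> the first fixed point of \<open>f\<^sup>2\<close> after \<open>y\<close>.\<close>

lemma two_step_return:
  assumes z: "z \<in> {a..b}" "f z = z" and y: "y \<in> {a..b}" "y < z" "f (f y) < y"
  shows "\<exists>z'. y < z' \<and> z' \<le> z \<and> f (f z') = z' \<and> (\<forall>t\<in>{y..<z'}. \<forall>i. ((f ^^ 2) ^^ i) t < z')"
proof -
  interpret g: no_horseshoe a b "f ^^ 2" by (rule no_horseshoe_funpow) simp
  have "continuous_on {y..z} (\<lambda>x. (f ^^ 2) x - x)"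
    using y z by (intro continuous_intros continuous_on_subset[OF g.cont]) auto
  then obtain z' where z': "y < z'" "z' \<le> z" "(f ^^ 2) z' - z' = 0" "\<And>x. x \<in> {y..<z'} \<Longrightarrow> (f ^^ 2) x - x < 0"
    using first_zero[of y z "\<lambda>x. (f ^^ 2) x - x"] y z by (auto simp: f_funpow2)
  have "((f ^^ 2) ^^ i) t < z'" if "t \<in> {y..<z'}" for t i
    by (rule g.no_homoclinic) (use z' that y z in auto)
  then show ?thesis using z' by (intro exI[of _ z']) (auto simp: f_funpow2)
qed

text \<open>Write \<open>y\<close> for the point at time \<open>n\<close>: it jumps over \<open>z\<close> and comes back to the left of itself. By
\<open>no_homoclinic\<close> for \<open>f\<^sup>2\<close>, the points reached from \<open>y\<close> in an even number of steps stay to the left of a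
fixed point \<open>z' \<le> z\<close> of \<open>f\<^sup>2\<close>. If one of them, \<open>v\<close>, failed to jump over \<open>z\<close>, it would move up twice, so
\<open>v < y\<close> by \<open>up_left_of_down\<close> for \<open>f\<^sup>2\<close>. Then some \<open>w\<close> in \<open>[v, y]\<close> is mapped to \<open>z\<close>, and some \<open>t\<close>
in \<open>[y, z')\<close> is mapped to \<open>w\<close> by an iterate of \<open>f\<^sup>2\<close>: the orbit of \<open>t\<close> under \<open>f\<^sup>2\<close> would reach
\<open>z \<ge> z'\<close>, which \<open>no_homoclinic\<close> forbids.\<close>

lemma expanding_turn_alternates:
  assumes x: "x \<in> {a..b}" and z: "z \<in> {a..b}" "f z = z"
    and ne: "\<And>n. (f ^^ n) x \<noteq> z"
    and up: "\<And>n. (f ^^ n) x < z \<Longrightarrow> (f ^^ n) x < (f ^^ Suc n) x"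
    and turn: "(f ^^ n) x < z" "(f ^^ (n + 2)) x < (f ^^ n) x"
  shows "(f ^^ (n + 2 * r)) x < z \<and> z < (f ^^ (n + 2 * r + 1)) x"
proof -
  define y where "y = (f ^^ n) x"
  have y: "y \<in> {a..b}" "y < z" using turn funpow_maps[OF x] by (auto simp: y_def)
  have orb: "(f ^^ (n + k)) x = (f ^^ k) y" for k unfolding y_def by (metis add.commute funpow_add comp_apply)
  have orb2: "(f ^^ (n + 2 * k)) x = ((f ^^ 2) ^^ k) y" for k using orb[of "2 * k"] by (simp add: funpow_mult)
  have fy2: "f (f y) < y" using turn orb[of 2] unfolding y_def by (simp add: f_funpow2 y_def[symmetric])
  interpret g: no_horseshoe a b "f ^^ 2" by (rule no_horseshoe_funpow) simp
  obtain z' where z': "y < z'" "z' \<le> z" "f (f z') = z'"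
    and pull: "\<And>t i. t \<in> {y..<z'} \<Longrightarrow> ((f ^^ 2) ^^ i) t < z'"
    using two_step_return[OF z y fy2] by blast
  have below: "((f ^^ 2) ^^ k) y < z'" for k using pull[of y k] z' by auto
  have left: "(f ^^ (n + 2 * r)) x < z" using below[of r] z' orb2[of r] by simp
  have fy: "f y > z"
  proof (rule ccontr)
    assume "\<not> f y > z"
    then have "f y < z" using ne[of "n + 1"] orb[of 1] by auto
    then have "f y < f (f y)" using up[of "n + 1"] orb[of 1] orb[of 2] by (simp add: f_funpow2)
    moreover have "y < f y" using up[of n] turn orb[of 0] orb[of 1] by simp
    ultimately show False using fy2 by simp
  qed
  moreover have "z < (f ^^ (n + 2 * r + 1)) x"
  proof (rule ccontr)
    define v where "v = ((f ^^ 2) ^^ r) y"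
    have vab: "v \<in> {a..b}" unfolding v_def using g.funpow_maps y by blast
    have v: "v = (f ^^ (n + 2 * r)) x" "f v = (f ^^ (n + 2 * r + 1)) x" "f (f v) = (f ^^ (n + 2 * r + 2)) x"
      using orb2[of r] by (simp_all add: v_def)
    assume "\<not> z < (f ^^ (n + 2 * r + 1)) x"
    then have fv: "f v < z" using ne[of "n + 2 * r + 1"] v by (auto simp: not_less le_less)
    have "v < f v" using up[of "n + 2 * r"] left v by simp
    also have "f v < f (f v)" using up[of "n + 2 * r + 1"] fv v by simp
    finally have "((f ^^ 2) ^^ r) y < ((f ^^ 2) ^^ Suc r) y" by (simp add: v_def f_funpow2)
    moreover have "((f ^^ 2) ^^ Suc 0) y < ((f ^^ 2) ^^ 0) y" using fy2 by (simp add: f_funpow2)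
    ultimately have vy: "v < y" using g.up_left_of_down[OF y(1), of r 0] by (simp add: v_def)
    have "continuous_on {v..y} f" using vab y by (intro continuous_on_subset[OF cont]) auto
    then obtain w where w: "w \<in> {v..y}" "f w = z"
      using ivt_on[of v y f v y z] vy fv fy by auto
    have "w \<noteq> y" using w fy by auto
    have fixz: "((f ^^ 2) ^^ k) z' = z'" for k using z'(3) by (induction k) (auto simp: f_funpow2)
    have "continuous_on {y..z'} ((f ^^ 2) ^^ r)"
      using y z' z by (intro continuous_on_subset[OF g.funpow_cont]) auto
    then obtain t where t: "t \<in> {y..z'}" "((f ^^ 2) ^^ r) t = w"
      using ivt_on[of y z' "(f ^^ 2) ^^ r" y z' w] w z' fixz[of r] by (auto simp: v_def)
    have "t \<noteq> z'" using t fixz[of r] w z' by auto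
    then have "((f ^^ 2) ^^ Suc r) t < z'" using t by (intro pull) auto
    moreover have "((f ^^ 2) ^^ Suc r) t = z" using t w z by (simp add: f_funpow2)
    ultimately show False using z' by simp
  qed
  ultimately show ?thesis using left by simp
qed

end

context no_horseshoe
begin

lemma asymptotically_periodic_reflect:
  "asymptotically_periodic (\<lambda>x. - f (- x)) (- x) \<longleftrightarrow> asymptotically_periodic f x"
  unfolding asymptotically_periodic_def funpow_reflect by (simp add: convergent_minus_iff[symmetric])

lemma orbit_ascends:
  assumes x: "x \<in> {a..b}" and na: "\<not> asymptotically_periodic f x" and p: "p > 0"
  shows "\<exists>i. (f ^^ (r + p * i)) x < (f ^^ (r + p * i + p)) x"
proof -
  interpret r: no_horseshoe "- b" "- a" "\<lambda>x. - f (- x)" by (rule no_horseshoe_reflect)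
  show ?thesis using r.orbit_descends[of "- x" p r] x na p
    unfolding funpow_reflect asymptotically_periodic_reflect by auto
qed

text \<open>The hypothesis \<open>contr\<close> says that two steps never bring a point on the left further away from
\<open>z\<close>. Consider the first time \<open>k\<close> at which the orbit falls below the left point at time \<open>n\<close>, and the last earlier
time \<open>l\<close> at which it is on the left. In between the orbit descends on the right of \<open>z\<close>, so some \<open>p\<close>
between the point at time \<open>l\<close> and \<open>z\<close> is mapped to the point at time \<open>k - 1\<close>. As \<open>f\<^sup>2\<close> moves \<open>p\<close> down, every second
point of the orbit stays on the left from time \<open>k\<close> on, where two steps never descend. Then \<open>x\<close> would be
asymptotically periodic.\<close>

lemma contracting_side_monotone:
  assumes x: "x \<in> {a..b}" and na: "\<not> asymptotically_periodic f x"
    and z: "z \<in> {a..b}" "f z = z" and ne: "\<And>n. (f ^^ n) x \<noteq> z"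
    and up: "\<And>n. (f ^^ n) x < z \<Longrightarrow> (f ^^ n) x < (f ^^ Suc n) x"
    and down: "\<And>n. (f ^^ n) x > z \<Longrightarrow> (f ^^ n) x > (f ^^ Suc n) x"
    and contr: "\<And>n. (f ^^ n) x < z \<Longrightarrow> (f ^^ n) x \<le> (f ^^ (n + 2)) x"
    and nm: "n < m" "(f ^^ n) x < z" "(f ^^ m) x < z"
  shows "(f ^^ n) x \<le> (f ^^ m) x"
proof (rule ccontr)
  define X where "X n = (f ^^ n) x" for n
  have X: "X n \<in> {a..b}" for n using funpow_maps[OF x] by (simp add: X_def)
  have fX: "f (X n) = X (Suc n)" for n by (simp add: X_def)
  define bad where "bad m \<longleftrightarrow> n < m \<and> X m < z \<and> X m < X n" for m
  assume "\<not> ?thesis"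
  then have "bad m" using nm by (simp add: bad_def X_def)
  define k where "k = (LEAST m. bad m)"
  have k: "bad k" "\<And>i. i < k \<Longrightarrow> \<not> bad i"
    unfolding k_def by (rule LeastI[of bad, OF \<open>bad m\<close>], rule not_less_Least)
  define l where "l = Max {i. i < k \<and> X i < z}"
  have fin: "finite {i. i < k \<and> X i < z}" by simp
  have nin: "n \<in> {i. i < k \<and> X i < z}" using k(1) nm by (auto simp: bad_def X_def)
  have l: "l < k" "X l < z" "n \<le> l"
  proof -
    have "l \<in> {i. i < k \<and> X i < z}" unfolding l_def by (rule Max_in[OF fin]) (use nin in blast)
    then show "l < k" "X l < z" by auto
    show "n \<le> l" unfolding l_def by (rule Max_ge[OF fin nin])
  qed
  have right: "X i > z" if "l < i" "i < k" for i
  proof (rule ccontr)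
    assume "\<not> X i > z"
    then have "X i < z" using ne[of i] by (simp add: X_def)
    then have "i \<le> l" unfolding l_def using that by (intro Max_ge) auto
    then show False using that by simp
  qed
  have Xl: "X n \<le> X l" using k(2)[OF l(1)] l by (cases "l = n") (auto simp: bad_def)
  have kl: "Suc l < k"
  proof (rule ccontr)
    assume "\<not> Suc l < k"
    then have "k = Suc l" using l by simp
    then show False using up[of l] l Xl k(1) by (simp add: X_def bad_def)
  qed
  have chain: "Suc l + j < k \<Longrightarrow> X (Suc l + j) \<le> X (Suc l)" for j
  proof (induction j)
    case (Suc j)
    then have "X (Suc l + j) > z" by (intro right) auto
    then show ?case using down[of "Suc l + j"] Suc by (simp add: X_def)
  qed simp
  obtain j where "k = Suc (Suc l + j)" using kl less_imp_Suc_add by blast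
  then have "X (k - 1) \<le> X (Suc l)" using chain[of j] by simp
  moreover have kz: "X (k - 1) > z" using right[of "k - 1"] kl by simp
  moreover have "continuous_on {X l..z} f" using X[of l] z by (intro continuous_on_subset[OF cont]) auto
  ultimately obtain p where p: "p \<in> {X l..z}" "f p = X (k - 1)"
    using ivt_on[of "X l" z f z "X l" "X (k - 1)"] z l fX[of l] by auto
  have "p \<noteq> z" using p kz z by auto
  have ffp: "f (f p) = X k" using p fX[of "k - 1"] kl by simp
  have "p \<in> {a..b}" "p < z" "f (f p) < p"
    using p \<open>p \<noteq> z\<close> X[of l] z ffp Xl k(1) by (auto simp: bad_def)
  from two_step_return[OF z this]
  obtain z' where z': "z' \<le> z" "\<And>i. ((f ^^ 2) ^^ i) p < z'" using \<open>p < z\<close> by fastforce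
  have "((f ^^ 2) ^^ Suc i) p = X (k + 2 * i)" for i
  proof -
    have "((f ^^ 2) ^^ Suc i) p = ((f ^^ 2) ^^ i) (X k)" by (simp only: funpow_Suc_right comp_apply f_funpow2 ffp)
    also have "\<dots> = X (k + 2 * i)" by (simp add: X_def funpow_mult funpow_add[symmetric, unfolded fun_eq_iff comp_apply, rule_format] add.commute)
    finally show ?thesis .
  qed
  then have "X (k + 2 * i) < z" for i using z' by (metis less_le_trans)
  then have "X (k + 2 * i) \<le> X (k + 2 * i + 2)" for i using contr[of "k + 2 * i"] by (simp add: X_def)
  moreover obtain i where "X (k + 2 * i + 2) < X (k + 2 * i)"
    using orbit_descends[OF x na, of 2 k] by (auto simp: X_def)
  ultimately show False by (simp add: not_less[symmetric])
qed

end

lemma mono_along_converges: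
  fixes X :: "nat \<Rightarrow> real"
  assumes mono: "\<And>n m. P n \<Longrightarrow> P m \<Longrightarrow> n < m \<Longrightarrow> X n \<le> X m" and bd: "\<And>n. X n \<le> B"
  shows "\<exists>\<alpha>. \<forall>\<epsilon>>0. \<exists>N. \<forall>n\<ge>N. P n \<longrightarrow> \<bar>X n - \<alpha>\<bar> < \<epsilon>"
proof (cases "\<exists>n. P n")
  case True
  have bdd: "bdd_above (X ` Collect P)" using bd by (auto intro!: bdd_aboveI[of _ B])
  define \<alpha> where "\<alpha> = Sup (X ` Collect P)"
  have "\<exists>N. \<forall>n\<ge>N. P n \<longrightarrow> \<bar>X n - \<alpha>\<bar> < \<epsilon>" if "\<epsilon> > 0" for \<epsilon>
  proof -
    have "\<alpha> - \<epsilon> < Sup (X ` Collect P)" using that by (simp add: \<alpha>_def)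
    then obtain n0 where n0: "P n0" "\<alpha> - \<epsilon> < X n0"
      using less_cSup_iff[OF _ bdd] True by auto
    have "\<bar>X n - \<alpha>\<bar> < \<epsilon>" if "n \<ge> n0" "P n" for n
    proof -
      have "X n0 \<le> X n" using mono[of n0 n] that n0 by (cases "n = n0") auto
      moreover have "X n \<le> \<alpha>" unfolding \<alpha>_def using that by (intro cSup_upper bdd) auto
      ultimately show ?thesis using n0 \<open>\<epsilon> > 0\<close> by simp
    qed
    then show ?thesis by blast
  qed
  then show ?thesis by blast
qed auto

context no_horseshoe
begin

text \<open>Continuity of \<open>f\<close> along the infinitely many times at which a point near \<open>\<alpha>\<close> is followed by a point near
\<open>\<beta>\<close>. The predicates \<open>P\<close> and \<open>Q\<close> will select a side of the fixed point.\<close>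

lemma limit_transition:
  assumes x: "x \<in> {a..b}" and inf: "infinite {n. P n \<and> Q (Suc n)}"
    and lim: "\<And>\<epsilon>. \<epsilon> > 0 \<Longrightarrow> \<exists>N. \<forall>n\<ge>N. P n \<longrightarrow> \<bar>(f ^^ n) x - \<alpha>\<bar> < \<epsilon>"
      "\<And>\<epsilon>. \<epsilon> > 0 \<Longrightarrow> \<exists>N. \<forall>n\<ge>N. Q n \<longrightarrow> \<bar>(f ^^ n) x - \<beta>\<bar> < \<epsilon>"
  shows "f \<alpha> = \<beta>"
proof -
  obtain s :: "nat \<Rightarrow> nat" where s: "strict_mono s" "\<And>i. P (s i) \<and> Q (Suc (s i))"
    using infinite_enumerate[OF inf] by auto
  have 1: "(\<lambda>i. (f ^^ s i) x) \<longlonglongrightarrow> \<alpha>"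
  proof (rule LIMSEQ_I)
    fix r :: real assume "r > 0"
    from lim(1)[OF this] obtain N where "\<forall>n\<ge>N. P n \<longrightarrow> \<bar>(f ^^ n) x - \<alpha>\<bar> < r" by blast
    then show "\<exists>no. \<forall>n\<ge>no. norm ((f ^^ s n) x - \<alpha>) < r"
      using s seq_suble[OF s(1)] by (intro exI[of _ N] allI impI) (metis order_trans real_norm_def)
  qed
  have 2: "(\<lambda>i. (f ^^ Suc (s i)) x) \<longlonglongrightarrow> \<beta>"
  proof (rule LIMSEQ_I)
    fix r :: real assume "r > 0"
    from lim(2)[OF this] obtain N where "\<forall>n\<ge>N. Q n \<longrightarrow> \<bar>(f ^^ n) x - \<beta>\<bar> < r" by blast
    then show "\<exists>no. \<forall>n\<ge>no. norm ((f ^^ Suc (s n)) x - \<beta>) < r"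
      using s seq_suble[OF s(1)]
      by (intro exI[of _ N] allI impI) (metis order_trans le_SucI real_norm_def)
  qed
  have "\<alpha> \<in> {a..b}"
    using closed_sequentially[OF closed_real_atLeastAtMost _ 1] funpow_maps[OF x] by auto
  then have "(\<lambda>i. f ((f ^^ s i) x)) \<longlonglongrightarrow> f \<alpha>"
    using continuous_on_tendsto_compose[OF cont 1] funpow_maps[OF x] by auto
  then show ?thesis using 2 LIMSEQ_unique by auto
qed

text \<open>If the orbit ever makes a turn that leads further away from \<open>z\<close>, \<open>expanding_turn_alternates\<close> or its
mirror image applies. Otherwise the points on the left increase to some \<open>\<alpha>\<close> and those on the right
decrease to some \<open>\<beta>\<close>. Both kinds of crossings occur infinitely often, so \<open>f\<close> exchanges \<open>\<alpha>\<close> and \<open>\<beta>\<close>. They are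
different, as the orbit does not converge; hence \<open>f\<close> fixes neither of them, and steps
that stay on one side cease.\<close>

lemma alternation:
  assumes x: "x \<in> {a..b}" and na: "\<not> asymptotically_periodic f x"
  shows "\<exists>z N. \<forall>n\<ge>N. (f ^^ n) x \<noteq> z \<and> ((f ^^ n) x < z \<longleftrightarrow> z < (f ^^ Suc n) x)"
proof -
  obtain z where z: "z \<in> {a..b}" "f z = z" and ne: "\<And>n. (f ^^ n) x \<noteq> z"
    and up: "\<And>n. (f ^^ n) x < z \<Longrightarrow> (f ^^ n) x < (f ^^ Suc n) x"
    and down: "\<And>n. (f ^^ n) x > z \<Longrightarrow> (f ^^ n) x > (f ^^ Suc n) x"
    by (rule separating_fixed_point[OF x na]) (rule that; assumption)
  define X where "X n = (f ^^ n) x" for n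
  have X: "X n \<in> {a..b}" for n using funpow_maps[OF x] by (simp add: X_def)
  interpret r: no_horseshoe "- b" "- a" "\<lambda>x. - f (- x)" by (rule no_horseshoe_reflect)
  have rx: "- x \<in> {- b..- a}" "- z \<in> {- b..- a}" "- f (- (- z)) = - z" using x z by auto
  have na': "\<not> asymptotically_periodic (\<lambda>x. - f (- x)) (- x)" 
    using na asymptotically_periodic_reflect by blast
  have rX: "((\<lambda>x. - f (- x)) ^^ n) (- x) = - X n" for n by (simp add: funpow_reflect X_def)
  have rne: "((\<lambda>x. - f (- x)) ^^ n) (- x) \<noteq> - z" for n using ne[of n] unfolding rX X_def by simp
  have rup: "((\<lambda>x. - f (- x)) ^^ n) (- x) < - z \<Longrightarrow> ((\<lambda>x. - f (- x)) ^^ n) (- x) < ((\<lambda>x. - f (- x)) ^^ Suc n) (- x)" for n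
    using down[of n] unfolding rX unfolding X_def by simp
  have rdown: "((\<lambda>x. - f (- x)) ^^ n) (- x) > - z \<Longrightarrow> ((\<lambda>x. - f (- x)) ^^ n) (- x) > ((\<lambda>x. - f (- x)) ^^ Suc n) (- x)" for n
    using up[of n] unfolding rX unfolding X_def by simp
  show ?thesis
  proof (cases "\<exists>n. X n < z \<and> X (n + 2) < X n \<or> X n > z \<and> X (n + 2) > X n")
    case True
    then obtain n where n: "X n < z \<and> X (n + 2) < X n \<or> X n > z \<and> X (n + 2) > X n" by blast
    then have alt: "(\<forall>k. X (n + 2 * k) < z \<and> z < X (n + 2 * k + 1)) \<or> (\<forall>k. z < X (n + 2 * k) \<and> X (n + 2 * k + 1) < z)"
    proof
      assume "X n < z \<and> X (n + 2) < X n"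
      then have "X (n + 2 * k) < z \<and> z < X (n + 2 * k + 1)" for k
        using expanding_turn_alternates[OF x z ne up, of n k] unfolding X_def by blast
      then show ?thesis by blast
    next
      assume "X n > z \<and> X (n + 2) > X n"
      then have "z < X (n + 2 * k) \<and> X (n + 2 * k + 1) < z" for k
        using r.expanding_turn_alternates[OF rx rne rup, of n k] unfolding rX neg_less_iff_less by blast
      then show ?thesis by blast
    qed
    have "X m \<noteq> z \<and> (X m < z \<longleftrightarrow> z < X (Suc m))" if "m \<ge> n" for m
    proof -
      define k where "k = (m - n) div 2"
      have "m = n + 2 * k \<and> Suc m = n + 2 * k + 1 \<or> m = n + 2 * k + 1 \<and> Suc m = n + 2 * Suc k"
        using that unfolding k_def by presburger
      moreover have "X (n + 2 * k) < z \<and> z < X (n + 2 * k + 1) \<and> X (n + 2 * Suc k) < z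
          \<or> z < X (n + 2 * k) \<and> X (n + 2 * k + 1) < z \<and> z < X (n + 2 * Suc k)"
        using alt by blast
      ultimately show ?thesis by (elim disjE conjE) (simp_all only: less_imp_neq[symmetric] less_imp_neq less_not_sym simp_thms not_False_eq_True)
    qed
    then show ?thesis unfolding X_def by blast
  next
    case False
    then have contr: "X n < z \<Longrightarrow> X n \<le> X (n + 2)" "X n > z \<Longrightarrow> X n \<ge> X (n + 2)" for n
      by (metis not_less)+
    have monoL: "X n \<le> X m" if "X n < z" "X m < z" "n < m" for n m
      using contracting_side_monotone[OF x na z ne up down, of n m] contr(1) that unfolding X_def by blast
    have monoR: "- X n \<le> - X m" if "X n > z" "X m > z" "n < m" for n m
    proof -
      have "((\<lambda>x. - f (- x)) ^^ k) (- x) < - z \<Longrightarrow> ((\<lambda>x. - f (- x)) ^^ k) (- x) \<le> ((\<lambda>x. - f (- x)) ^^ (k + 2)) (- x)" for k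
        using contr(2)[of k] unfolding rX by simp
      from r.contracting_side_monotone[OF rx(1) na' rx(2,3) rne rup rdown this that(3)] that
      show ?thesis unfolding rX by simp
    qed
    obtain \<alpha> where \<alpha>: "\<And>\<epsilon>. \<epsilon> > 0 \<Longrightarrow> \<exists>N. \<forall>n\<ge>N. X n < z \<longrightarrow> \<bar>X n - \<alpha>\<bar> < \<epsilon>"
      using mono_along_converges[of "\<lambda>n. X n < z" X b] monoL X by auto
    obtain \<beta>' where \<beta>': "\<And>\<epsilon>. \<epsilon> > 0 \<Longrightarrow> \<exists>N. \<forall>n\<ge>N. X n > z \<longrightarrow> \<bar>- X n - \<beta>'\<bar> < \<epsilon>"
      using mono_along_converges[of "\<lambda>n. X n > z" "\<lambda>n. - X n" "- a"] monoR X by auto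
    define \<beta> where "\<beta> = - \<beta>'"
    have \<beta>: "\<exists>N. \<forall>n\<ge>N. X n > z \<longrightarrow> \<bar>X n - \<beta>\<bar> < \<epsilon>" if "\<epsilon> > 0" for \<epsilon>
    proof -
      have "\<bar>- X n - \<beta>'\<bar> = \<bar>X n - \<beta>\<bar>" for n by (simp add: \<beta>_def)
      then show ?thesis using \<beta>'[OF that] by simp
    qed
    have not_eq: "\<alpha> \<noteq> \<beta>"
    proof
      assume "\<alpha> = \<beta>"
      have "X \<longlonglongrightarrow> \<alpha>"
      proof (rule LIMSEQ_I)
        fix r :: real assume "r > 0"
        obtain N1 N2 where "\<forall>n\<ge>N1. X n < z \<longrightarrow> \<bar>X n - \<alpha>\<bar> < r" "\<forall>n\<ge>N2. X n > z \<longrightarrow> \<bar>X n - \<beta>\<bar> < r"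
          using \<alpha>[OF \<open>r > 0\<close>] \<beta>[OF \<open>r > 0\<close>] by blast
        then have "norm (X n - \<alpha>) < r" if "n \<ge> max N1 N2" for n
          using that \<open>\<alpha> = \<beta>\<close> ne[of n] unfolding X_def[symmetric] real_norm_def
          by (metis linorder_neqE_linordered_idom max.boundedE)
        then show "\<exists>no. \<forall>n\<ge>no. norm (X n - \<alpha>) < r" by blast
      qed
      then have "convergent (\<lambda>n. (f ^^ (1 * n)) x)" unfolding convergent_def X_def mult_1 by blast
      then have "asymptotically_periodic f x" unfolding asymptotically_periodic_def by (intro exI[of _ 1] conjI) auto
      then show False using na by blast
    qed
    have L: "\<exists>n\<ge>N. X n < z" for N
    proof -
      obtain i where "X (N + i) < X (N + i + 1)" using orbit_ascends[OF x na zero_less_one, of N] unfolding X_def mult_1 by blast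
      then have "\<not> z < X (N + i)" using down[of "N + i"] unfolding X_def Suc_eq_plus1[symmetric] by (meson less_asym)
      then have "X (N + i) < z" using ne[of "N + i"] unfolding X_def by (meson linorder_neqE_linordered_idom)
      then show ?thesis by (meson le_add1)
    qed
    have R: "\<exists>n\<ge>N. X n > z" for N
    proof -
      obtain i where "X (N + i) > X (N + i + 1)" using orbit_descends[OF x na zero_less_one, of N] unfolding X_def mult_1 by blast
      then have "\<not> z > X (N + i)" using up[of "N + i"] unfolding X_def Suc_eq_plus1[symmetric] by (meson less_asym)
      then have "X (N + i) > z" using ne[of "N + i"] unfolding X_def by (meson linorder_neqE_linordered_idom)
      then show ?thesis by (meson le_add1)
    qed
    have cross: "\<exists>k\<ge>n. P k \<and> \<not> P (Suc k)" if "P n" "\<not> P m" "n \<le> m" for P :: "nat \<Rightarrow> bool" and n m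
    proof (rule ccontr)
      assume "\<not> ?thesis"
      then have step: "P k \<Longrightarrow> P (Suc k)" if "k \<ge> n" for k using that by blast
      have "P (n + i)" for i using that(1) step by (induction i) simp_all
      then show False using that le_Suc_ex by metis
    qed
    have LR: "infinite {n. X n < z \<and> X (Suc n) > z}"
      unfolding infinite_nat_iff_unbounded_le
    proof
      fix N
      obtain n where n: "n \<ge> N" "X n < z" using L by blast
      obtain m where m: "m \<ge> n" "X m > z" using R by blast
      show "\<exists>n\<ge>N. n \<in> {n. X n < z \<and> X (Suc n) > z}"
      proof -
        obtain k where k: "k \<ge> n" "X k < z" "\<not> X (Suc k) < z"
          using cross[of "\<lambda>n. X n < z" n m] n m by auto
        then have "X (Suc k) > z" using ne[of "Suc k"] unfolding X_def by (simp only: not_less le_less) blast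
        then show ?thesis using k n by (intro exI[of _ k]) auto
      qed
    qed
    have RL: "infinite {n. X n > z \<and> X (Suc n) < z}"
      unfolding infinite_nat_iff_unbounded_le
    proof
      fix N
      obtain n where n: "n \<ge> N" "X n > z" using R by blast
      obtain m where m: "m \<ge> n" "X m < z" using L by blast
      show "\<exists>n\<ge>N. n \<in> {n. X n > z \<and> X (Suc n) < z}"
      proof -
        obtain k where k: "k \<ge> n" "X k > z" "\<not> X (Suc k) > z"
          using cross[of "\<lambda>n. X n > z" n m] n m by auto
        then have "X (Suc k) < z" using ne[of "Suc k"] unfolding X_def by (simp only: not_less le_less) blast
        then show ?thesis using k n by (intro exI[of _ k]) auto
      qed
    qed
    have \<alpha>\<beta>: "f \<alpha> = \<beta>" "f \<beta> = \<alpha>"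
      using limit_transition[of x "\<lambda>n. X n < z" "\<lambda>n. X n > z", folded X_def, OF x LR \<alpha> \<beta>]
        limit_transition[of x "\<lambda>n. X n > z" "\<lambda>n. X n < z", folded X_def, OF x RL \<beta> \<alpha>]
      by blast+
    have "finite {n. X n < z \<and> X (Suc n) < z}"
    proof (rule ccontr)
      assume inf: "infinite {n. X n < z \<and> X (Suc n) < z}"
      show False
        using limit_transition[of x "\<lambda>n. X n < z" "\<lambda>n. X n < z", folded X_def, OF x inf \<alpha> \<alpha>]
          \<alpha>\<beta> not_eq by simp
    qed
    moreover have "finite {n. X n > z \<and> X (Suc n) > z}"
    proof (rule ccontr)
      assume inf: "infinite {n. X n > z \<and> X (Suc n) > z}"
      show False
        using limit_transition[of x "\<lambda>n. X n > z" "\<lambda>n. X n > z", folded X_def, OF x inf \<beta> \<beta>]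
          \<alpha>\<beta> not_eq by simp
    qed
    ultimately have "finite ({n. X n < z \<and> X (Suc n) < z} \<union> {n. X n > z \<and> X (Suc n) > z})" by blast
    then obtain N where N: "\<And>n. X n < z \<and> X (Suc n) < z \<or> X n > z \<and> X (Suc n) > z \<Longrightarrow> n < N"
      unfolding finite_nat_set_iff_bounded by blast
    show ?thesis
    proof (intro exI[of _ z] exI[of _ N] allI impI)
      fix n assume "n \<ge> N"
      then have "\<not> (X n < z \<and> X (Suc n) < z \<or> X n > z \<and> X (Suc n) > z)" using N[of n] by (meson not_less)
      then show "(f ^^ n) x \<noteq> z \<and> ((f ^^ n) x < z \<longleftrightarrow> z < (f ^^ Suc n) x)"
        using ne[of n] ne[of "Suc n"] unfolding X_def by (meson linorder_neqE_linordered_idom less_asym)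
    qed
  qed
qed

end

section \<open>Orbits are almost periodic\<close>

definition separated :: "real set \<Rightarrow> real set \<Rightarrow> bool" where
  "separated A B \<longleftrightarrow> (\<exists>z. (\<forall>x\<in>A. x < z) \<and> (\<forall>y\<in>B. z < y) \<or> (\<forall>x\<in>A. z < x) \<and> (\<forall>y\<in>B. y < z))"

lemma separated_mono: "separated A B \<Longrightarrow> A' \<subseteq> A \<Longrightarrow> B' \<subseteq> B \<Longrightarrow> separated A' B'"
  unfolding separated_def by blast

lemma separated_commute: "separated A B \<longleftrightarrow> separated B A"
  unfolding separated_def by blast

definition residue_tail :: "(nat \<Rightarrow> real) \<Rightarrow> nat \<Rightarrow> nat \<Rightarrow> nat \<Rightarrow> real set" where
  "residue_tail X q N r = {X n |n. n \<ge> N \<and> n mod q = r}"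

lemma residue_tail_mono: "N \<le> N' \<Longrightarrow> residue_tail X q N' r \<subseteq> residue_tail X q N r"
  unfolding residue_tail_def using order_trans by blast

lemma residue_tail_double: "residue_tail X (2 * q) N r \<subseteq> residue_tail X q N (r mod q)"
proof -
  have "n mod q = r mod q" if "n mod (2 * q) = r" for n
    unfolding that[symmetric] by (simp add: mod_mod_cancel)
  then show ?thesis unfolding residue_tail_def by blast
qed

lemma alternating_sides:
  fixes Y :: "nat \<Rightarrow> real"
  assumes "\<And>i. i \<ge> M \<Longrightarrow> Y i \<noteq> z \<and> (Y i < z \<longleftrightarrow> z < Y (Suc i))" 
  shows "(Y (2 * M + 2 * i) < z \<longleftrightarrow> Y (2 * M) < z) \<and> (Y (2 * M + 2 * i + 1) > z \<longleftrightarrow> Y (2 * M) < z)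
    \<and> Y (2 * M + 2 * i) \<noteq> z \<and> Y (2 * M + 2 * i + 1) \<noteq> z"
proof (induction i)
  case 0
  then show ?case using assms[of "2 * M"] assms[of "2 * M + 1"] by auto
next
  case (Suc i)
  have "2 * M + 2 * Suc i = Suc (2 * M + 2 * i + 1)" by simp
  then show ?case using Suc assms[of "2 * M + 2 * i + 1"] assms[of "2 * M + 2 * Suc i"] assms[of "2 * M + 2 * Suc i + 1"]
    by (auto simp: not_less_iff_gr_or_eq)
qed

context no_horseshoe
begin

text \<open>A residue class modulo \<open>q\<close> is an orbit of \<open>f^q\<close>, and its two halves modulo \<open>2 * q\<close> are the two
sides in \<open>alternation\<close> for \<open>f^q\<close>.\<close>

lemma sibling_classes_separated:
  assumes x: "x \<in> {a..b}" and na: "\<not> asymptotically_periodic f x" and q: "q > 0" and s: "s < q"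
  shows "\<exists>N. separated (residue_tail (\<lambda>n. (f ^^ n) x) (2 * q) N s) (residue_tail (\<lambda>n. (f ^^ n) x) (2 * q) N (s + q))"
proof -
  define X where "X n = (f ^^ n) x" for n
  interpret g: no_horseshoe a b "f ^^ q" by (rule no_horseshoe_funpow[OF q])
  have "\<not> asymptotically_periodic (f ^^ q) ((f ^^ s) x)"
    using asymptotically_periodic_funpow[OF x q] na by blast
  then obtain z M where alt: "\<And>i. i \<ge> M \<Longrightarrow> ((f ^^ q) ^^ i) ((f ^^ s) x) \<noteq> z \<and>
      (((f ^^ q) ^^ i) ((f ^^ s) x) < z \<longleftrightarrow> z < ((f ^^ q) ^^ Suc i) ((f ^^ s) x))"
    using g.alternation[of "(f ^^ s) x"] funpow_maps[OF x] by blast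
  have Y: "((f ^^ q) ^^ i) ((f ^^ s) x) = X (s + q * i)" for i
    by (simp only: X_def funpow_mult add.commute[of s] funpow_add comp_apply)
  define Y where "Y i = X (s + q * i)" for i
  note sides = alternating_sides[of M Y z, OF alt[unfolded Y, folded Y_def]]
  define N where "N = s + q * (2 * M)"
  have even_part: "\<exists>i. X n = Y (2 * M + 2 * i)" if n: "n \<ge> N" "n mod (2 * q) = s" for n
  proof -
    define t where "t = n div (2 * q)"
    have nt: "n = s + q * (2 * t)" using n(2) mod_mult_div_eq[of n "2 * q"] by (simp add: t_def ac_simps)
    then have "M \<le> t" using n(1) q unfolding N_def by simp
    then show ?thesis using nt by (intro exI[of _ "t - M"]) (simp add: Y_def algebra_simps)
  qed
  have odd_part: "\<exists>i. X n = Y (2 * M + 2 * i + 1)" if n: "n \<ge> N" "n mod (2 * q) = s + q" for n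
  proof -
    define t where "t = n div (2 * q)"
    have nt: "n = s + q * (2 * t + 1)" using n(2) mod_mult_div_eq[of n "2 * q"] by (simp add: t_def algebra_simps)
    then have "q * (2 * M) \<le> q * (2 * t + 1)" using n(1) unfolding N_def by simp
    then have "2 * M \<le> 2 * t + 1" using q mult_le_cancel1 by blast
    then have "M \<le> t" by simp
    then have "2 * t + 1 = 2 * M + 2 * (t - M) + 1" by simp
    then show ?thesis using nt by (intro exI[of _ "t - M"]) (simp add: Y_def)
  qed
  have "separated (residue_tail X (2 * q) N s) (residue_tail X (2 * q) N (s + q))"
  proof (cases "Y (2 * M) < z")
    case True
    have "X n < z" if "n \<ge> N" "n mod (2 * q) = s" for n using even_part[OF that] sides True by metis
    moreover have "z < X n" if "n \<ge> N" "n mod (2 * q) = s + q" for n using odd_part[OF that] sides True by metis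
    ultimately show ?thesis unfolding separated_def residue_tail_def by blast
  next
    case False
    have "X n > z" if "n \<ge> N" "n mod (2 * q) = s" for n using even_part[OF that] sides False by (metis linorder_neqE_linordered_idom)
    moreover have "z > X n" if "n \<ge> N" "n mod (2 * q) = s + q" for n using odd_part[OF that] sides False by (metis linorder_neqE_linordered_idom)
    ultimately show ?thesis unfolding separated_def residue_tail_def by blast
  qed
  then show ?thesis unfolding X_def by blast
qed

text \<open>Two residues that differ modulo \<open>2^(k+1)\<close> either differ already modulo \<open>2^k\<close> or are the two halves of
one class modulo \<open>2^k\<close>.\<close>

lemma dyadic_classes_separated:
  assumes x: "x \<in> {a..b}" and na: "\<not> asymptotically_periodic f x"
  shows "\<exists>N. \<forall>r<2 ^ k. \<forall>r'<2 ^ k. r \<noteq> r' \<longrightarrow>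
    separated (residue_tail (\<lambda>n. (f ^^ n) x) (2 ^ k) N r) (residue_tail (\<lambda>n. (f ^^ n) x) (2 ^ k) N r')"
proof (induction k)
  case (Suc k)
  define X where "X n = (f ^^ n) x" for n
  define q :: nat where "q = 2 ^ k"
  have q: "q > 0" by (simp add: q_def)
  from Suc obtain N where N: "\<And>r r'. r < q \<Longrightarrow> r' < q \<Longrightarrow> r \<noteq> r' \<Longrightarrow>
      separated (residue_tail X q N r) (residue_tail X q N r')"
    unfolding X_def q_def by blast
  have "\<forall>s. \<exists>M. s < q \<longrightarrow> separated (residue_tail X (2 * q) M s) (residue_tail X (2 * q) M (s + q))"
    using sibling_classes_separated[OF x na q] unfolding X_def by blast
  then obtain M where M: "\<And>s. s < q \<Longrightarrow> separated (residue_tail X (2 * q) (M s) s) (residue_tail X (2 * q) (M s) (s + q))"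
    by metis
  define L where "L = Max (insert N (M ` {..<q}))"
  have L: "N \<le> L" "\<And>s. s < q \<Longrightarrow> M s \<le> L" unfolding L_def by auto
  have sib: "separated (residue_tail X (2 * q) L s) (residue_tail X (2 * q) L (s + q))" if "s < q" for s
    by (rule separated_mono[OF M[OF that]]) (intro residue_tail_mono L that)+
  have "separated (residue_tail X (2 * q) L r) (residue_tail X (2 * q) L r')"
    if r: "r < 2 * q" "r' < 2 * q" "r \<noteq> r'" for r r'
  proof (cases "r mod q = r' mod q")
    case False
    have "separated (residue_tail X q N (r mod q)) (residue_tail X q N (r' mod q))"
      using N False q by simp
    then show ?thesis
      by (rule separated_mono) (meson residue_tail_double residue_tail_mono L(1) order_trans)+
  next
    case True
    have "r' = r + q \<or> r = r' + q"
      using r True q by (cases "r < q"; cases "r' < q") (auto simp: mod_if[of r] mod_if[of r'] split: if_splits)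
    then show ?thesis
    proof
      assume "r' = r + q"
      then show ?thesis using sib[of r] r by simp
    next
      assume "r = r' + q"
      then show ?thesis using sib[of r'] r separated_commute by simp
    qed
  qed
  then show ?case unfolding X_def q_def power_Suc by blast
qed auto

end

lemma card_disjoint_intervals_le:
  fixes lo hi :: "'i \<Rightarrow> real" and \<delta> :: real
  assumes "finite B" and len: "\<And>r. r \<in> B \<Longrightarrow> lo r + \<delta> \<le> hi r" and "\<delta> > 0"
    and sub: "\<And>r. r \<in> B \<Longrightarrow> {lo r..hi r} \<subseteq> {a..b}"
    and disj: "disjoint_family_on (\<lambda>r. {lo r..hi r}) B" and ab: "a \<le> b"
  shows "card B * \<delta> \<le> b - a"
proof -
  have le: "lo r \<le> hi r" if "r \<in> B" for r using len[OF that] \<open>\<delta> > 0\<close> by simp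
  have "card B * \<delta> = (\<Sum>r\<in>B. \<delta>)" by simp
  also have "\<dots> \<le> (\<Sum>r\<in>B. measure lborel {lo r..hi r})"
    using len le by (intro sum_mono) (force simp: algebra_simps)
  also have "\<dots> = measure lborel (\<Union>r\<in>B. {lo r..hi r})"
    by (rule measure_finite_Union[symmetric]) (use assms le in \<open>auto simp: emeasure_lborel_Icc\<close>)
  also have "\<dots> \<le> measure lborel {a..b}"
  proof (rule measure_mono_fmeasurable)
    show "(\<Union>r\<in>B. {lo r..hi r}) \<subseteq> {a..b}" by (rule UN_least) (rule sub)
    show "{a..b} \<in> fmeasurable lborel" by (auto simp: fmeasurable_def emeasure_lborel_Icc_eq)
  qed (use assms(1) in auto)
  finally show ?thesis using ab by simp
qed

context no_horseshoe
begin

text \<open>A residue is bad if its class still spreads over more than \<open>\<delta>\<close> after time \<open>N\<close>. Bad residues span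
pairwise disjoint intervals of length at least \<open>\<delta>\<close> in \<open>[a, b]\<close>, so their number is bounded
independently of \<open>k\<close>, while the modulus \<open>2^k\<close> grows.\<close>

theorem orbit_almost_periodic:
  fixes x \<delta> \<eta> :: real
  assumes x: "x \<in> {a..b}" and \<delta>: "\<delta> > 0" and \<eta>: "\<eta> > 0"
  shows "\<exists>q::nat. q > 0 \<and> (\<exists>N B. B \<subseteq> {..<q} \<and> real (card B) \<le> \<eta> * q \<and>
    (\<forall>n\<ge>N. \<forall>m\<ge>N. n mod q = m mod q \<and> n mod q \<notin> B \<longrightarrow> \<bar>(f ^^ n) x - (f ^^ m) x\<bar> \<le> \<delta>))"
proof (cases "asymptotically_periodic f x")
  case True
  then obtain p where p: "p > 0" "convergent (\<lambda>n. (f ^^ (p * n)) x)"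
    unfolding asymptotically_periodic_def by blast
  have "\<exists>N. \<forall>n\<ge>N. \<forall>m\<ge>N. \<bar>(f ^^ (r + p * n)) x - (f ^^ (r + p * m)) x\<bar> < \<delta>" for r
  proof -
    have "convergent (\<lambda>n. (f ^^ r) ((f ^^ (p * n)) x))"
      by (rule convergent_funpow[OF p(2)]) (rule funpow_maps[OF x])
    then have "Cauchy (\<lambda>n. (f ^^ (r + p * n)) x)" by (simp add: funpow_add convergent_Cauchy)
    then show ?thesis using \<delta> by (auto simp: Cauchy_iff)
  qed
  then obtain N where N: "\<And>r n m. n \<ge> N r \<Longrightarrow> m \<ge> N r \<Longrightarrow> \<bar>(f ^^ (r + p * n)) x - (f ^^ (r + p * m)) x\<bar> < \<delta>"
    by metis
  define M where "M = p * Suc (Max (N ` {..<p}))"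
  have M: "N r \<le> n div p" if "r < p" "n \<ge> M" for r n
  proof -
    have "N r \<le> Max (N ` {..<p})" using that by (intro Max_ge) auto
    also have "\<dots> \<le> M div p" using p(1) by (simp add: M_def)
    also have "\<dots> \<le> n div p" using that by (simp add: div_le_mono)
    finally show ?thesis .
  qed
  have "\<bar>(f ^^ n) x - (f ^^ m) x\<bar> \<le> \<delta>" if "n \<ge> M" "m \<ge> M" "n mod p = m mod p" for n m
    using N[of "n mod p" "n div p" "m div p"] M[of "n mod p" n] M[of "n mod p" m] that p(1)
    by (metis less_imp_le mod_less_divisor mod_mult_div_eq add.commute)
  then show ?thesis using p(1) \<eta> by (intro exI[of _ p] conjI exI[of _ M] exI[of _ "{}"]) auto
next
  case False
  define X where "X n = (f ^^ n) x" for n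
  have X: "X n \<in> {a..b}" for n using funpow_maps[OF x] by (simp add: X_def)
  have ab: "a \<le> b" using x by auto
  obtain k where k: "(b - a) / (\<delta> * \<eta>) < 2 ^ k" using real_arch_pow[of 2] by auto
  define q :: nat where "q = 2 ^ k"
  obtain N where N: "\<And>r r'. r < q \<Longrightarrow> r' < q \<Longrightarrow> r \<noteq> r' \<Longrightarrow>
      separated (residue_tail X q N r) (residue_tail X q N r')"
    using dyadic_classes_separated[OF x False, of k] unfolding X_def q_def by blast
  define B where "B = {r. r < q \<and> (\<exists>n m. n \<ge> N \<and> m \<ge> N \<and> n mod q = r \<and> m mod q = r \<and> X n + \<delta> < X m)}"
  have "\<forall>r. \<exists>n m. r \<in> B \<longrightarrow> n \<ge> N \<and> m \<ge> N \<and> n mod q = r \<and> m mod q = r \<and> X n + \<delta> < X m"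
    unfolding B_def by blast
  then obtain l h where lh: "\<And>r. r \<in> B \<Longrightarrow> l r \<ge> N \<and> h r \<ge> N \<and> l r mod q = r \<and> h r mod q = r \<and> X (l r) + \<delta> < X (h r)"
    by metis
  have "card B * \<delta> \<le> b - a"
  proof (rule card_disjoint_intervals_le)
    show "disjoint_family_on (\<lambda>r. {X (l r)..X (h r)}) B"
      unfolding disjoint_family_on_def
    proof (intro ballI impI)
      fix r r' assume r: "r \<in> B" "r' \<in> B" "r \<noteq> r'"
      have "X (l r) \<in> residue_tail X q N r" "X (h r) \<in> residue_tail X q N r"
        "X (l r') \<in> residue_tail X q N r'" "X (h r') \<in> residue_tail X q N r'"
        using lh[OF r(1)] lh[OF r(2)] unfolding residue_tail_def by blast+
      moreover have "separated (residue_tail X q N r) (residue_tail X q N r')"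
        using N[of r r'] r by (auto simp: B_def)
      ultimately have "X (h r) < X (l r') \<or> X (h r') < X (l r)"
        unfolding separated_def by (meson less_trans)
      then show "{X (l r)..X (h r)} \<inter> {X (l r')..X (h r')} = {}" by auto
    qed
    show "{X (l r)..X (h r)} \<subseteq> {a..b}" for r using X[of "l r"] X[of "h r"] by auto
    show "finite B" unfolding B_def by simp
    show "X (l r) + \<delta> \<le> X (h r)" if "r \<in> B" for r using lh[OF that] by simp
  qed (rule \<delta>, rule ab)
  also have "\<dots> \<le> \<eta> * q * \<delta>"
    using k \<delta> \<eta> by (simp add: q_def field_simps)
  finally have "card B * \<delta> \<le> \<eta> * q * \<delta>" .
  then have "card B \<le> \<eta> * q" using mult_right_le_imp_le[OF _ \<delta>] by blast
  moreover have "B \<subseteq> {..<q}" unfolding B_def by blast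
  moreover have "\<bar>X n - X m\<bar> \<le> \<delta>" if nm: "n \<ge> N" "m \<ge> N" "n mod q = m mod q" "n mod q \<notin> B" for n m
  proof -
    have lt: "n mod q < q" unfolding q_def by simp
    have le: "X v \<le> X u + \<delta>" if "u \<ge> N" "v \<ge> N" "u mod q = n mod q" "v mod q = n mod q" for u v
    proof (rule ccontr)
      assume "\<not> X v \<le> X u + \<delta>"
      then have "X u + \<delta> < X v" by simp
      then have "n mod q \<in> B" unfolding B_def using lt that
        by (intro CollectI conjI exI[of _ u] exI[of _ v]) simp_all
      then show False using nm(4) by simp
    qed
    show ?thesis using le[OF nm(1,2) refl nm(3)[symmetric]] le[OF nm(2,1) nm(3)[symmetric] refl] by linarith
  qed
  moreover have "q > 0" unfolding q_def by simp
  ultimately show ?thesis unfolding X_def by blast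
qed

end

section \<open>Powers with complex exponents\<close>

text \<open>This is \<open>n^(-s)\<close>. The exponential form makes it entire in \<open>s\<close>; powers \<open>N^z\<close> are written
\<open>nexp N (- z)\<close>.\<close>

definition nexp :: "nat \<Rightarrow> complex \<Rightarrow> complex" where
  "nexp n s = exp (- (s * of_real (ln (real n))))"

lemma norm_nexp: "n > 0 \<Longrightarrow> norm (nexp n s) = real n powr - Re s"
  by (simp add: nexp_def powr_def norm_exp_eq_Re)

lemma nexp_mult: "m > 0 \<Longrightarrow> n > 0 \<Longrightarrow> nexp (m * n) s = nexp m s * nexp n s"
  by (simp add: nexp_def ln_mult exp_add[symmetric] algebra_simps)

lemma nexp_add: "nexp n (s + t) = nexp n s * nexp n t"
  by (simp add: nexp_def exp_add[symmetric] algebra_simps)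

lemma nexp_1_left [simp]: "nexp (Suc 0) s = 1"
  by (simp add: nexp_def)

lemma nexp_0_right [simp]: "nexp n 0 = 1"
  by (simp add: nexp_def)

lemma nexp_1_right: "n > 0 \<Longrightarrow> nexp n 1 = 1 / of_nat n"
  by (simp add: nexp_def exp_minus exp_of_real field_simps)

lemma nexp_holomorphic [holomorphic_intros]: "g holomorphic_on A \<Longrightarrow> (\<lambda>s. nexp n (g s)) holomorphic_on A"
  unfolding nexp_def by (intro holomorphic_intros)

text \<open>Mean value theorem for \<open>t^(-x)\<close> on \<open>[n, n + 1]\<close>. It makes the tail of \<open>\<Sum> n^(-1-x)\<close> telescope.\<close>

lemma powr_step_le:
  fixes x :: real
  assumes "x > 0" "n > 0"
  shows "real (Suc n) powr (- 1 - x) \<le> (real n powr - x - real (Suc n) powr - x) / x"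
proof -
  have "\<exists>z. real n < z \<and> z < real (Suc n) \<and> 
     real (Suc n) powr - x - real n powr - x = (real (Suc n) - real n) * (- x * z powr (- x - 1))"
    using assms by (intro MVT2) (auto intro!: derivative_eq_intros simp: field_simps)
  then obtain z where z: "real n < z" "z < real (Suc n)"
     "real (Suc n) powr - x - real n powr - x = (real (Suc n) - real n) * (- x * z powr (- x - 1))" by blast
  have "real (Suc n) powr (- 1 - x) \<le> z powr (- x - 1)"
    using z assms powr_mono2'[of "- 1 - x" z "real (Suc n)"] by (simp add: minus_diff_commute)
  also have "\<dots> = (real n powr - x - real (Suc n) powr - x) / x"
    using z(3) assms by (simp add: field_simps)
  finally show ?thesis .
qed

lemma tail_powr_bound:
  fixes x :: real
  assumes "x > 0" "N > 0"
  shows "summable (\<lambda>n. real (Suc (n + N)) powr (- 1 - x))"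
    and "(\<Sum>n. real (Suc (n + N)) powr (- 1 - x)) \<le> real N powr - x / x"
proof -
  have lim: "(\<lambda>n. real (n + N) powr - x) \<longlonglongrightarrow> 0"
    using assms(1) by real_asymp
  have "(\<lambda>n. (real (n + N) powr - x - real (Suc n + N) powr - x)) sums (real (0 + N) powr - x - 0)"
    by (rule telescope_sums'[OF lim])
  from sums_divide[OF this, of x]
  have s: "(\<lambda>n. (real (n + N) powr - x - real (Suc n + N) powr - x) / x) sums (real N powr - x / x)" by simp
  have le: "real (Suc (n + N)) powr (- 1 - x) \<le> (real (n + N) powr - x - real (Suc n + N) powr - x) / x" for n
    using powr_step_le[of x "n + N"] assms by simp
  show sm: "summable (\<lambda>n. real (Suc (n + N)) powr (- 1 - x))"
    by (rule summable_comparison_test'[OF sums_summable[OF s], of 0]) (use le in auto)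
  show "(\<Sum>n. real (Suc (n + N)) powr (- 1 - x)) \<le> real N powr - x / x"
    using suminf_le[OF le sm sums_summable[OF s]] sums_unique[OF s] by simp
qed

text \<open>Comparison with the integral of \<open>t^(y - 1)\<close>. The integrand decreases for \<open>y \<le> 1\<close> and increases
otherwise, and in the second case the last summand is left over.\<close>

lemma partial_powr_bound:
  fixes y :: real
  assumes y: "y > 0" and N: "N > 0"
  shows "(\<Sum>n<N. real (Suc n) powr (y - 1)) \<le> real N powr y / y + real N powr (y - 1)"
proof (cases "y \<le> 1")
  case True
  have step: "real (Suc n) powr (y - 1) \<le> (real (Suc n) powr y - real n powr y) / y" for n
  proof (cases "n = 0")
    case True
    then show ?thesis using y \<open>y \<le> 1\<close> by simp
  next
    case False
    have "\<exists>z. real n < z \<and> z < real (Suc n) \<and> 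
       real (Suc n) powr y - real n powr y = (real (Suc n) - real n) * (y * z powr (y - 1))"
      using False by (intro MVT2) (auto intro!: derivative_eq_intros simp: field_simps)
    then obtain z where z: "real n < z" "z < real (Suc n)"
       "real (Suc n) powr y - real n powr y = (real (Suc n) - real n) * (y * z powr (y - 1))" by blast
    have "real (Suc n) powr (y - 1) \<le> z powr (y - 1)"
      using z False True powr_mono2'[of "y - 1" z "real (Suc n)"] by simp
    then show ?thesis using z(3) y by (simp add: field_simps)
  qed
  have "(\<Sum>n<N. real (Suc n) powr (y - 1)) \<le> (\<Sum>n<N. (real (Suc n) powr y - real n powr y) / y)"
    by (intro sum_mono step)
  also have "\<dots> = real N powr y / y"
    using sum_lessThan_telescope[of "\<lambda>n. real n powr y" N] by (simp add: sum_divide_distrib[symmetric])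
  finally show ?thesis by (smt (verit) powr_ge_zero)
next
  case False
  have step: "real (Suc n) powr (y - 1) \<le> (real (Suc (Suc n)) powr y - real (Suc n) powr y) / y" for n
  proof -
    have "\<exists>z. real (Suc n) < z \<and> z < real (Suc (Suc n)) \<and> 
       real (Suc (Suc n)) powr y - real (Suc n) powr y = (real (Suc (Suc n)) - real (Suc n)) * (y * z powr (y - 1))"
      by (intro MVT2) (auto intro!: derivative_eq_intros simp: field_simps)
    then obtain z where z: "real (Suc n) < z" "z < real (Suc (Suc n))"
       "real (Suc (Suc n)) powr y - real (Suc n) powr y = (real (Suc (Suc n)) - real (Suc n)) * (y * z powr (y - 1))" by blast
    have "real (Suc n) powr (y - 1) \<le> z powr (y - 1)"
      using z False powr_mono2[of "y - 1" "real (Suc n)" z] by simp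
    then show ?thesis using z(3) y by (simp add: field_simps)
  qed
  obtain M where M: "N = Suc M" using N gr0_implies_Suc by blast
  have "(\<Sum>n<M. real (Suc n) powr (y - 1)) \<le> (\<Sum>n<M. (real (Suc (Suc n)) powr y - real (Suc n) powr y) / y)"
    by (intro sum_mono step)
  also have "\<dots> = (real (Suc M) powr y - 1) / y"
    using sum_lessThan_telescope[of "\<lambda>n. real (Suc n) powr y" M] by (simp add: sum_divide_distrib[symmetric])
  also have "\<dots> \<le> real N powr y / y" using y M by (simp add: divide_right_mono)
  finally show ?thesis using M by simp
qed

section \<open>Newman's Tauberian theorem\<close>

lemma contour_inverse_arc: "((\<lambda>w. 1 / (w - 0)) has_contour_integral (\<i> * of_real (t - s))) (part_circlepath 0 R s t)"
  if "R > 0" "s < t"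
proof -
  have "((\<lambda>t. 1 / (0 + R * cis t - 0) * R * \<i> * cis t) has_integral (\<i> * of_real (t - s))) {s..t}"
    using has_integral_const_real[of \<i> s t] that 
    by (simp add: field_simps scaleR_conv_of_real)
  then show ?thesis
    using has_contour_integral_part_circlepath_iff[OF that(2), of "\<lambda>w. 1 / (w - 0)" "\<i> * of_real (t - s)" 0 R] by simp
qed

lemma Ln_imaginary: "R > 0 \<Longrightarrow> Ln (\<i> * of_real R) - Ln (- (\<i> * of_real R)) = \<i> * pi"
  using Ln_times_of_real[of R \<i>] Ln_times_of_real[of R "- \<i>"] by (simp add: mult.commute)

text \<open>The branch \<open>Ln (- z)\<close> is a primitive of \<open>1 / z\<close> on the closed left half plane without \<open>0\<close>, so every
path there from \<open>\<i> R\<close> to \<open>- \<i> R\<close> makes half a turn.\<close>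

lemma contour_inverse_left:
  assumes g: "valid_path g" "path_image g \<subseteq> {z. Re z \<le> 0 \<and> z \<noteq> 0}" "pathstart g = \<i> * of_real R" "pathfinish g = - (\<i> * of_real R)"
    and R: "R > 0"
  shows "((\<lambda>w. 1 / (w - 0)) has_contour_integral (\<i> * pi)) g"
proof -
  have "((\<lambda>w. 1 / (w - 0)) has_contour_integral (Ln (- pathfinish g) - Ln (- pathstart g))) g"
  proof (rule contour_integral_primitive[of "{z. Re z \<le> 0 \<and> z \<noteq> 0}"])
    fix x :: complex assume "x \<in> {z. Re z \<le> 0 \<and> z \<noteq> 0}"
    then have "- x \<notin> \<real>\<^sub>\<le>\<^sub>0" by (auto simp: complex_nonpos_Reals_iff complex_eq_iff)
    then show "((\<lambda>z. Ln (- z)) has_field_derivative 1 / (x - 0)) (at x within {z. Re z \<le> 0 \<and> z \<noteq> 0})"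
      by (auto intro!: derivative_eq_intros simp: field_simps)
  qed (use g in auto)
  then show ?thesis unfolding g using Ln_imaginary[OF R] by simp
qed

abbreviation right_arc :: "real \<Rightarrow> real \<Rightarrow> complex" where
  "right_arc R \<equiv> part_circlepath 0 R (- pi / 2) (pi / 2)"

abbreviation left_arc :: "real \<Rightarrow> real \<Rightarrow> complex" where
  "left_arc R \<equiv> part_circlepath 0 R (pi / 2) (3 * pi / 2)"

lemma exp_half_pi [simp]: "exp (\<i> * complex_of_real pi / 2) = \<i>"
  using cis_conv_exp[of "pi / 2"] by simp

lemma exp_minus_half_pi [simp]: "exp (- (\<i> * complex_of_real pi / 2)) = - \<i>"
  by (simp add: exp_minus)

lemma right_arc_ends [simp]:
  "pathstart (right_arc R) = - (\<i> * of_real R)" "pathfinish (right_arc R) = \<i> * of_real R"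
  using exp_half_pi by (simp_all add: exp_minus field_simps)

lemma left_arc_ends [simp]:
  "pathstart (left_arc R) = \<i> * of_real R" "pathfinish (left_arc R) = - (\<i> * of_real R)"
proof -
  have "cis (3 * pi / 2) = - \<i>" using cis_mult[of pi "pi/2"] by (simp add: field_simps)
  then show "pathfinish (left_arc R) = - (\<i> * of_real R)" by (simp add: cis_conv_exp mult.commute)
  show "pathstart (left_arc R) = \<i> * of_real R" using exp_half_pi by (simp add: mult.commute)
qed

text \<open>Cauchy's formula at \<open>0\<close> for a contour that consists of the right half of a circle and any path \<open>B\<close>
that completes it with another half turn. Two choices of \<open>B\<close> are used with the same right half.\<close>

lemma Cauchy_split:
  assumes U: "convex U" "0 \<in> interior U" "F holomorphic_on U" and R: "R > 0"
    and A: "path_image (right_arc R) \<subseteq> U"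
    and B: "valid_path B" "path_image B \<subseteq> U" "pathstart B = \<i> * of_real R" "pathfinish B = - (\<i> * of_real R)"
      "((\<lambda>w. 1 / (w - 0)) has_contour_integral (\<i> * pi)) B" "0 \<notin> path_image B"
  shows "contour_integral (right_arc R) (\<lambda>z. F z / z) + contour_integral B (\<lambda>z. F z / z) = 2 * pi * \<i> * F 0"
    and "(\<lambda>z. F z / z) contour_integrable_on right_arc R" "(\<lambda>z. F z / z) contour_integrable_on B"
proof -
  let ?g = "right_arc R +++ B"
  have v: "valid_path ?g" using B by (intro valid_path_join) auto
  have 0: "0 \<notin> path_image (right_arc R)" using R by (auto simp: path_image_part_circlepath')
  have pim: "path_image ?g \<subseteq> U - {0}" using A B 0 by (subst path_image_join) auto
  have cl: "pathfinish ?g = pathstart ?g" using B by simp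
  have "((\<lambda>w. 1 / (w - 0)) has_contour_integral (\<i> * of_real (pi / 2 - (- pi / 2)) + \<i> * pi)) ?g"
    using B R by (intro has_contour_integral_join contour_inverse_arc) auto
  then have "((\<lambda>w. 1 / (w - 0)) has_contour_integral (2 * pi * \<i>)) ?g" by (simp add: field_simps)
  moreover have "0 \<notin> path_image ?g" using pim by blast
  ultimately have w: "winding_number ?g 0 = 1"
    using winding_number_valid_path[OF v, of 0] by (simp add: contour_integral_unique)
  have I: "((\<lambda>w. F w / (w - 0)) has_contour_integral (2 * pi * \<i> * winding_number ?g 0 * F 0)) ?g"
    by (rule Cauchy_integral_formula_convex_simple[OF U(1,3,2) v pim cl])
  then have int: "(\<lambda>z. F z / z) contour_integrable_on ?g" by (auto simp: contour_integrable_on_def)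
  show iA: "(\<lambda>z. F z / z) contour_integrable_on right_arc R"
    using contour_integrable_joinD1[OF int] by simp
  show iB: "(\<lambda>z. F z / z) contour_integrable_on B"
    using contour_integrable_joinD2[OF int] B by simp
  show "contour_integral (right_arc R) (\<lambda>z. F z / z) + contour_integral B (\<lambda>z. F z / z) = 2 * pi * \<i> * F 0"
    using contour_integral_join[OF iA iB] contour_integral_unique[OF I] w B exp_half_pi by simp
qed

lemma path_image_right_arc: "R > 0 \<Longrightarrow> path_image (right_arc R) \<subseteq> {z. norm z = R \<and> Re z \<ge> 0}"
  by (auto simp: path_image_part_circlepath' closed_segment_eq_real_ivl norm_mult intro!: mult_nonneg_nonneg cos_ge_zero)

lemma path_image_left_arc: "R > 0 \<Longrightarrow> path_image (left_arc R) \<subseteq> {z. norm z = R \<and> Re z \<le> 0}"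
proof -
  assume R: "R > 0"
  have "cos t \<le> 0" if "pi / 2 \<le> t" "t \<le> 3 * pi / 2" for t
    using cos_ge_zero[of "t - pi"] that by (simp add: cos_diff)
  then show ?thesis using R
    by (auto simp: path_image_part_circlepath' closed_segment_eq_real_ivl norm_mult mult_nonneg_nonpos)
qed

lemma circle_imaginary: "norm z = R \<Longrightarrow> Re z = 0 \<Longrightarrow> z \<in> {\<i> * of_real R, - (\<i> * of_real R)}"
  by (auto simp: complex_eq_iff norm_complex_def abs_if split: if_splits)

text \<open>Newman's kernel \<open>1 / z + z / R\<^sup>2\<close> is real on the circle and vanishes at \<open>\<plusminus> \<i> R\<close>, where the tail of the
series cannot be controlled.\<close>

lemma kernel_on_circle:
  assumes "norm z = R" "R > 0"
  shows "(1 + z\<^sup>2 / (of_real R)\<^sup>2) / z = of_real (2 * Re z / R\<^sup>2)"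
proof -
  have z: "z \<noteq> 0" using assms by auto
  define w :: complex where "w = of_real R"
  have w: "w \<noteq> 0" "w\<^sup>2 = z * cnj z" using assms by (auto simp: w_def complex_norm_square[symmetric])
  have "w\<^sup>2 + z\<^sup>2 = z * (z + cnj z)" unfolding w(2) by (simp add: power2_eq_square algebra_simps)
  moreover have "1 + z\<^sup>2 / w\<^sup>2 = (w\<^sup>2 + z\<^sup>2) / w\<^sup>2" using w(1) by (simp add: add_divide_distrib)
  ultimately have "1 + z\<^sup>2 / (of_real R)\<^sup>2 = z * (z + cnj z) / (of_real R)\<^sup>2" by (simp only: w_def)
  then show ?thesis using z by (simp add: complex_add_cnj)
qed

text \<open>The three segments lead from \<open>\<i> R\<close> to \<open>- \<i> R\<close> through the two corners with real part \<open>- d\<close>.\<close>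

lemma left_bracket:
  assumes R: "R > 0" and d: "d > 0"
  defines "p1 \<equiv> linepath (\<i> * of_real R) (- of_real d + \<i> * of_real R)"
    and "p2 \<equiv> linepath (- of_real d + \<i> * of_real R) (- of_real d - \<i> * of_real R)"
    and "p3 \<equiv> linepath (- of_real d - \<i> * of_real R) (- (\<i> * of_real R))"
  shows "path_image p1 \<subseteq> {z. - d \<le> Re z \<and> Re z \<le> 0 \<and> \<bar>Im z\<bar> \<le> R \<and> norm z \<ge> R}"
    "path_image p2 \<subseteq> {z. Re z = - d \<and> \<bar>Im z\<bar> \<le> R}"
    "path_image p3 \<subseteq> {z. - d \<le> Re z \<and> Re z \<le> 0 \<and> \<bar>Im z\<bar> \<le> R \<and> norm z \<ge> R}"
proof -
  have n: "Im z = R \<Longrightarrow> R \<le> norm z" "Im z = - R \<Longrightarrow> R \<le> norm z"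
      "Im z > 0 \<Longrightarrow> Im z \<le> norm z" for z
    using abs_Im_le_cmod[of z] R by simp_all
  show "path_image p1 \<subseteq> {z. - d \<le> Re z \<and> Re z \<le> 0 \<and> \<bar>Im z\<bar> \<le> R \<and> norm z \<ge> R}"
    "path_image p3 \<subseteq> {z. - d \<le> Re z \<and> Re z \<le> 0 \<and> \<bar>Im z\<bar> \<le> R \<and> norm z \<ge> R}"
    unfolding p1_def p3_def
    using R d by (auto simp: closed_segment_same_Im closed_segment_eq_real_ivl intro: n)
  show "path_image p2 \<subseteq> {z. Re z = - d \<and> \<bar>Im z\<bar> \<le> R}"
    unfolding p2_def using R d by (auto simp: closed_segment_same_Re closed_segment_eq_real_ivl)
qed

lemma compact_box: "compact {z. - d \<le> Re z \<and> Re z \<le> 0 \<and> \<bar>Im z\<bar> \<le> R}"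
proof -
  have "{z. - d \<le> Re z \<and> Re z \<le> 0 \<and> \<bar>Im z\<bar> \<le> R} = cbox (Complex (- d) (- R)) (Complex 0 R)"
    by (auto simp: in_cbox_complex_iff)
  then show ?thesis by simp
qed

lemma convex_box: "convex {z. Re z > - d \<and> \<bar>Im z\<bar> \<le> R}"
proof -
  have "{z. Re z > - d \<and> \<bar>Im z\<bar> \<le> R} = {z. Re z > - d} \<inter> {z. Im z \<le> R} \<inter> {z. Im z \<ge> - R}" by auto
  then show ?thesis by (simp add: convex_Int convex_halfspace_Re_gt convex_halfspace_Im_le convex_halfspace_Im_ge)
qed

text \<open>Let \<open>S\<close> be the partial sum of the first \<open>N\<close> terms, which is entire, and \<open>k z = N^z (1 + z\<^sup>2 / R\<^sup>2)\<close>. By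
\<open>Cauchy_split\<close>, \<open>f 0\<close> is an integral of \<open>f k / z\<close> over the right arc and the bracket close to the imaginary
axis, and \<open>S 0\<close> is one of \<open>S k / z\<close> over the full circle. The difference consists of three parts: on the right
arc \<open>f - S\<close> is at most \<open>N^(-x) / x\<close>, on the left arc \<open>S\<close> is at most about \<open>N^(-x) / (-x)\<close>, with \<open>x = Re z\<close>,
and the factor \<open>N^x * 2 \<bar>x\<bar> / R\<^sup>2\<close> from the kernel cancels both \<open>N\<close> and the singularity at
\<open>x = 0\<close>. On the bracket \<open>f\<close> is bounded: the horizontal sides are as short as \<open>d\<close>, and \<open>N^(-d)\<close> is small on the vertical one.
The bound \<open>M\<close> depends on \<open>R\<close>, but not on \<open>d\<close> and \<open>N\<close>.\<close>

lemma newman_estimate: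
  fixes a :: "nat \<Rightarrow> complex"
  assumes a: "\<And>n. norm (a n) \<le> 1" and W: "open W" "{z. Re z \<ge> 0} \<subseteq> W" and f: "f holomorphic_on W"
    and eq: "\<And>z. Re z > 0 \<Longrightarrow> (\<lambda>n. a (Suc n) * nexp (Suc n) (1 + z)) sums f z"
    and R: "R \<ge> 1"
  shows "\<exists>M \<delta>. M \<ge> 0 \<and> \<delta> > 0 \<and> (\<forall>d N. 0 < d \<and> d \<le> \<delta> \<and> N > 0 \<longrightarrow>
     norm (f 0 - (\<Sum>n<N. a (Suc n) * nexp (Suc n) 1)) \<le> 2 / R + 1 / N + d * M + R * M / d * real N powr - d)"
proof -
  define K where "K = {z. Re z = 0 \<and> \<bar>Im z\<bar> \<le> R}"
  have "compact K" using compact_box[of 0 R] by (simp add: K_def antisym_conv eq_iff conj_commute conj_left_commute)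
  moreover have "K \<subseteq> W" using W(2) by (auto simp: K_def)
  ultimately obtain e where e: "e > 0" "(\<Union>x\<in>K. ball x e) \<subseteq> W"
    using compact_subset_open_imp_ball_epsilon_subset W(1) by metis
  define U where "U = {z. Re z > - e \<and> \<bar>Im z\<bar> \<le> R}"
  have "U \<subseteq> W"
  proof
    fix z assume z: "z \<in> U"
    show "z \<in> W"
    proof (cases "Re z \<ge> 0")
      case False
      have "\<i> * of_real (Im z) \<in> K" using z by (auto simp: K_def U_def)
      moreover have "z - \<i> * of_real (Im z) = of_real (Re z)" by (simp add: complex_eq_iff)
      then have "dist (\<i> * of_real (Im z)) z < e" using False z
        by (simp add: dist_commute dist_norm U_def)
      ultimately show ?thesis using e(2) by (meson UN_I mem_ball subsetD)
    qed (use W in auto)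
  qed
  then have fU: "f holomorphic_on U" using f holomorphic_on_subset by blast
  have convU: "convex U" unfolding U_def by (rule convex_box)
  have int0: "0 \<in> interior U"
  proof -
    have "ball 0 (min e R) \<subseteq> U"
    proof
      fix z :: complex assume "z \<in> ball 0 (min e R)"
      then show "z \<in> U" using abs_Re_le_cmod[of z] abs_Im_le_cmod[of z] by (auto simp: U_def)
    qed
    then show ?thesis using e R by (meson centre_in_ball interior_maximal min_less_iff_conj open_ball subsetD zero_less_one less_le_trans)
  qed
  \<comment> \<open>half of \<open>e\<close> keeps the closed box \<open>Bx\<close> inside \<open>U\<close>\<close>
  define \<delta> where "\<delta> = e / 2"
  have \<delta>: "\<delta> > 0" "\<delta> < e" using e by (auto simp: \<delta>_def)
  define Bx where "Bx = {z. - \<delta> \<le> Re z \<and> Re z \<le> 0 \<and> \<bar>Im z\<bar> \<le> R}"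
  have BxU: "Bx \<subseteq> U" using \<delta> by (auto simp: Bx_def U_def)
  have "continuous_on Bx (\<lambda>z. f z * (1 + z\<^sup>2 / (of_real R)\<^sup>2))"
    using R by (intro continuous_intros holomorphic_on_imp_continuous_on holomorphic_on_subset[OF fU BxU]) auto
  then have "bounded ((\<lambda>z. f z * (1 + z\<^sup>2 / (of_real R)\<^sup>2)) ` Bx)"
    using compact_box[of \<delta> R] by (intro compact_imp_bounded compact_continuous_image) (auto simp: Bx_def)
  then obtain M where M: "M > 0" "\<And>z. z \<in> Bx \<Longrightarrow> norm (f z * (1 + z\<^sup>2 / (of_real R)\<^sup>2)) \<le> M"
    unfolding bounded_pos by auto
  have main: "norm (f 0 - (\<Sum>n<N. a (Suc n) * nexp (Suc n) 1)) \<le> 2 / R + 1 / N + d * M + R * M / d * real N powr - d"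
    if d: "0 < d" "d \<le> \<delta>" and N: "N > 0" for d N
  proof -
    define S where "S z = (\<Sum>n<N. a (Suc n) * nexp (Suc n) (1 + z))" for z
    define k where "k z = nexp N (- z) * (1 + z\<^sup>2 / (of_real R)\<^sup>2)" for z
    have k0: "k 0 = 1" by (simp add: k_def)
    have kh: "k holomorphic_on X" for X unfolding k_def by (intro holomorphic_intros) (use R in auto)
    have Sh: "S holomorphic_on X" for X unfolding S_def by (intro holomorphic_intros)
    have kc: "norm (k z / z) = real N powr Re z * (2 * \<bar>Re z\<bar> / R\<^sup>2)" if "norm z = R" for z
    proof -
      have "k z / z = nexp N (- z) * of_real (2 * Re z / R\<^sup>2)"
        using kernel_on_circle[OF that less_le_trans[OF zero_less_one R]] unfolding k_def times_divide_eq_right[symmetric] by (simp only:)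
      then have "norm (k z / z) = norm (nexp N (- z)) * \<bar>2 * Re z / R\<^sup>2\<bar>" by (simp only: norm_mult norm_of_real)
      then show ?thesis using N by (simp add: norm_nexp abs_mult)
    qed
    define p1 where "p1 \<equiv> linepath (\<i> * of_real R) (- of_real d + \<i> * of_real R)"
    define p2 where "p2 \<equiv> linepath (- of_real d + \<i> * of_real R) (- of_real d - \<i> * of_real R)"
    define p3 where "p3 \<equiv> linepath (- of_real d - \<i> * of_real R) (- (\<i> * of_real R))"
    define B where "B = p1 +++ p2 +++ p3"
    have R0: "R > 0" using R by simp
    note pim = left_bracket[OF R0 d(1), folded p1_def p2_def p3_def]
    have vB: "valid_path B" unfolding B_def p1_def p2_def p3_def by (intro valid_path_join) auto
    have pB: "path_image B \<subseteq> {z \<in> Bx. z \<noteq> 0}"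
    proof -
      have "path_image B = path_image p1 \<union> path_image p2 \<union> path_image p3"
        unfolding B_def p1_def p2_def p3_def by (simp add: path_image_join Un_assoc)
      also have "\<dots> \<subseteq> {z \<in> Bx. z \<noteq> 0}"
        using pim d R unfolding Bx_def by (intro Un_least) force+
      finally show ?thesis .
    qed
    have sB: "pathstart B = \<i> * of_real R" "pathfinish B = - (\<i> * of_real R)"
      unfolding B_def p1_def p3_def by simp_all
    have B1: "((\<lambda>w. 1 / (w - 0)) has_contour_integral (\<i> * pi)) B"
      using pB by (intro contour_inverse_left[OF vB _ sB R0]) (auto simp: Bx_def)
    have RA: "path_image (right_arc R) \<subseteq> U"
      using path_image_right_arc[OF R0] e abs_Im_le_cmod by (force simp: U_def)
    have fkh: "(\<lambda>z. f z * k z) holomorphic_on U" by (intro holomorphic_intros fU kh)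
    note cf = Cauchy_split[OF convU int0 fkh R0 RA vB _ sB B1]
    have cf': "contour_integral (right_arc R) (\<lambda>z. f z * k z / z) + contour_integral B (\<lambda>z. f z * k z / z) = 2 * pi * \<i> * f 0"
      "(\<lambda>z. f z * k z / z) contour_integrable_on right_arc R" "(\<lambda>z. f z * k z / z) contour_integrable_on B"
      using cf pB BxU k0 by auto
    have vL: "valid_path (left_arc R)" by simp
    have L1: "((\<lambda>w. 1 / (w - 0)) has_contour_integral (\<i> * pi)) (left_arc R)"
      using contour_inverse_arc[OF R0, of "pi / 2" "3 * pi / 2"] by (simp add: field_simps)
    have L0: "0 \<notin> path_image (left_arc R)" using path_image_left_arc[OF R0] R by auto
    have Skh: "(\<lambda>z. S z * k z) holomorphic_on UNIV" by (intro holomorphic_intros Sh kh)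
    note cS = Cauchy_split[OF convex_UNIV _ Skh R0 _ vL _ _ _ L1 L0]
    have cS': "contour_integral (right_arc R) (\<lambda>z. S z * k z / z) + contour_integral (left_arc R) (\<lambda>z. S z * k z / z) = 2 * pi * \<i> * S 0"
      "(\<lambda>z. S z * k z / z) contour_integrable_on right_arc R" "(\<lambda>z. S z * k z / z) contour_integrable_on left_arc R"
      using cS k0 left_arc_ends by auto
    define I1 I2 I3 where "I1 = contour_integral (right_arc R) (\<lambda>z. f z * k z / z - S z * k z / z)"
      and "I2 = contour_integral (left_arc R) (\<lambda>z. S z * k z / z)"
      and "I3 = contour_integral B (\<lambda>z. f z * k z / z)"
    have key: "2 * pi * \<i> * (f 0 - S 0) = I1 + I3 - I2"
      unfolding I1_def contour_integral_diff[OF cf'(2) cS'(2)] I2_def I3_def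
      using cf'(1) cS'(1) by (simp add: algebra_simps)
    have b1: "norm I1 \<le> 2 / R\<^sup>2 * R * (pi / 2 - (- pi / 2))"
    proof (rule has_contour_integral_bound_part_circlepath_strong)
      show "((\<lambda>z. f z * k z / z - S z * k z / z) has_contour_integral I1) (right_arc R)"
        unfolding I1_def by (intro has_contour_integral_integral contour_integrable_diff cf' cS')
      show "finite {\<i> * of_real R, - (\<i> * of_real R)}" by simp
      fix z assume "z \<in> path_image (right_arc R) - {\<i> * of_real R, - (\<i> * of_real R)}"
      then have z: "norm z = R" "Re z > 0"
        using path_image_right_arc[OF R0] circle_imaginary[of z R] by (auto simp: le_less subset_iff)
      have tail: "(\<lambda>n. a (Suc (n + N)) * nexp (Suc (n + N)) (1 + z)) sums (f z - S z)"
        using sums_split_initial_segment[OF eq[OF z(2)], of N] by (simp add: S_def)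
      have nt: "norm (a (Suc (n + N)) * nexp (Suc (n + N)) (1 + z)) \<le> real (Suc (n + N)) powr (- 1 - Re z)" for n
      proof -
        have "norm (a (Suc (n + N))) * norm (nexp (Suc (n + N)) (1 + z)) \<le> 1 * norm (nexp (Suc (n + N)) (1 + z))"
          by (intro mult_right_mono a) simp
        then show ?thesis by (simp add: norm_mult norm_nexp minus_diff_commute)
      qed
      have "norm (f z - S z) \<le> (\<Sum>n. real (Suc (n + N)) powr (- 1 - Re z))"
        unfolding sums_unique[OF tail] by (rule norm_suminf_le[OF nt tail_powr_bound(1)[OF z(2) N]])
      also have "\<dots> \<le> real N powr - Re z / Re z" by (rule tail_powr_bound(2)[OF z(2) N])
      finally have "norm (f z - S z) * norm (k z / z) \<le> real N powr - Re z / Re z * norm (k z / z)"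
        by (intro mult_right_mono) auto
      also have "\<dots> = 2 / R\<^sup>2 * (real N powr - Re z * real N powr Re z)"
        unfolding kc[OF z(1)] using z(2) by (simp add: field_simps)
      also have "\<dots> = 2 / R\<^sup>2" using N by (simp add: powr_add[symmetric])
      finally show "norm (f z * k z / z - S z * k z / z) \<le> 2 / R\<^sup>2"
        by (simp add: norm_mult[symmetric] algebra_simps diff_divide_distrib)
    qed (use R in auto)
    have b2: "norm I2 \<le> (2 / R\<^sup>2 + 2 / (N * R)) * R * (3 * pi / 2 - pi / 2)"
    proof (rule has_contour_integral_bound_part_circlepath_strong)
      show "((\<lambda>z. S z * k z / z) has_contour_integral I2) (left_arc R)"
        unfolding I2_def by (intro has_contour_integral_integral cS')
      show "finite {\<i> * of_real R, - (\<i> * of_real R)}" by simp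
      fix z assume "z \<in> path_image (left_arc R) - {\<i> * of_real R, - (\<i> * of_real R)}"
      then have z: "norm z = R" "Re z < 0"
        using path_image_left_arc[OF R0] circle_imaginary[of z R] by (auto simp: le_less subset_iff)
      define y where "y = - Re z"
      have y: "y > 0" "y \<le> R" using z abs_Re_le_cmod[of z] by (auto simp: y_def)
      have nt: "norm (a (Suc n) * nexp (Suc n) (1 + z)) \<le> real (Suc n) powr (y - 1)" for n
      proof -
        have "norm (a (Suc n)) * norm (nexp (Suc n) (1 + z)) \<le> 1 * norm (nexp (Suc n) (1 + z))"
          by (intro mult_right_mono a) simp
        then show ?thesis by (simp add: norm_mult norm_nexp y_def minus_diff_commute)
      qed
      have "norm (S z) \<le> (\<Sum>n<N. real (Suc n) powr (y - 1))"
        unfolding S_def by (intro sum_norm_le nt)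
      also have "\<dots> \<le> real N powr y / y + real N powr (y - 1)" by (rule partial_powr_bound[OF y(1) N])
      finally have "norm (S z) * norm (k z / z) \<le> (real N powr y / y + real N powr (y - 1)) * norm (k z / z)"
        by (intro mult_right_mono) auto
      also have "\<dots> = (real N powr y / y + real N powr y / real N) * (real N powr - y * (2 * y / R\<^sup>2))"
        unfolding kc[OF z(1)] using y N by (simp add: y_def powr_diff)
      also have "\<dots> = (real N powr y * real N powr - y) * (2 / R\<^sup>2 + 2 * y / (N * R\<^sup>2))"
        using y N by (simp add: field_simps)
      also have "\<dots> = 2 / R\<^sup>2 + 2 * y / (N * R\<^sup>2)" using N by (simp add: powr_add[symmetric])
      also have "\<dots> \<le> 2 / R\<^sup>2 + 2 / (N * R)"
        using y R N by (simp add: field_simps power2_eq_square)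
      finally show "norm (S z * k z / z) \<le> 2 / R\<^sup>2 + 2 / (N * R)"
        by (simp add: norm_mult[symmetric])
    qed (use R in auto)
    have int: "(\<lambda>z. f z * k z / z) contour_integrable_on p1" "(\<lambda>z. f z * k z / z) contour_integrable_on p2"
        "(\<lambda>z. f z * k z / z) contour_integrable_on p3"
      and I3: "I3 = contour_integral p1 (\<lambda>z. f z * k z / z) + (contour_integral p2 (\<lambda>z. f z * k z / z) + contour_integral p3 (\<lambda>z. f z * k z / z))"
    proof -
      have v: "valid_path p1" "valid_path p2" "valid_path p3" "pathfinish p1 = pathstart p2" "pathfinish p2 = pathstart p3"
        by (simp_all add: p1_def p2_def p3_def)
      then have v': "valid_path (p2 +++ p3)" "pathfinish p1 = pathstart (p2 +++ p3)" by (auto intro: valid_path_join)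
      show i1: "(\<lambda>z. f z * k z / z) contour_integrable_on p1"
        using contour_integrable_joinD1[of _ p1 "p2 +++ p3"] cf'(3) v by (simp add: B_def)
      have i23: "(\<lambda>z. f z * k z / z) contour_integrable_on (p2 +++ p3)"
        using contour_integrable_joinD2[of _ p1 "p2 +++ p3"] cf'(3) v' by (simp add: B_def)
      show i2: "(\<lambda>z. f z * k z / z) contour_integrable_on p2"
        using contour_integrable_joinD1[OF i23] v by simp
      show i3: "(\<lambda>z. f z * k z / z) contour_integrable_on p3"
        using contour_integrable_joinD2[OF i23] v by simp
      show "I3 = contour_integral p1 (\<lambda>z. f z * k z / z) + (contour_integral p2 (\<lambda>z. f z * k z / z) + contour_integral p3 (\<lambda>z. f z * k z / z))"
        unfolding I3_def B_def by (simp add: contour_integral_join i1 i2 i3 i23 v v')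
    qed
    have kb: "norm (f z * k z / z) \<le> M * real N powr Re z / norm z" if "z \<in> Bx" for z
    proof -
      have "norm (f z * k z / z) = norm (f z * (1 + z\<^sup>2 / (of_real R)\<^sup>2)) * real N powr Re z / norm z"
        using N by (simp add: k_def norm_mult norm_divide norm_nexp)
      also have "\<dots> \<le> M * real N powr Re z / norm z"
        by (intro divide_right_mono mult_right_mono M that) auto
      finally show ?thesis .
    qed
    have horiz: "norm (f z * k z / z) \<le> M" if "z \<in> Bx" "norm z \<ge> R" for z
    proof -
      have "real N powr Re z \<le> real N powr 0" using that N by (intro powr_mono) (auto simp: Bx_def)
      then have "M * real N powr Re z / norm z \<le> M * 1 / 1"
        using that R M N by (intro frac_le mult_left_mono) auto
      then show ?thesis using kb[OF that(1)] by simp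
    qed
    have c1: "norm (contour_integral p1 (\<lambda>z. f z * k z / z)) \<le> M * norm ((- of_real d + \<i> * of_real R) - \<i> * of_real R)"
      unfolding p1_def
    proof (rule contour_integral_bound_linepath)
      show "(\<lambda>z. f z * k z / z) contour_integrable_on linepath (\<i> * of_real R) (- of_real d + \<i> * of_real R)"
        using int(1) by (simp add: p1_def)
      fix z assume "z \<in> closed_segment (\<i> * of_real R) (- of_real d + \<i> * of_real R)"
      then have "z \<in> path_image p1" by (simp add: p1_def)
      then show "norm (f z * k z / z) \<le> M" using pim(1) d by (intro horiz) (auto simp: Bx_def)
    qed (use M in auto)
    have c3: "norm (contour_integral p3 (\<lambda>z. f z * k z / z)) \<le> M * norm (- (\<i> * of_real R) - (- of_real d - \<i> * of_real R))"
      unfolding p3_def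
    proof (rule contour_integral_bound_linepath)
      show "(\<lambda>z. f z * k z / z) contour_integrable_on linepath (- of_real d - \<i> * of_real R) (- (\<i> * of_real R))"
        using int(3) by (simp add: p3_def)
      fix z assume "z \<in> closed_segment (- of_real d - \<i> * of_real R) (- (\<i> * of_real R))"
      then have "z \<in> path_image p3" by (simp add: p3_def)
      then show "norm (f z * k z / z) \<le> M" using pim(3) d by (intro horiz) (auto simp: Bx_def)
    qed (use M in auto)
    have c2: "norm (contour_integral p2 (\<lambda>z. f z * k z / z)) \<le> (M * real N powr - d / d) * norm ((- of_real d - \<i> * of_real R) - (- of_real d + \<i> * of_real R))"
      unfolding p2_def
    proof (rule contour_integral_bound_linepath)
      show "(\<lambda>z. f z * k z / z) contour_integrable_on linepath (- of_real d + \<i> * of_real R) (- of_real d - \<i> * of_real R)"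
        using int(2) by (simp add: p2_def)
      fix z assume "z \<in> closed_segment (- of_real d + \<i> * of_real R) (- of_real d - \<i> * of_real R)"
      then have z: "Re z = - d" "z \<in> Bx" using pim(2) d by (auto simp: p2_def Bx_def)
      have "norm (f z * k z / z) \<le> M * real N powr - d / norm z" using kb[OF z(2)] z by simp
      also have "\<dots> \<le> M * real N powr - d / d"
        using abs_Re_le_cmod[of z] z d M by (intro divide_left_mono mult_pos_pos mult_nonneg_nonneg) auto
      finally show "norm (f z * k z / z) \<le> M * real N powr - d / d" .
    qed (use M d in auto)
    have n1: "norm ((- of_real d + \<i> * of_real R) - \<i> * of_real R) = d"
      "norm (- (\<i> * of_real R) - (- of_real d - \<i> * of_real R)) = d" using d by simp_all
    have "(- of_real d - \<i> * of_real R) - (- of_real d + \<i> * of_real R) = - (2 * \<i> * of_real R)" by simp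
    then have n2: "norm ((- of_real d - \<i> * of_real R) - (- of_real d + \<i> * of_real R)) = 2 * R"
      using R by (simp only: norm_minus_cancel norm_mult) simp
    have b3: "norm I3 \<le> 2 * (d * M) + 2 * (R * M / d * real N powr - d)"
    proof -
      have "norm I3 \<le> M * d + ((M * real N powr - d / d) * (2 * R) + M * d)"
        unfolding I3 using c1 c2 c3 unfolding n1 n2 by (intro norm_triangle_le add_mono) auto
      then show ?thesis by (simp add: field_simps)
    qed
    have norm_scale: "norm (2 * pi * \<i> * (f 0 - S 0)) = 2 * pi * norm (f 0 - S 0)" by (simp add: norm_mult)
    have "norm (2 * pi * \<i> * (f 0 - S 0)) \<le> norm I1 + norm I3 + norm I2"
      unfolding key by (rule norm_triangle_le_diff) (rule add_right_mono, rule norm_triangle_ineq)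
    also have "\<dots> \<le> 2 / R\<^sup>2 * R * pi + (2 * (d * M) + 2 * (R * M / d * real N powr - d)) + (2 / R\<^sup>2 + 2 / (N * R)) * R * pi"
      using b1 b2 b3 by (intro add_mono) simp_all
    also have "\<dots> = 2 * pi * (2 / R + 1 / N) + 2 * (d * M + R * M / d * real N powr - d)"
      using R N by (simp add: field_simps power2_eq_square)
    also have "\<dots> \<le> 2 * pi * (2 / R + 1 / N) + 2 * pi * (d * M + R * M / d * real N powr - d)"
      using d M R pi_gt3 by (intro add_left_mono mult_right_mono add_nonneg_nonneg) auto
    finally have "2 * pi * norm (f 0 - S 0) \<le> 2 * pi * (2 / R + 1 / N + d * M + R * M / d * real N powr - d)"
      unfolding norm_scale by (simp only: distrib_left add.assoc)
    then have "norm (f 0 - S 0) \<le> 2 / R + 1 / N + d * M + R * M / d * real N powr - d"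
      by (subst (asm) mult_le_cancel_left_pos) auto
    then show ?thesis by (simp add: S_def)
  qed
  show ?thesis using main M \<delta> by (intro exI[of _ M] exI[of _ \<delta>]) auto
qed

text \<open>In \<open>newman_estimate\<close> choose \<open>R\<close>, then \<open>d\<close>, and finally \<open>N\<close>.\<close>

theorem newman_tauberian:
  fixes a :: "nat \<Rightarrow> complex"
  assumes a: "\<And>n. norm (a n) \<le> 1" and W: "open W" "{s. Re s \<ge> 1} \<subseteq> W" and G: "G holomorphic_on W"
    and eq: "\<And>s. Re s > 1 \<Longrightarrow> (\<lambda>n. a (Suc n) * nexp (Suc n) s) sums G s"
  shows "(\<lambda>n. a (Suc n) / of_nat (Suc n)) sums G 1"
proof -
  define f where "f z = G (1 + z)" for z
  define V where "V = (\<lambda>z. 1 + z) -` W"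
  have V: "open V" "{z. Re z \<ge> 0} \<subseteq> V"
    using W unfolding V_def by (auto intro!: continuous_open_vimage continuous_intros simp: subset_iff)
  have f: "f holomorphic_on V"
    unfolding f_def V_def by (intro holomorphic_on_compose_gen[OF _ G, unfolded o_def]) (auto intro!: holomorphic_intros)
  have eqf: "(\<lambda>n. a (Suc n) * nexp (Suc n) (1 + z)) sums f z" if "Re z > 0" for z
    unfolding f_def using eq[of "1 + z"] that by simp
  have "(\<lambda>N. \<Sum>n<N. a (Suc n) * nexp (Suc n) 1) \<longlonglongrightarrow> f 0"
  proof (rule LIMSEQ_I)
    fix \<epsilon> :: real assume \<epsilon>: "\<epsilon> > 0"
    define R where "R = max 1 (8 / \<epsilon>)"
    have R: "R \<ge> 1" "2 / R \<le> \<epsilon> / 4" using \<epsilon> by (auto simp: R_def field_simps max_def)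
    obtain M \<delta> where M: "M \<ge> 0" "\<delta> > 0" and est: "\<And>d N. 0 < d \<Longrightarrow> d \<le> \<delta> \<Longrightarrow> N > 0 \<Longrightarrow>
       norm (f 0 - (\<Sum>n<N. a (Suc n) * nexp (Suc n) 1)) \<le> 2 / R + 1 / N + d * M + R * M / d * real N powr - d"
      using newman_estimate[OF a V f eqf R(1)] by blast
    define d where "d = min \<delta> (\<epsilon> / (4 * (M + 1)))"
    have d: "d > 0" "d \<le> \<delta>" using M \<epsilon> by (auto simp: d_def)
    have "d * M \<le> \<epsilon> / (4 * (M + 1)) * M" using M by (intro mult_right_mono) (auto simp: d_def)
    also have "\<dots> \<le> \<epsilon> / 4" using M \<epsilon> by (simp add: field_simps)
    finally have dM: "d * M \<le> \<epsilon> / 4" .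
    have "(\<lambda>N. 1 / real N + R * M / d * real N powr - d) \<longlonglongrightarrow> 0 + R * M / d * 0"
      using d by (intro tendsto_intros tendsto_neg_powr filterlim_real_sequentially lim_1_over_n) auto
    then have "eventually (\<lambda>N. 1 / real N + R * M / d * real N powr - d < \<epsilon> / 4) sequentially"
      using \<epsilon> by (intro order_tendstoD(2)) auto
    then obtain N0 where N0: "\<And>N. N \<ge> N0 \<Longrightarrow> 1 / real N + R * M / d * real N powr - d < \<epsilon> / 4"
      unfolding eventually_sequentially by blast
    have "norm ((\<Sum>n<N. a (Suc n) * nexp (Suc n) 1) - f 0) < \<epsilon>" if "N \<ge> max 1 N0" for N
    proof -
      have "N > 0" "N \<ge> N0" using that by auto
      then show ?thesis using est[OF d, of N] N0[of N] dM R(2) \<epsilon>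
        unfolding norm_minus_commute[of _ "f 0"] by linarith
    qed
    then show "\<exists>N0. \<forall>N\<ge>N0. norm ((\<Sum>n<N. a (Suc n) * nexp (Suc n) 1) - f 0) < \<epsilon>" by blast
  qed
  then show ?thesis by (simp add: sums_def nexp_1_right f_def field_simps)
qed

section \<open>Rearranging double series by the product of the indices\<close>

text \<open>A pair of positive integers corresponds to its product together with the first factor as a divisor.
Everything is shifted by one because series run over \<open>Suc n\<close>.\<close>

lemma bij_divisor_pairs:
  "bij_betw (\<lambda>(n, d). (d - 1, Suc n div d - 1)) (SIGMA n:UNIV. {d. d dvd Suc n}) (UNIV :: (nat \<times> nat) set)"
proof (rule bij_betwI[of _ _ _ "\<lambda>(i, j). (Suc i * Suc j - 1, Suc i)"])
  show "(\<lambda>(i, j). (Suc i * Suc j - 1, Suc i)) \<in> UNIV \<rightarrow> (SIGMA n:UNIV. {d. d dvd Suc n})"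
  proof
    fix x :: "nat \<times> nat"
    obtain i j where x: "x = (i, j)" by (cases x)
    have "Suc (Suc i * Suc j - 1) = Suc i * Suc j" by simp
    then have "Suc i dvd Suc (Suc i * Suc j - 1)" by (metis dvd_triv_left)
    then show "(case x of (i, j) \<Rightarrow> (Suc i * Suc j - 1, Suc i)) \<in> (SIGMA n:UNIV. {d. d dvd Suc n})"
      using x by auto
  qed
next
  fix x assume "x \<in> (SIGMA n:UNIV. {d. d dvd Suc n})"
  then obtain n d where x: "x = (n, d)" "d dvd Suc n" by auto
  then obtain e where e: "Suc n = d * e" by (elim dvdE)
  then have pos: "d > 0" "e > 0" by (metis mult_is_0 nat.distinct(1) gr0I)+
  then have "Suc n div d = e" unfolding e by simp
  then show "(case case x of (n, d) \<Rightarrow> (d - 1, Suc n div d - 1) of (i, j) \<Rightarrow> (Suc i * Suc j - 1, Suc i)) = x"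
    using pos by (simp only: x(1) prod.case \<open>Suc n div d = e\<close> Suc_diff_1 e[symmetric] diff_Suc_1)
next
  fix y :: "nat \<times> nat"
  obtain i j where y: "y = (i, j)" by (cases y)
  have "Suc (Suc i * Suc j - 1) div Suc i = Suc j" using nonzero_mult_div_cancel_left[of "Suc i" "Suc j"] by simp
  then show "(case case y of (i, j) \<Rightarrow> (Suc i * Suc j - 1, Suc i) of (n, d) \<Rightarrow> (d - 1, Suc n div d - 1)) = y"
    by (simp add: y)
qed auto

text \<open>This serves both products of Dirichlet series, where \<open>F d e\<close> contains \<open>(d e)^(-s)\<close>, and Lambert series,
where it contains \<open>t^(d e)\<close>.\<close>

lemma has_sum_by_products:
  fixes F :: "nat \<Rightarrow> nat \<Rightarrow> 'a :: banach"
  assumes "((\<lambda>(i, j). F (Suc i) (Suc j)) has_sum S) UNIV"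
  shows "(\<lambda>n. \<Sum>d | d dvd Suc n. F d (Suc n div d)) sums S"
proof -
  have "((\<lambda>x. (\<lambda>(i, j). F (Suc i) (Suc j)) ((\<lambda>(n, d). (d - 1, Suc n div d - 1)) x)) has_sum S)
     (SIGMA n:UNIV. {d. d dvd Suc n})"
    using assms unfolding has_sum_reindex_bij_betw[OF bij_divisor_pairs] .
  also have "?this \<longleftrightarrow> ((\<lambda>(n, d). F d (Suc n div d)) has_sum S) (SIGMA n:UNIV. {d. d dvd Suc n})"
  proof (intro has_sum_cong)
    fix x assume "x \<in> (SIGMA n:UNIV. {d. d dvd Suc n})"
    then obtain n d where x: "x = (n, d)" "d dvd Suc n" by auto
    then obtain e where e: "Suc n = d * e" by (elim dvdE)
    then have "d > 0" "e > 0" by (metis mult_is_0 nat.distinct(1) gr0I)+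
    moreover from this have "Suc n div d = e" unfolding e by simp
    ultimately show "(\<lambda>(i, j). F (Suc i) (Suc j)) ((\<lambda>(n, d). (d - 1, Suc n div d - 1)) x) = (case x of (n, d) \<Rightarrow> F d (Suc n div d))"
      using x by simp
  qed
  finally have "((\<lambda>(n, d). F d (Suc n div d)) has_sum S) (SIGMA n:UNIV. {d. d dvd Suc n})" .
  then have "((\<lambda>n. \<Sum>d | d dvd Suc n. F d (Suc n div d)) has_sum S) UNIV"
    by (rule has_sum_SigmaD) (auto intro!: has_sum_finite)
  then show ?thesis by (rule has_sum_imp_sums)
qed

lemma has_sum_double:
  fixes G :: "nat \<Rightarrow> nat \<Rightarrow> complex"
  assumes rows: "\<And>i. summable (\<lambda>j. norm (G i j))"
    and cols: "summable (\<lambda>i. \<Sum>j. norm (G i j))"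
  shows "((\<lambda>(i, j). G i j) has_sum (\<Sum>i. \<Sum>j. G i j)) UNIV"
proof -
  have r: "(\<lambda>j. norm (G i j)) summable_on UNIV" for i
    using norm_summable_imp_summable_on[of "\<lambda>j. norm (G i j)"] rows by simp
  have rs: "infsum (\<lambda>j. norm (G i j)) UNIV = (\<Sum>j. norm (G i j))" for i
    using has_sum_imp_sums[OF has_sum_infsum[OF r[of i]]] sums_unique by fastforce
  have "(\<lambda>x. norm (case x of (i, j) \<Rightarrow> G i j)) summable_on (UNIV \<times> UNIV)"
    unfolding Infinite_Sum.abs_summable_on_Sigma_iff
  proof (intro conjI ballI)
    show "(\<lambda>y. norm (case (x, y) of (i, j) \<Rightarrow> G i j)) summable_on UNIV" for x using r by simp
    have "(\<lambda>i. \<Sum>j. norm (G i j)) summable_on UNIV"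
      using cols rows by (intro norm_summable_imp_summable_on) (simp add: suminf_nonneg)
    then show "(\<lambda>x. norm (infsum (\<lambda>y. norm (case (x, y) of (i, j) \<Rightarrow> G i j)) UNIV)) summable_on UNIV"
      using rows by (simp add: rs suminf_nonneg)
  qed
  then have "(\<lambda>(i, j). G i j) summable_on (UNIV \<times> UNIV)" by (rule abs_summable_summable)
  then obtain S where S: "((\<lambda>(i, j). G i j) has_sum S) (UNIV \<times> UNIV)" unfolding summable_on_def by blast
  have "((\<lambda>i. \<Sum>j. G i j) has_sum S) UNIV"
  proof (rule has_sum_SigmaD[OF S])
    fix i
    show "((\<lambda>y. case (i, y) of (i, j) \<Rightarrow> G i j) has_sum (\<Sum>j. G i j)) UNIV"
      using norm_summable_imp_has_sum[OF rows summable_sums[OF summable_norm_cancel[OF rows]]] by simp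
  qed
  then have "S = (\<Sum>i. \<Sum>j. G i j)" using has_sum_imp_sums sums_unique by blast
  then show ?thesis using S by simp
qed

lemma sums_divisor_convolution:
  fixes u v :: "nat \<Rightarrow> complex"
  assumes u: "summable (\<lambda>n. norm (u (Suc n)))" and v: "summable (\<lambda>n. norm (v (Suc n)))"
  shows "(\<lambda>n. \<Sum>d | d dvd Suc n. u d * v (Suc n div d)) sums ((\<Sum>n. u (Suc n)) * (\<Sum>n. v (Suc n)))"
proof (rule has_sum_by_products[of "\<lambda>i j. u i * v j"])
  have eq: "(\<Sum>i. \<Sum>j. u (Suc i) * v (Suc j)) = (\<Sum>n. u (Suc n)) * (\<Sum>n. v (Suc n))"
    by (simp add: suminf_mult[OF summable_norm_cancel[OF v]] suminf_mult2[OF summable_norm_cancel[OF u]])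
  show "((\<lambda>(i, j). u (Suc i) * v (Suc j)) has_sum ((\<Sum>n. u (Suc n)) * (\<Sum>n. v (Suc n)))) UNIV"
    unfolding eq[symmetric]
  proof (rule has_sum_double)
    show "summable (\<lambda>j. norm (u (Suc i) * v (Suc j)))" for i
      unfolding norm_mult by (intro summable_mult v)
    show "summable (\<lambda>i. \<Sum>j. norm (u (Suc i) * v (Suc j)))"
      unfolding norm_mult suminf_mult[OF v] by (intro summable_mult2 u)
  qed
qed

section \<open>Dirichlet series with periodic coefficients\<close>

text \<open>The power \<open>w^(-s)\<close> with complex base, for estimates by the derivative with respect to the base.\<close>

definition rexp :: "complex \<Rightarrow> complex \<Rightarrow> complex" where
  "rexp w s = exp (- (s * Ln w))"

lemma nexp_eq_rexp: "n > 0 \<Longrightarrow> nexp n s = rexp (of_nat n) s"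
  by (simp add: nexp_def rexp_def Ln_of_nat)

lemma norm_rexp: "x > 0 \<Longrightarrow> norm (rexp (of_real x) s) = x powr - Re s"
  by (simp add: rexp_def Ln_of_real powr_def)

lemma rexp_deriv:
  assumes "w \<notin> \<real>\<^sub>\<le>\<^sub>0"
  shows "((\<lambda>w. rexp w s) has_field_derivative - s * rexp w (s + 1)) (at w within A)"
proof -
  have "w \<noteq> 0" using assms by auto
  have "rexp w (s + 1) = rexp w s / w"
    using \<open>w \<noteq> 0\<close> by (simp add: rexp_def exp_diff exp_minus distrib_right exp_Ln divide_inverse exp_add)
  then show ?thesis unfolding rexp_def using assms
    by (auto intro!: derivative_eq_intros simp: divide_inverse)
qed

lemma segment_nat: "z \<in> closed_segment (of_nat n) (of_nat (Suc n)) \<Longrightarrow> \<exists>x. z = of_real x \<and> real n \<le> x \<and> x \<le> real (Suc n)"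
proof -
  assume "z \<in> closed_segment (of_nat n) (of_nat (Suc n))"
  then obtain u where u: "0 \<le> u" "u \<le> 1" "z = (1 - u) *\<^sub>R of_nat n + u *\<^sub>R of_nat (Suc n)"
    by (auto simp: closed_segment_def)
  then have "z = of_real (real n + u)" by (simp add: scaleR_conv_of_real algebra_simps)
  then show ?thesis using u by (intro exI[of _ "real n + u"]) auto
qed

lemma rexp_variation:
  assumes n: "n > 0" and s: "Re s > - 1"
    and xy: "x \<in> closed_segment (of_nat n) (of_nat (Suc n))" "y \<in> closed_segment (of_nat n) (of_nat (Suc n))"
  shows "norm (rexp x s - rexp y s) \<le> norm s * real n powr (- Re s - 1) * norm (x - y)"
proof (rule field_differentiable_bound[OF convex_closed_segment _ _ xy])
  fix z assume "z \<in> closed_segment (of_nat n) (of_nat (Suc n) :: complex)"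
  then obtain x where x: "z = of_real x" "real n \<le> x" using segment_nat by blast
  have "x > 0" using x n by simp
  then have "z \<notin> \<real>\<^sub>\<le>\<^sub>0" using x by (auto simp: complex_nonpos_Reals_iff)
  then show "((\<lambda>w. rexp w s) has_field_derivative - s * rexp z (s + 1)) (at z within closed_segment (of_nat n) (of_nat (Suc n)))"
    by (rule rexp_deriv)
  have "norm (rexp z (s + 1)) = x powr (- Re s - 1)" using norm_rexp[OF \<open>x > 0\<close>] x by (simp add: minus_diff_commute)
  also have "\<dots> \<le> real n powr (- Re s - 1)" using x n s by (intro powr_mono2') auto
  finally show "norm (- s * rexp z (s + 1)) \<le> norm s * real n powr (- Re s - 1)"
    by (simp add: norm_mult mult_left_mono)
qed

lemma nexp_step_bound:
  assumes n: "n > 0" and s: "Re s > - 1"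
  shows "norm (nexp n s - nexp (Suc n) s) \<le> norm s * real n powr (- Re s - 1)"
  using rexp_variation[OF n s, of "of_nat n" "of_nat (Suc n)"] n
  by (simp add: nexp_eq_rexp)

text \<open>The bracket \<open>nexp n (s - 1) - nexp (Suc n) (s - 1)\<close> is \<open>s - 1\<close> times the integral of \<open>x^(-s)\<close> over
\<open>[n, n + 1]\<close>. The estimate bounds the derivative of \<open>(s - 1) n^(-s) x + x^(1 - s)\<close> on that interval, so that
\<open>s = 1\<close> need not be singled out.\<close>

lemma nexp_second_step_bound:
  assumes n: "n > 0" and s: "Re s > 0"
  shows "norm ((s - 1) * nexp n s - (nexp n (s - 1) - nexp (Suc n) (s - 1))) \<le> norm (s - 1) * norm s * real n powr (- Re s - 1)"
proof -
  let ?S = "closed_segment (of_nat n) (of_nat (Suc n)) :: complex set"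
  define g where "g w = (s - 1) * rexp (of_nat n) s * w + rexp w (s - 1)" for w
  have "norm (g (of_nat (Suc n)) - g (of_nat n)) \<le> norm (s - 1) * norm s * real n powr (- Re s - 1) * norm (of_nat (Suc n) - of_nat n :: complex)"
  proof (rule field_differentiable_bound[OF convex_closed_segment])
    fix z assume z: "z \<in> ?S"
    then obtain x where x: "z = of_real x" "real n \<le> x" "x \<le> real (Suc n)" using segment_nat by blast
    have "x > 0" using x n by simp
    then have "z \<notin> \<real>\<^sub>\<le>\<^sub>0" using x by (auto simp: complex_nonpos_Reals_iff)
    then show "(g has_field_derivative (s - 1) * (rexp (of_nat n) s - rexp z s)) (at z within ?S)"
      unfolding g_def by (auto intro!: derivative_eq_intros rexp_deriv simp: algebra_simps)
    have "norm (rexp (of_nat n) s - rexp z s) \<le> norm s * real n powr (- Re s - 1) * norm (of_nat n - z)"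
      using z s by (intro rexp_variation[OF n]) auto
    also have "\<dots> \<le> norm s * real n powr (- Re s - 1) * 1"
    proof (intro mult_left_mono)
      have "of_nat n - z = of_real (real n - x)" using x by simp
      then show "norm (of_nat n - z) \<le> 1" using x by (simp only: norm_of_real)
    qed auto
    finally show "norm ((s - 1) * (rexp (of_nat n) s - rexp z s)) \<le> norm (s - 1) * norm s * real n powr (- Re s - 1)"
      by (simp add: norm_mult mult_left_mono mult.assoc)
  qed auto
  moreover have "g (of_nat (Suc n)) - g (of_nat n) = (s - 1) * nexp n s - (nexp n (s - 1) - nexp (Suc n) (s - 1))"
    using n by (simp add: g_def nexp_eq_rexp algebra_simps)
  ultimately show ?thesis by simp
qed

text \<open>The term bound makes the series converge locally uniformly. Its shape covers both continuations
below.\<close>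

lemma holomorphic_series:
  fixes h :: "nat \<Rightarrow> complex \<Rightarrow> complex"
  assumes hol: "\<And>n. h n holomorphic_on {s. Re s > 0}"
    and bd: "\<And>n s. Re s > 0 \<Longrightarrow> norm (h n s) \<le> (norm s + 1)\<^sup>2 * C * real (Suc n) powr (- Re s - 1)"
    and C: "C \<ge> 0"
  shows "\<exists>g. g holomorphic_on {s. Re s > 0} \<and> (\<forall>s. Re s > 0 \<longrightarrow> (\<lambda>n. h n s) sums g s)"
proof -
  let ?S = "{s. Re s > 0}"
  have op: "open ?S" by (rule open_halfspace_Re_gt)
  have "\<exists>g g'. \<forall>x\<in>?S. ((\<lambda>n. h n x) sums g x) \<and> ((\<lambda>n. deriv (h n) x) sums g' x) \<and> (g has_field_derivative g' x) (at x)"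
  proof (rule series_and_derivative_comparison_complex[OF op])
    show "(h n has_field_derivative deriv (h n) x) (at x)" if "x \<in> ?S" for n x
      using holomorphic_derivI[OF hol op that] .
  next
    fix x assume x: "x \<in> ?S"
    define \<sigma> where "\<sigma> = Re x / 2"
    define B where "B = (norm x + \<sigma> + 1)\<^sup>2 * C"
    have \<sigma>: "\<sigma> > 0" using x by (simp add: \<sigma>_def)
    define m :: "nat \<Rightarrow> complex" where "m n = of_real (B * real (Suc n) powr (- \<sigma> - 1))" for n
    have B: "B \<ge> 0" using C by (simp add: B_def)
    have "summable (\<lambda>n. real n powr (- \<sigma> - 1))" using \<sigma> by (subst summable_real_powr_iff) simp
    then have "summable (\<lambda>n. real (Suc n) powr (- \<sigma> - 1))" by (subst summable_Suc_iff)
    then have "summable m" unfolding m_def by (intro summable_of_real summable_mult)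
    moreover have "range m \<subseteq> \<real>\<^sub>\<ge>\<^sub>0" using B by (auto simp: m_def)
    moreover have "norm (h n y) \<le> norm (m n)" if y: "y \<in> ball x \<sigma> \<inter> ?S" for n y
    proof -
      have d: "norm (x - y) < \<sigma>" using y by (simp add: dist_norm)
      have "\<bar>Re x - Re y\<bar> < \<sigma>" using abs_Re_le_cmod[of "x - y"] d by simp
      then have re: "Re y \<ge> \<sigma>" using abs_ge_self[of "Re x - Re y"] unfolding \<sigma>_def by linarith
      have ny: "norm y \<le> norm x + \<sigma>" using d norm_triangle_ineq2[of y x] by (simp add: norm_minus_commute)
      have "norm (h n y) \<le> (norm y + 1)\<^sup>2 * C * real (Suc n) powr (- Re y - 1)" using y by (intro bd) auto
      also have "\<dots> \<le> B * real (Suc n) powr (- \<sigma> - 1)"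
        unfolding B_def using ny C re \<sigma> by (intro mult_mono power_mono powr_mono) auto
      finally show ?thesis using B by (simp add: m_def norm_mult)
    qed
    ultimately show "\<exists>d h'. 0 < d \<and> summable h' \<and> range h' \<subseteq> \<real>\<^sub>\<ge>\<^sub>0 \<and> (\<forall>\<^sub>F n in sequentially. \<forall>y\<in>ball x d \<inter> ?S. cmod (h n y) \<le> cmod (h' n))"
      using \<sigma> by (intro exI[of _ \<sigma>] exI[of _ m]) (auto intro!: always_eventually)
  qed
  then obtain g g' where g: "\<forall>x\<in>?S. ((\<lambda>n. h n x) sums g x) \<and> ((\<lambda>n. deriv (h n) x) sums g' x) \<and> (g has_field_derivative g' x) (at x)" by blast
  have "g holomorphic_on ?S" unfolding holomorphic_on_open[OF op] using g by blast
  then show ?thesis using g by blast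
qed

text \<open>Subtracting the telescoping series \<open>n^(1-s) - (n+1)^(1-s)\<close>, which sums to \<open>1\<close>, from \<open>(s - 1) \<Sum> n^(-s)\<close>
leaves a series that converges for \<open>Re s > 0\<close> and vanishes at \<open>1\<close>. Dividing by \<open>s - 1\<close> therefore
leaves only a removable singularity.\<close>

lemma zeta_continuation:
  "\<exists>E. E holomorphic_on {s. Re s > 0} \<and> (\<forall>s. Re s > 1 \<longrightarrow> (\<lambda>n. nexp (Suc n) s) sums (1 / (s - 1) + E s))"
proof -
  let ?S = "{s. Re s > 0}"
  define h where "h n s = (s - 1) * nexp (Suc n) s - (nexp (Suc n) (s - 1) - nexp (Suc (Suc n)) (s - 1))" for n s
  obtain g where g: "g holomorphic_on ?S" "\<And>s. Re s > 0 \<Longrightarrow> (\<lambda>n. h n s) sums g s"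
  proof -
    have "\<exists>g. g holomorphic_on ?S \<and> (\<forall>s. Re s > 0 \<longrightarrow> (\<lambda>n. h n s) sums g s)"
    proof (rule holomorphic_series[where C = 1])
      show "h n holomorphic_on ?S" for n unfolding h_def by (intro holomorphic_intros)
      fix n s assume s: "Re s > 0"
      have "norm (h n s) \<le> norm (s - 1) * norm s * real (Suc n) powr (- Re s - 1)"
        unfolding h_def by (rule nexp_second_step_bound) (use s in auto)
      also have "norm (s - 1) * norm s \<le> (norm s + 1)\<^sup>2 * 1"
        using norm_triangle_ineq4[of s 1] unfolding power2_eq_square mult_1_right by (intro mult_mono) auto
      finally show "norm (h n s) \<le> (norm s + 1)\<^sup>2 * 1 * real (Suc n) powr (- Re s - 1)"
        by (simp add: mult_right_mono)
    qed auto
    then show ?thesis using that by blast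
  qed
  have "h n 1 = 0" for n by (simp add: h_def)
  then have g1: "g 1 = 0" using g(2)[of 1] sums_unique2[OF _ sums_zero] by simp
  define E where "E z = (if z = 1 then deriv g 1 else (g z - g 1) / (z - 1))" for z
  have "1 \<in> interior ?S" by (simp add: interior_open open_halfspace_Re_gt)
  then have "E holomorphic_on ?S" unfolding E_def by (rule pole_lemma[OF g(1)])
  moreover have "(\<lambda>n. nexp (Suc n) s) sums (1 / (s - 1) + E s)" if s: "Re s > 1" for s
  proof -
    have s1: "s \<noteq> 1" using s by auto
    have lim: "(\<lambda>n. nexp (Suc n) (s - 1)) \<longlonglongrightarrow> 0"
    proof (rule tendsto_norm_zero_cancel)
      have "(\<lambda>n. real (Suc n) powr - (Re s - 1)) \<longlonglongrightarrow> 0"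
        using s by real_asymp
      then show "(\<lambda>n. norm (nexp (Suc n) (s - 1))) \<longlonglongrightarrow> 0" by (simp add: norm_nexp)
    qed
    have "(\<lambda>n. nexp (Suc n) (s - 1) - nexp (Suc (Suc n)) (s - 1)) sums (nexp (Suc 0) (s - 1) - 0)"
      by (rule telescope_sums'[OF lim])
    from sums_add[OF g(2)[of s] this] have "(\<lambda>n. (s - 1) * nexp (Suc n) s) sums (g s + 1)"
      using s by (simp add: h_def)
    from sums_divide[OF this, of "s - 1"] have "(\<lambda>n. nexp (Suc n) s) sums ((g s + 1) / (s - 1))"
      using s1 by simp
    moreover have "(g s + 1) / (s - 1) = 1 / (s - 1) + E s" using s1 g1 by (simp add: E_def add_divide_distrib)
    ultimately show ?thesis by simp
  qed
  ultimately show ?thesis by blast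
qed

text \<open>Abel summation: the differences of \<open>n^(-s)\<close> gain the factor \<open>1 / n\<close> that is missing for
convergence.\<close>

lemma bounded_partial_sums_continuation:
  fixes c :: "nat \<Rightarrow> complex"
  assumes B: "\<And>N. norm (\<Sum>n<N. c (Suc n)) \<le> B"
  shows "\<exists>E. E holomorphic_on {s. Re s > 0} \<and> (\<forall>s. Re s > 0 \<longrightarrow> (\<lambda>n. c (Suc n) * nexp (Suc n) s) sums E s)"
proof -
  let ?S = "{s. Re s > 0}"
  define C where "C N = (\<Sum>n<N. c (Suc n))" for N
  have B0: "B \<ge> 0" using B[of 0] by simp
  define h where "h n s = C (Suc n) * (nexp (Suc n) s - nexp (Suc (Suc n)) s)" for n s
  have "\<exists>g. g holomorphic_on ?S \<and> (\<forall>s. Re s > 0 \<longrightarrow> (\<lambda>n. h n s) sums g s)"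
  proof (rule holomorphic_series[OF _ _ B0])
    show "h n holomorphic_on ?S" for n unfolding h_def by (intro holomorphic_intros)
    fix n s assume s: "Re s > 0"
    have "norm s \<le> (norm s + 1)\<^sup>2" by (simp add: power2_eq_square algebra_simps)
    then have "norm s * B \<le> (norm s + 1)\<^sup>2 * B" by (intro mult_right_mono B0)
    have "norm (h n s) \<le> B * (norm s * real (Suc n) powr (- Re s - 1))"
      unfolding h_def norm_mult C_def using s by (intro mult_mono B nexp_step_bound B0) auto
    also have "\<dots> = norm s * B * real (Suc n) powr (- Re s - 1)" by simp
    also have "\<dots> \<le> (norm s + 1)\<^sup>2 * B * real (Suc n) powr (- Re s - 1)"
      by (intro mult_right_mono \<open>norm s * B \<le> (norm s + 1)\<^sup>2 * B\<close>) auto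
    finally show "norm (h n s) \<le> (norm s + 1)\<^sup>2 * B * real (Suc n) powr (- Re s - 1)" .
  qed
  then obtain g where g: "g holomorphic_on ?S" "\<And>s. Re s > 0 \<Longrightarrow> (\<lambda>n. h n s) sums g s" by blast
  have "(\<lambda>n. c (Suc n) * nexp (Suc n) s) sums g s" if s: "Re s > 0" for s
  proof -
    have abel: "(\<Sum>n<N. c (Suc n) * nexp (Suc n) s) = (\<Sum>n<N. h n s) + C N * nexp (Suc N) s" for N
      by (induction N) (simp_all add: h_def C_def algebra_simps)
    have "(\<lambda>N. C N * nexp (Suc N) s) \<longlonglongrightarrow> 0"
    proof (rule tendsto_norm_zero_cancel, rule tendsto_sandwich)
      show "\<forall>\<^sub>F N in sequentially. 0 \<le> norm (C N * nexp (Suc N) s)" by simp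
      show "\<forall>\<^sub>F N in sequentially. norm (C N * nexp (Suc N) s) \<le> B * real (Suc N) powr - Re s"
        unfolding norm_mult C_def by (intro always_eventually allI mult_mono B B0) (auto simp: norm_nexp)
      have "(\<lambda>N. real (Suc N) powr - Re s) \<longlonglongrightarrow> 0" using s by real_asymp
      then show "(\<lambda>N. B * real (Suc N) powr - Re s) \<longlonglongrightarrow> 0" by (rule tendsto_mult_right_zero)
    qed auto
    from tendsto_add[OF g(2)[OF s, unfolded sums_def] this] show ?thesis
      by (simp add: sums_def abel)
  qed
  then show ?thesis using g(1) by blast
qed

lemma periodic_partial_sums_bounded:
  fixes c :: "nat \<Rightarrow> complex"
  assumes per: "\<And>n. c (n + q) = c n" and q: "q > 0" and mean: "(\<Sum>n<q. c n) = 0"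
  shows "norm (\<Sum>n<N. c (Suc n)) \<le> 2 * (\<Sum>n<q. norm (c n))"
proof -
  have block: "(\<Sum>n<q. c (n + m)) = 0" for m
  proof (induction m)
    case (Suc m)
    have "(\<Sum>n<q. c (n + Suc m)) = (\<Sum>n<Suc q. c (n + m)) - c m"
      by (subst sum.lessThan_Suc_shift) simp
    then show ?case using Suc per[of m] by (simp add: add.commute)
  qed (use mean in simp)
  have per': "c (r + q * k) = c r" for r k
    by (induction k) (simp_all add: per add.assoc[symmetric] add.commute[of q])
  have split: "(\<Sum>n<m + l. c n) = (\<Sum>n<m. c n) + (\<Sum>n<l. c (n + m))" for m l
    by (induction l) (simp_all add: add.assoc add.commute)
  have "(\<Sum>n<m + q * k. c n) = (\<Sum>n<m. c n)" for m k
  proof (induction k)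
    case (Suc k)
    have "(\<Sum>n<m + q * Suc k. c n) = (\<Sum>n<(m + q * k) + q. c n)" by (simp add: ac_simps)
    also have "\<dots> = (\<Sum>n<m + q * k. c n) + (\<Sum>n<q. c (n + (m + q * k)))"
      by (rule split)
    finally show ?case using Suc block by simp
  qed simp
  then have red: "(\<Sum>n<M. c n) = (\<Sum>n<M mod q. c n)" for M
    by (metis mod_mult_div_eq)
  have bound: "norm (\<Sum>n<M. c n) \<le> (\<Sum>n<q. norm (c n))" for M
  proof -
    have "norm (\<Sum>n<M. c n) \<le> (\<Sum>n<M mod q. norm (c n))" unfolding red[of M] by (rule norm_sum)
    also have "\<dots> \<le> (\<Sum>n<q. norm (c n))" using q by (intro sum_mono2) (auto intro: less_trans)
    finally show ?thesis .
  qed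
  have "(\<Sum>n<N. c (Suc n)) = (\<Sum>n<Suc N. c n) - (\<Sum>n<1. c n)"
    by (subst sum.lessThan_Suc_shift) simp
  then have "norm (\<Sum>n<N. c (Suc n)) \<le> norm (\<Sum>n<Suc N. c n) + norm (\<Sum>n<1. c n)"
    by (metis norm_triangle_ineq4)
  then show ?thesis using bound[of "Suc N"] bound[of 1] by linarith
qed

text \<open>Split \<open>c\<close> into its mean, which contributes a multiple of the zeta function, and a part of mean zero,
whose partial sums are bounded.\<close>

theorem periodic_continuation:
  fixes c :: "nat \<Rightarrow> complex"
  assumes per: "\<And>n. c (n + q) = c n" and q: "q > 0"
  defines "\<kappa> \<equiv> (\<Sum>n<q. c n) / of_nat q"
  shows "\<exists>E. E holomorphic_on {s. Re s > 0} \<and>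
    (\<forall>s. Re s > 1 \<longrightarrow> (\<lambda>n. c (Suc n) * nexp (Suc n) s) sums (\<kappa> / (s - 1) + E s)) \<and>
    (\<kappa> = 0 \<longrightarrow> (\<forall>s. Re s > 0 \<longrightarrow> (\<lambda>n. c (Suc n) * nexp (Suc n) s) sums E s))"
proof -
  define d where "d n = c n - \<kappa>" for n
  have "(\<Sum>n<q. d n) = 0" using q by (simp add: d_def sum_subtractf \<kappa>_def)
  moreover have "d (n + q) = d n" for n by (simp add: d_def per)
  ultimately obtain E1 where E1: "E1 holomorphic_on {s. Re s > 0}"
      "\<And>s. Re s > 0 \<Longrightarrow> (\<lambda>n. d (Suc n) * nexp (Suc n) s) sums E1 s"
    using bounded_partial_sums_continuation[OF periodic_partial_sums_bounded[of d q]] q by blast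
  obtain E2 where E2: "E2 holomorphic_on {s. Re s > 0}"
     "\<And>s. Re s > 1 \<Longrightarrow> (\<lambda>n. nexp (Suc n) s) sums (1 / (s - 1) + E2 s)"
    using zeta_continuation by blast
  define E where "E s = \<kappa> * E2 s + E1 s" for s
  have "E holomorphic_on {s. Re s > 0}" unfolding E_def by (intro holomorphic_intros E1 E2)
  moreover have "(\<lambda>n. c (Suc n) * nexp (Suc n) s) sums (\<kappa> / (s - 1) + E s)" if "Re s > 1" for s
    using sums_add[OF sums_mult[OF E2(2)[OF that], of \<kappa>] E1(2)[of s]] that
    by (simp add: d_def E_def algebra_simps)
  moreover have "(\<lambda>n. c (Suc n) * nexp (Suc n) s) sums E s" if "\<kappa> = 0" "Re s > 0" for s
    using E1(2)[OF that(2)] that(1) by (simp add: d_def E_def)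
  ultimately show ?thesis by blast
qed

section \<open>The Moebius function\<close>

lemma moebius_Suc_0 [simp]: "moebius_mu (Suc 0) = 1"
proof -
  have "\<not> (\<exists>p::nat. prime p \<and> p\<^sup>2 dvd Suc 0)" using not_prime_1 by (auto simp: power2_eq_square)
  then show ?thesis by (simp add: moebius_mu_def)
qed

lemma abs_moebius_le_1: "\<bar>moebius_mu n\<bar> \<le> 1"
  by (simp add: moebius_mu_def power_abs)

lemma moebius_eq_0: "prime p \<Longrightarrow> p\<^sup>2 dvd n \<Longrightarrow> moebius_mu n = 0"
  by (auto simp: moebius_mu_def)

lemma moebius_coprime_mult:
  assumes co: "coprime m n" and pos: "m > 0" "n > 0"
  shows "moebius_mu (m * n) = moebius_mu m * moebius_mu n"
proof (cases "\<exists>p. prime p \<and> (p\<^sup>2 dvd m \<or> p\<^sup>2 dvd n)")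
  case True
  then obtain p where p: "prime p" "p\<^sup>2 dvd m \<or> p\<^sup>2 dvd n" by blast
  then have "moebius_mu m * moebius_mu n = 0" using moebius_eq_0 by auto
  moreover have "moebius_mu (m * n) = 0" by (rule moebius_eq_0[OF p(1)]) (use p(2) in auto)
  ultimately show ?thesis by simp
next
  case False
  have "\<not> p\<^sup>2 dvd m * n" if p: "prime p" for p
  proof
    assume dv: "p\<^sup>2 dvd m * n"
    have "coprime p m \<or> coprime p n"
      using co p by (metis coprime_common_divisor prime_imp_coprime not_prime_unit)
    then show False
    proof
      assume "coprime p m"
      then have "p\<^sup>2 dvd n" using dv by (simp add: coprime_dvd_mult_right_iff)
      then show False using False p by blast
    next
      assume "coprime p n"
      then have "p\<^sup>2 dvd m" using dv by (simp add: coprime_dvd_mult_left_iff)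
      then show False using False p by blast
    qed
  qed
  moreover have "prime_factors (m * n) = prime_factors m \<union> prime_factors n"
    using pos by (intro prime_factors_product) auto
  moreover have "prime_factors m \<inter> prime_factors n = {}"
    using co by (auto simp: in_prime_factors_iff disjoint_iff dest: coprime_common_divisor)
  ultimately have "card (prime_factors (m * n)) = card (prime_factors m) + card (prime_factors n)"
    by (simp add: card_Un_disjoint)
  then show ?thesis using False \<open>\<And>p. prime p \<Longrightarrow> \<not> p\<^sup>2 dvd m * n\<close>
    by (simp add: moebius_mu_def power_add)
qed

lemma moebius_prime: "prime p \<Longrightarrow> moebius_mu p = - 1"
proof -
  assume p: "prime (p :: nat)"
  have "\<not> q\<^sup>2 dvd p" if "prime q" for q
  proof
    assume "q\<^sup>2 dvd p"
    then have "q dvd p" by (metis dvd_mult_left power2_eq_square)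
    then have "q = p" using p that by (simp add: primes_dvd_imp_eq)
    then have "p * p dvd p * 1" using \<open>q\<^sup>2 dvd p\<close> by (simp add: power2_eq_square)
    then show False using p by (metis dvd_mult_cancel1 nat_mult_1_right not_prime_1 prime_gt_0_nat nat_dvd_1_iff_1 dvd_mult_cancel)
  qed
  then show ?thesis using p by (simp add: moebius_mu_def prime_factorization_prime)
qed

text \<open>Let \<open>p\<close> be a prime divisor of \<open>n = p^k m\<close> with \<open>m\<close> prime to \<open>p\<close>. Divisors that are not divisible
by \<open>p\<^sup>2\<close> come in pairs \<open>d\<close>, \<open>p d\<close> with \<open>d\<close> dividing \<open>m\<close>, which cancel.\<close>

lemma moebius_divisor_sum:
  assumes "n > 0"
  shows "(\<Sum>d | d dvd n. moebius_mu d) = (if n = 1 then 1 else 0)"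
proof (cases "n = 1")
  case False
  then obtain p where p: "prime p" "p dvd n" using prime_factor_nat by blast
  obtain k m where nk: "n = p ^ k * m" "\<not> p dvd m"
    using multiplicity_decompose'[of n p] assms p(1) not_prime_unit by (metis not_gr_zero)
  have m: "m > 0" "m dvd n" using nk assms by (auto intro: Nat.gr0I)
  have k: "k > 0" using nk p by (cases k) auto
  have pm: "p * d dvd n" if "d dvd m" for d
    using that nk k by (cases k) (auto simp: mult_dvd_mono)
  define D where "D = {d. d dvd m}"
  have fin: "finite D" "finite {d. d dvd n}" using m assms by (auto simp: D_def)
  have "(\<Sum>d | d dvd n. moebius_mu d) = (\<Sum>d\<in>D \<union> (*) p ` D. moebius_mu d)"
  proof (rule sum.mono_neutral_right[OF fin(2)])
    show "D \<union> (*) p ` D \<subseteq> {d. d dvd n}" using pm m(2) by (auto simp: D_def intro: dvd_trans)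
    show "\<forall>d\<in>{d. d dvd n} - (D \<union> (*) p ` D). moebius_mu d = 0"
    proof
      fix d assume d: "d \<in> {d. d dvd n} - (D \<union> (*) p ` D)"
      have "p\<^sup>2 dvd d"
      proof (cases "p dvd d")
        case False
        then have "coprime d (p ^ k)" using prime_imp_coprime[OF p(1) False] by (simp add: coprime_commute)
        then have "d dvd m" using d nk(1) by (simp add: coprime_dvd_mult_right_iff)
        then show ?thesis using d by (simp add: D_def)
      next
        case True
        then obtain e where e: "d = p * e" by (elim dvdE)
        show ?thesis
        proof (cases "p dvd e")
          case False
          then have "coprime e (p ^ k)" using prime_imp_coprime[OF p(1) False] by (simp add: coprime_commute)
          moreover have "e dvd p ^ k * m" using d e nk(1) by (metis DiffD1 dvd_mult_right mem_Collect_eq)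
          ultimately have "e \<in> D" by (simp add: D_def coprime_dvd_mult_right_iff)
          then show ?thesis using d e by blast
        qed (simp add: e power2_eq_square mult_dvd_mono)
      qed
      then show "moebius_mu d = 0" by (rule moebius_eq_0[OF p(1)])
    qed
  qed
  also have "\<dots> = (\<Sum>d\<in>D. moebius_mu d) + (\<Sum>d\<in>(*) p ` D. moebius_mu d)"
    by (rule sum.union_disjoint) (use fin nk(2) in \<open>auto simp: D_def dest: dvd_mult_left\<close>)
  also have "(\<Sum>d\<in>(*) p ` D. moebius_mu d) = (\<Sum>d\<in>D. moebius_mu (p * d))"
    by (subst sum.reindex) (use p(1) in \<open>auto simp: inj_on_def prime_gt_0_nat\<close>)
  also have "\<dots> = (\<Sum>d\<in>D. - moebius_mu d)"
  proof (rule sum.cong[OF refl])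
    fix d assume d: "d \<in> D"
    then have "\<not> p dvd d" using nk(2) dvd_trans by (auto simp: D_def)
    then have "coprime p d" using p(1) by (simp add: prime_imp_coprime)
    moreover have "d > 0" using d m by (auto simp: D_def intro: Nat.gr0I)
    ultimately show "moebius_mu (p * d) = - moebius_mu d"
      using p(1) by (simp add: moebius_coprime_mult moebius_prime prime_gt_0_nat)
  qed
  finally show ?thesis using False by (simp add: sum_negf)
qed simp

section \<open>Dirichlet characters\<close>

locale dirichlet_character =
  fixes q :: nat and \<xi> :: "nat \<Rightarrow> complex"
  assumes modulus_pos: "q > 0"
    and mult: "\<xi> (m * n) = \<xi> m * \<xi> n"
    and periodic: "\<xi> (n + q) = \<xi> n"
    and support: "\<xi> n \<noteq> 0 \<longleftrightarrow> coprime n q"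
begin

lemma one [simp]: "\<xi> (Suc 0) = 1"
  using mult[of 1 1] support[of 1] by simp

lemma periodic_mult: "\<xi> (n + q * k) = \<xi> n"
  by (induction k) (simp_all add: periodic add.assoc[symmetric] add.commute[of q])

lemma mod_eq: "\<xi> (n mod q) = \<xi> n"
  using periodic_mult[of "n mod q" "n div q"] by simp

lemma power: "\<xi> (n ^ k) = \<xi> n ^ k"
  by (induction k) (simp_all add: mult)

lemma power_totient: "coprime n q \<Longrightarrow> \<xi> n ^ totient q = 1"
proof -
  assume "coprime n q"
  then have "[n ^ totient q = 1] (mod q)" by (rule euler_theorem)
  then have "\<xi> (n ^ totient q) = \<xi> 1" by (metis cong_def mod_eq)
  then show ?thesis by (simp add: power)
qed

lemma norm_eq: "norm (\<xi> n) = (if coprime n q then 1 else 0)"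
proof (cases "coprime n q")
  case True
  have "norm (\<xi> n) ^ totient q = 1" using power_totient[OF True] by (metis norm_one norm_power)
  then have "norm (\<xi> n) = 1"
    using power_eq_imp_eq_base[of "norm (\<xi> n)" "totient q" 1] modulus_pos by (simp add: totient_gt_0_iff)
  then show ?thesis using True by simp
qed (use support in auto)

lemma norm_le_1: "norm (\<xi> n) \<le> 1"
  by (simp add: norm_eq)

text \<open>Multiplication with \<open>g\<close> permutes the residues and multiplies the sum by \<open>\<xi> g\<close>.\<close>

lemma sum_nonprincipal:
  assumes "coprime g q" "\<xi> g \<noteq> 1"
  shows "(\<Sum>n<q. \<xi> n) = 0"
proof -
  have inj: "inj_on (\<lambda>n. g * n mod q) {..<q}"
  proof (rule inj_onI)
    fix m n assume "m \<in> {..<q}" "n \<in> {..<q}" "g * m mod q = g * n mod q"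
    then have "[m = n] (mod q)" using assms(1) cong_mult_lcancel_nat unfolding cong_def by blast
    then show "m = n" using \<open>m \<in> {..<q}\<close> \<open>n \<in> {..<q}\<close> by (simp add: cong_def)
  qed
  have "(\<lambda>n. g * n mod q) ` {..<q} = {..<q}"
    by (rule endo_inj_surj) (use inj modulus_pos in auto)
  then have "(\<Sum>n<q. \<xi> n) = (\<Sum>n\<in>(\<lambda>n. g * n mod q) ` {..<q}. \<xi> n)" by simp
  also have "\<dots> = (\<Sum>n<q. \<xi> g * \<xi> n)" by (subst sum.reindex[OF inj]) (simp add: mod_eq mult)
  also have "\<dots> = \<xi> g * (\<Sum>n<q. \<xi> n)" by (rule sum_distrib_left[symmetric])
  finally have "(\<Sum>n<q. \<xi> n) = \<xi> g * (\<Sum>n<q. \<xi> n)" .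
  then show ?thesis using assms(2) by (metis mult_cancel_right1 mult.commute)
qed

text \<open>This is the residue of the \<open>L\<close>-series at \<open>1\<close>; it is nonzero exactly for the principal character.\<close>

definition mean where "mean = (\<Sum>n<q. \<xi> n) / of_nat q"

lemma mean_nonzero_imp_principal: "mean \<noteq> 0 \<Longrightarrow> coprime n q \<Longrightarrow> \<xi> n = 1"
  using sum_nonprincipal[of n] by (auto simp: mean_def)

lemma mean_principal:
  assumes "\<And>n. coprime n q \<Longrightarrow> \<xi> n = 1"
  shows "mean \<noteq> 0" 
proof -
  have "(\<Sum>n<q. \<xi> n) = (\<Sum>n<q. of_nat (if coprime n q then 1 else 0))"
    using assms support by (intro sum.cong) auto
  also have "\<dots> = of_nat (\<Sum>n<q. if coprime n q then 1 else 0)" by simp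
  finally have s: "(\<Sum>n<q. \<xi> n) = of_nat (\<Sum>n<q. if coprime n q then 1 else 0)" .
  have "(\<Sum>n<q. if coprime n q then 1 else 0) > (0::nat)"
  proof (cases "q = 1")
    case False
    then have "1 < q" using modulus_pos by simp
    then show ?thesis by (intro sum_pos2[of _ 1]) auto
  qed simp
  then show ?thesis unfolding mean_def s using modulus_pos
    by (simp only: divide_eq_0_iff of_nat_eq_0_iff) (metis less_not_refl)
qed

end

lemma character_mult:
  assumes "dirichlet_character q \<xi>" "dirichlet_character q \<psi>"
  shows "dirichlet_character q (\<lambda>n. \<xi> n * \<psi> n)"
  using assms unfolding dirichlet_character_def by (auto simp: mult_ac)

section \<open>Non-vanishing at 1 for real characters\<close>

text \<open>Divisors of \<open>p^(k+1) m\<close> either divide \<open>m\<close> or are \<open>p\<close> times a divisor of \<open>p^k m\<close>.\<close>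

lemma divisor_sum_prime_step:
  fixes c :: "nat \<Rightarrow> real"
  assumes mult: "\<And>m n. c (m * n) = c m * c n" and p: "prime p" "\<not> p dvd m" and m: "m > 0"
  shows "(\<Sum>d | d dvd p ^ Suc k * m. c d) = (\<Sum>d | d dvd m. c d) + c p * (\<Sum>d | d dvd p ^ k * m. c d)"
proof -
  have p0: "p > 0" using p(1) prime_gt_0_nat by blast
  have "{d. d dvd p ^ Suc k * m} = {d. d dvd m} \<union> (*) p ` {d. d dvd p ^ k * m}"
  proof (intro equalityI subsetI)
    fix d assume "d \<in> {d. d dvd p ^ Suc k * m}"
    then have d: "d dvd p ^ Suc k * m" by simp
    show "d \<in> {d. d dvd m} \<union> (*) p ` {d. d dvd p ^ k * m}"
    proof (cases "p dvd d")
      case False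
      then have "coprime d (p ^ Suc k)" using prime_imp_coprime[OF p(1) False] by (simp add: coprime_commute)
      then show ?thesis using d by (simp add: coprime_dvd_mult_right_iff del: power_Suc)
    next
      case True
      then obtain e where e: "d = p * e" by (elim dvdE)
      then have "e dvd p ^ k * m" using d p0 by (simp add: mult.assoc)
      then show ?thesis using e by blast
    qed
  qed (auto simp: mult.assoc)
  moreover have "{d. d dvd m} \<inter> (*) p ` {d. d dvd p ^ k * m} = {}"
    using p(2) by (auto dest: dvd_mult_left)
  moreover have "finite {d. d dvd m}" "finite {d. d dvd p ^ k * m}" using m p0 by simp_all
  ultimately have "(\<Sum>d | d dvd p ^ Suc k * m. c d) = (\<Sum>d | d dvd m. c d) + (\<Sum>d\<in>(*) p ` {d. d dvd p ^ k * m}. c d)"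
    by (simp add: sum.union_disjoint del: power_Suc)
  also have "(\<Sum>d\<in>(*) p ` {d. d dvd p ^ k * m}. c d) = (\<Sum>d | d dvd p ^ k * m. c (p * d))"
    by (subst sum.reindex) (use p0 in \<open>auto simp: inj_on_def\<close>)
  finally show ?thesis by (simp add: mult sum_distrib_left)
qed

text \<open>The recursion \<open>A (k + 1) = A 0 + c p * A k\<close> yields \<open>A k = (k + 1) A 0\<close>, \<open>A k = A 0\<close>, or \<open>A 0\<close> and \<open>0\<close> in turn,
according as \<open>c p\<close> is \<open>1\<close>, \<open>0\<close> or \<open>- 1\<close>.\<close>

lemma divisor_sum_prime_power:
  fixes c :: "nat \<Rightarrow> real"
  assumes mult: "\<And>m n. c (m * n) = c m * c n" and p: "prime p" "\<not> p dvd m" and m: "m > 0"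
    and val: "c p \<in> {- 1, 0, 1}" and nn: "(\<Sum>d | d dvd m. c d) \<ge> 0"
  shows "(\<Sum>d | d dvd p ^ k * m. c d) \<ge> 0 \<and> (even k \<longrightarrow> (\<Sum>d | d dvd p ^ k * m. c d) \<ge> (\<Sum>d | d dvd m. c d))"
proof -
  define A where "A k = (\<Sum>d | d dvd p ^ k * m. c d)" for k
  have A0: "A 0 = (\<Sum>d | d dvd m. c d)" by (simp add: A_def)
  have step: "A (Suc k) = A 0 + c p * A k" for k
    unfolding A0 unfolding A_def by (rule divisor_sum_prime_step[OF mult p m])
  have "A k \<ge> 0 \<and> (even k \<longrightarrow> A k \<ge> A 0)"
  proof -
    consider "c p = - 1" | "c p = 0" | "c p = 1" using val by auto
    then show ?thesis
    proof cases
      case 1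
      have "A k = (if even k then A 0 else 0)" by (induction k) (auto simp: step 1)
      then show ?thesis using nn A0 by auto
    next
      case 2
      then show ?thesis using nn A0 by (cases k) (auto simp: step)
    next
      case 3
      have "A k \<ge> A 0" by (induction k) (use nn A0 3 step in auto)
      then show ?thesis using nn A0 by auto
    qed
  qed
  then show ?thesis unfolding A0 unfolding A_def .
qed

lemma divisor_sum_nonneg:
  fixes c :: "nat \<Rightarrow> real"
  assumes mult: "\<And>m n. c (m * n) = c m * c n" and one: "c 1 = 1"
    and val: "\<And>n. c n \<in> {- 1, 0, 1}"
  shows "n > 0 \<Longrightarrow> (\<Sum>d | d dvd n. c d) \<ge> 0"
proof (induction n rule: less_induct)
  case (less n)
  show ?case
  proof (cases "n = 1")
    case False
    then obtain p where p: "prime p" "p dvd n" using prime_factor_nat by blast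
    obtain k m where nk: "n = p ^ k * m" "\<not> p dvd m"
      using multiplicity_decompose'[of n p] less.prems p(1) not_prime_unit by (metis not_gr_zero)
    have k: "k > 0" using nk p by (cases k) auto
    have m: "m > 0" using nk less.prems by (cases m) auto
    have "1 < p ^ k" by (rule one_less_power[OF prime_gt_1_nat[OF p(1)] k])
    then have "m < n" using nk m by simp
    then show ?thesis using divisor_sum_prime_power[OF mult p(1) nk(2) m val] less.IH m nk(1) by simp
  qed (use one in simp)
qed

lemma divisor_sum_square:
  fixes c :: "nat \<Rightarrow> real"
  assumes mult: "\<And>m n. c (m * n) = c m * c n" and one: "c 1 = 1"
    and val: "\<And>n. c n \<in> {- 1, 0, 1}"
  shows "n > 0 \<Longrightarrow> (\<Sum>d | d dvd n\<^sup>2. c d) \<ge> 1"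
proof (induction n rule: less_induct)
  case (less n)
  show ?case
  proof (cases "n = 1")
    case False
    then obtain p where p: "prime p" "p dvd n" using prime_factor_nat by blast
    obtain k m where nk: "n = p ^ k * m" "\<not> p dvd m"
      using multiplicity_decompose'[of n p] less.prems p(1) not_prime_unit by (metis not_gr_zero)
    have k: "k > 0" using nk p by (cases k) auto
    have m: "m > 0" using nk less.prems by (cases m) auto
    have "1 < p ^ k" by (rule one_less_power[OF prime_gt_1_nat[OF p(1)] k])
    then have "m < n" using nk m by simp
    then have IH: "(\<Sum>d | d dvd m\<^sup>2. c d) \<ge> 1" using less.IH m by simp
    have n2: "n\<^sup>2 = p ^ (2 * k) * m\<^sup>2" using nk(1) by (simp add: power_mult_distrib power_mult[symmetric] mult.commute)
    have pm: "\<not> p dvd m\<^sup>2" using nk(2) p(1) by (simp add: prime_dvd_power_iff)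
    show ?thesis using divisor_sum_prime_power[OF mult p(1) pm _ val, of "2 * k"] IH m unfolding n2 by simp
  qed (use one in simp)
qed

text \<open>Since \<open>1 - u^(2n)\<close> is \<open>1 - u\<^sup>2\<close> times a geometric sum, this is the inequality of arithmetic and
geometric means for the \<open>n\<close> terms \<open>u^(2i)\<close>, applied to the pairs \<open>i\<close>, \<open>n - 1 - i\<close>.\<close>

lemma geometric_gap:
  fixes u :: real
  assumes u: "0 \<le> u" "u \<le> 1"
  shows "real n * u ^ (n - 1) * (1 - u\<^sup>2) \<le> 1 - u ^ (2 * n)"
proof -
  have "(\<Sum>i<n. 2 * u ^ (n - 1)) \<le> (\<Sum>i<n. u ^ (2 * i) + u ^ (2 * (n - Suc i)))"
  proof (rule sum_mono)
    fix i assume "i \<in> {..<n}"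
    then have "u ^ (n - 1) = u ^ i * u ^ (n - Suc i)" by (simp add: power_add[symmetric])
    moreover have "(u ^ i - u ^ (n - Suc i))\<^sup>2 \<ge> 0" by simp
    moreover have "u ^ (2 * j) = (u ^ j)\<^sup>2" for j by (simp add: power_mult[symmetric] mult.commute)
    ultimately show "2 * u ^ (n - 1) \<le> u ^ (2 * i) + u ^ (2 * (n - Suc i))"
      by (simp only: power2_diff mult.assoc)
  qed
  also have "\<dots> = 2 * (\<Sum>i<n. (u\<^sup>2) ^ i)"
    by (simp add: sum.distrib sum.nat_diff_reindex power_mult)
  finally have "real n * u ^ (n - 1) \<le> (\<Sum>i<n. (u\<^sup>2) ^ i)" by simp
  then have "real n * u ^ (n - 1) * (1 - u\<^sup>2) \<le> (\<Sum>i<n. (u\<^sup>2) ^ i) * (1 - u\<^sup>2)"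
    using u by (intro mult_right_mono) (simp_all add: power_le_one)
  also have "\<dots> = 1 - u ^ (2 * n)"
    using one_diff_power_eq[of "u\<^sup>2" n] by (simp only: power_mult mult.commute[of "1 - u\<^sup>2"])
  finally show ?thesis .
qed

text \<open>The error made in replacing the \<open>n\<close>-th term of a Lambert series by its leading part as \<open>t\<close> tends
to \<open>1\<close>.\<close>

definition lambert_gap :: "real \<Rightarrow> nat \<Rightarrow> real" where
  "lambert_gap t n = 1 / (n * (1 - t)) - t ^ n / (1 - t ^ n)"

lemma lambert_gap_nonneg:
  assumes t: "0 < t" "t < 1" and n: "n > 0"
  shows "lambert_gap t n \<ge> 0"
proof -
  define u where "u = sqrt t"
  have u: "0 \<le> u" "u \<le> 1" "u\<^sup>2 = t" using t by (simp_all add: u_def)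
  have "u ^ (2 * n) \<le> u ^ (n - 1)" using u by (intro power_decreasing) auto
  then have "real n * t ^ n * (1 - t) \<le> real n * u ^ (n - 1) * (1 - t)"
    using t u by (intro mult_right_mono mult_left_mono) (auto simp: power_mult)
  also have "\<dots> \<le> 1 - t ^ n" using geometric_gap[OF u(1,2), of n] u(3) by (simp add: power_mult)
  finally have le: "real n * t ^ n * (1 - t) \<le> 1 - t ^ n" .
  have "t ^ n < 1" using t n by (simp add: power_less_one_iff)
  then have "t ^ n / (1 - t ^ n) \<le> 1 / (n * (1 - t))"
    using le t n by (simp add: divide_simps mult_ac)
  then show ?thesis by (simp add: lambert_gap_def)
qed

lemma lambert_gap_decreasing:
  assumes t: "0 < t" "t < 1" and n: "n > 0"
  shows "lambert_gap t (Suc n) \<le> lambert_gap t n"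
proof -
  define u where "u = sqrt t"
  have u: "0 \<le> u" "u \<le> 1" "u\<^sup>2 = t" using t by (simp_all add: u_def)
  have tn: "t ^ n < 1" "t ^ Suc n < 1" using t n by (simp_all only: power_less_one_iff) auto
  have g1: "real n * u ^ (n - 1) * (1 - t) \<le> 1 - t ^ n"
    using geometric_gap[OF u(1,2), of n] u(3) by (simp add: power_mult)
  have g2: "real (Suc n) * u ^ n * (1 - t) \<le> 1 - t ^ Suc n"
    using geometric_gap[OF u(1,2), of "Suc n"] u(3) by (simp only: power_mult) simp
  have "u ^ (2 * n) \<le> u ^ (n - 1 + n)" using u by (intro power_decreasing) auto
  then have "real n * real (Suc n) * t ^ n * (1 - t)\<^sup>2 \<le> real n * real (Suc n) * u ^ (n - 1 + n) * (1 - t)\<^sup>2"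
    using u by (intro mult_right_mono mult_left_mono) (auto simp: power_mult)
  also have "\<dots> = (real n * u ^ (n - 1) * (1 - t)) * (real (Suc n) * u ^ n * (1 - t))"
    by (simp add: power_add power2_eq_square)
  also have "\<dots> \<le> (1 - t ^ n) * (1 - t ^ Suc n)"
    using g1 g2 t u tn by (intro mult_mono) auto
  finally have key: "real n * real (Suc n) * t ^ n * (1 - t)\<^sup>2 \<le> (1 - t ^ n) * (1 - t ^ Suc n)" .
  have "t ^ n / (1 - t ^ n) - t ^ Suc n / (1 - t ^ Suc n) = t ^ n * (1 - t) / ((1 - t ^ n) * (1 - t ^ Suc n))"
    using tn by (simp add: divide_simps) (simp add: algebra_simps)
  also have "\<dots> \<le> 1 / (real n * real (Suc n) * (1 - t))"
  proof -
    have "(1 - t ^ n) * (1 - t ^ Suc n) > 0" using tn by simp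
    moreover have "real n * real (Suc n) * (1 - t) > 0" using n t by simp
    moreover have "t ^ n * (1 - t) * (real n * real (Suc n) * (1 - t)) \<le> 1 * ((1 - t ^ n) * (1 - t ^ Suc n))"
      using key by (simp add: power2_eq_square mult_ac)
    ultimately show ?thesis by (simp only: pos_divide_le_eq pos_le_divide_eq times_divide_eq_left mult_1_left)
  qed
  also have "\<dots> = 1 / (n * (1 - t)) - 1 / (real (Suc n) * (1 - t))"
    using n t by (simp add: divide_simps)
  finally show ?thesis by (simp add: lambert_gap_def)
qed

lemma abel_bound:
  fixes c b :: "nat \<Rightarrow> real"
  assumes C: "\<And>N. \<bar>\<Sum>n<N. c n\<bar> \<le> K" and dec: "\<And>n. b (Suc n) \<le> b n" and nn: "\<And>n. b n \<ge> 0"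
  shows "\<bar>\<Sum>n<N. c n * b n\<bar> \<le> K * b 0"
proof -
  have abel: "(\<Sum>n<N. c n * b n) = (\<Sum>n<N. (\<Sum>i<Suc n. c i) * (b n - b (Suc n))) + (\<Sum>i<N. c i) * b N"
    by (induction N) (simp_all add: algebra_simps)
  have K: "K \<ge> 0" using C[of 0] by simp
  have "\<bar>\<Sum>n<N. c n * b n\<bar> \<le> (\<Sum>n<N. \<bar>(\<Sum>i<Suc n. c i) * (b n - b (Suc n))\<bar>) + \<bar>(\<Sum>i<N. c i) * b N\<bar>"
    unfolding abel by (rule order_trans[OF abs_triangle_ineq]) (intro add_mono sum_abs order_refl)
  also have "\<dots> \<le> (\<Sum>n<N. K * (b n - b (Suc n))) + K * b N"
    unfolding abs_mult by (intro add_mono sum_mono mult_mono C) (auto simp: K dec nn)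
  also have "\<dots> = K * b 0"
    unfolding sum_distrib_left[symmetric] sum_lessThan_telescope' by (simp add: right_diff_distrib)
  finally show ?thesis .
qed

text \<open>Monsky's argument. The Lambert series \<open>\<Sum> c(n) t^n / (1 - t^n)\<close> equals \<open>\<Sum> r(n) t^n\<close> with the divisor sums
\<open>r(n) \<ge> 0\<close> and \<open>r(m\<^sup>2) \<ge> 1\<close>, hence is unbounded as \<open>t\<close> tends to \<open>1\<close>. But if \<open>\<Sum> c(n) / n\<close> were \<open>0\<close>, it
would also equal \<open>- \<Sum> c(n) lambert_gap t n\<close>. The gaps decrease from \<open>1\<close>, so Abel summation bounds this by
\<open>K\<close> for all \<open>t\<close>.\<close>

theorem real_character_sum_nonzero:
  fixes c :: "nat \<Rightarrow> real"
  assumes mult: "\<And>m n. c (m * n) = c m * c n" and one: "c 1 = 1"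
    and val: "\<And>n. c n \<in> {- 1, 0, 1}" and K: "\<And>N. \<bar>\<Sum>n<N. c (Suc n)\<bar> \<le> K"
  shows "\<not> (\<lambda>n. c (Suc n) / real (Suc n)) sums 0"
proof
  assume zero: "(\<lambda>n. c (Suc n) / real (Suc n)) sums 0"
  define r where "r n = (\<Sum>d | d dvd n. c d)" for n
  have r0: "r n \<ge> 0" if "n > 0" for n unfolding r_def using divisor_sum_nonneg[OF mult one val that] .
  have r1: "r (n\<^sup>2) \<ge> 1" if "n > 0" for n unfolding r_def using divisor_sum_square[OF mult one val that] .
  have c1: "\<bar>c n\<bar> \<le> 1" for n using val[of n] by auto
  have bound: "\<exists>S. (\<lambda>n. r (Suc n) * t ^ Suc n) sums S \<and> S \<le> K" if t: "0 < t" "t < 1" for t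
  proof -
    define l where "l n = c n * (t ^ n / (1 - t ^ n))" for n
    have tn: "t ^ Suc n < 1" for n using t by (simp only: power_less_one_iff) auto
    have rowsums: "(\<lambda>j. t ^ (Suc i * Suc j)) sums (t ^ Suc i / (1 - t ^ Suc i))" for i
    proof -
      have "(\<lambda>j. t ^ Suc i * (t ^ Suc i) ^ j) sums (t ^ Suc i * (1 / (1 - t ^ Suc i)))"
        by (intro sums_mult geometric_sums) (use t tn in auto)
      then show ?thesis by (simp only: power_mult power_Suc times_divide_eq_right mult_1_right)
    qed
    have le: "t ^ Suc i / (1 - t ^ Suc i) \<le> t ^ Suc i / (1 - t)" for i
      using t tn[of i] by (intro divide_left_mono mult_pos_pos) (auto simp: mult_left_le power_le_one)
    define G where "G i j = complex_of_real (c (Suc i) * t ^ (Suc i * Suc j))" for i j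
    have Gs: "(\<lambda>j. G i j) sums complex_of_real (l (Suc i))" for i
      unfolding G_def l_def by (intro sums_of_real sums_mult rowsums)
    have Gn: "norm (G i j) = \<bar>c (Suc i)\<bar> * t ^ (Suc i * Suc j)" for i j
      unfolding G_def norm_of_real abs_mult using t by simp
    have Gns: "(\<lambda>j. norm (G i j)) sums (\<bar>c (Suc i)\<bar> * (t ^ Suc i / (1 - t ^ Suc i)))" for i
      unfolding Gn by (intro sums_mult rowsums)
    have gsum: "summable (\<lambda>i. t ^ Suc i / (1 - t))"
      using t by (intro summable_divide) (simp add: summable_Suc_iff)
    have lt: "\<bar>c (Suc i)\<bar> * (t ^ Suc i / (1 - t ^ Suc i)) \<le> t ^ Suc i / (1 - t)" for i
    proof -
      have "\<bar>c (Suc i)\<bar> * (t ^ Suc i / (1 - t ^ Suc i)) \<le> 1 * (t ^ Suc i / (1 - t ^ Suc i))"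
        by (rule mult_right_mono[OF c1]) (use t tn[of i] in auto)
      then show ?thesis using le[of i] by simp
    qed
    have lt0: "0 \<le> \<bar>c (Suc i)\<bar> * (t ^ Suc i / (1 - t ^ Suc i))" for i using t tn[of i] by auto
    have "((\<lambda>(i, j). G i j) has_sum (\<Sum>i. \<Sum>j. G i j)) UNIV"
    proof (rule has_sum_double)
      show "summable (\<lambda>j. norm (G i j))" for i using Gns sums_summable by blast
      show "summable (\<lambda>i. \<Sum>j. norm (G i j))"
        unfolding sums_unique[OF Gns, symmetric]
        by (rule summable_comparison_test'[OF gsum, of 0]) (use lt lt0 in \<open>simp only: real_norm_def abs_of_nonneg\<close>)
    qed
    then have "(\<lambda>n. \<Sum>d | d dvd Suc n. complex_of_real (c d * t ^ (d * (Suc n div d)))) sums (\<Sum>i. complex_of_real (l (Suc i)))"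
      unfolding sums_unique[OF Gs, symmetric] unfolding G_def by (rule has_sum_by_products)
    moreover have "(\<Sum>d | d dvd Suc n. complex_of_real (c d * t ^ (d * (Suc n div d)))) = of_real (r (Suc n) * t ^ Suc n)" for n
    proof -
      have "(\<Sum>d | d dvd Suc n. complex_of_real (c d * t ^ (d * (Suc n div d)))) = (\<Sum>d | d dvd Suc n. complex_of_real (c d * t ^ Suc n))"
        by (intro sum.cong refl) (simp only: mem_Collect_eq dvd_mult_div_cancel)
      then show ?thesis unfolding r_def by (simp only: sum_distrib_right of_real_sum)
    qed
    ultimately have s: "(\<lambda>n. complex_of_real (r (Suc n) * t ^ Suc n)) sums (\<Sum>i. complex_of_real (l (Suc i)))" by simp
    have lsum: "summable (\<lambda>i. l (Suc i))"
    proof (rule summable_comparison_test'[OF gsum, of 0])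
      fix i show "norm (l (Suc i)) \<le> t ^ Suc i / (1 - t)"
        using lt[of i] t tn[of i] unfolding l_def real_norm_def abs_mult abs_divide by simp
    qed
    have "(\<lambda>n. complex_of_real (r (Suc n) * t ^ Suc n)) sums complex_of_real (\<Sum>i. l (Suc i))"
      using s suminf_of_real[OF lsum, where 'a = complex] by simp
    then have s': "(\<lambda>n. r (Suc n) * t ^ Suc n) sums (\<Sum>i. l (Suc i))" by (simp only: sums_of_real_iff)
    have ab: "\<bar>\<Sum>n<N. c (Suc n) * lambert_gap t (Suc n)\<bar> \<le> K * lambert_gap t (Suc 0)" for N
      by (rule abel_bound[OF K]) (use lambert_gap_decreasing[OF t] lambert_gap_nonneg[OF t] in auto)
    have lg: "lambert_gap t (Suc 0) = 1" using t by (simp add: lambert_gap_def divide_simps)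
    have "(\<lambda>n. c (Suc n) / real (Suc n) * (1 / (1 - t)) - l (Suc n)) sums (0 * (1 / (1 - t)) - (\<Sum>i. l (Suc i)))"
      by (intro sums_diff sums_mult2 zero summable_sums lsum)
    moreover have "c (Suc n) / real (Suc n) * (1 / (1 - t)) - l (Suc n) = c (Suc n) * lambert_gap t (Suc n)" for n
      by (simp only: lambert_gap_def l_def right_diff_distrib times_divide_eq_right mult_1_right divide_divide_eq_left)
    ultimately have "(\<lambda>n. c (Suc n) * lambert_gap t (Suc n)) sums (- (\<Sum>i. l (Suc i)))" by simp
    then have lim: "(\<lambda>N. \<bar>\<Sum>n<N. c (Suc n) * lambert_gap t (Suc n)\<bar>) \<longlonglongrightarrow> \<bar>- (\<Sum>i. l (Suc i))\<bar>"
      unfolding sums_def by (rule tendsto_rabs)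
    have "\<bar>- (\<Sum>i. l (Suc i))\<bar> \<le> K"
      by (rule tendsto_upperbound[OF lim]) (use ab lg in auto)
    then show ?thesis using s' by (intro exI[of _ "\<Sum>i. l (Suc i)"]) auto
  qed
  have "real M / 2 \<le> K" if M: "M > 0" for M :: nat
  proof -
    \<comment> \<open>close enough to \<open>1\<close> that \<open>t^(M\<^sup>2) \<ge> 1 / 2\<close>, by Bernoulli's inequality\<close>
    define t where "t = 1 - 1 / (2 * (real M)\<^sup>2)"
    have M1: "1 \<le> (real M)\<^sup>2" using M by (simp add: one_le_power)
    have "1 / (2 * (real M)\<^sup>2) \<le> 1 / 2" by (rule frac_le) (use M1 in auto)
    moreover have "1 / (2 * (real M)\<^sup>2) > 0" using M by simp
    ultimately have t: "0 < t" "t < 1" unfolding t_def by linarith+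
    obtain S where S: "(\<lambda>n. r (Suc n) * t ^ Suc n) sums S" "S \<le> K" using bound[OF t] by blast
    have half: "t ^ (M\<^sup>2) \<ge> 1 / 2"
    proof -
      have "1 + real (M\<^sup>2) * (- (1 / (2 * (real M)\<^sup>2))) \<le> (1 + (- (1 / (2 * (real M)\<^sup>2)))) ^ (M\<^sup>2)"
        using t by (intro Bernoulli_inequality) (simp add: t_def)
      then show ?thesis using M by (simp add: t_def)
    qed
    define A where "A = (\<lambda>m. m\<^sup>2 - 1) ` {1..M}"
    have sq: "Suc (m\<^sup>2 - 1) = m\<^sup>2" if "m \<in> {1..M}" for m using that by simp
    have inj: "inj_on (\<lambda>m. m\<^sup>2 - 1) {1..M}"
    proof (rule inj_onI)
      fix x y assume "x \<in> {1..M}" "y \<in> {1..M}" "x\<^sup>2 - 1 = y\<^sup>2 - 1"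
      then have "x\<^sup>2 = y\<^sup>2" using sq by metis
      then show "x = y" by simp
    qed
    have "real M / 2 = (\<Sum>m\<in>{1..M}. 1 / 2)" by simp
    also have "\<dots> \<le> (\<Sum>m\<in>{1..M}. r (m\<^sup>2) * t ^ (m\<^sup>2))"
    proof (rule sum_mono)
      fix m assume m: "m \<in> {1..M}"
      have "1 / 2 \<le> t ^ (M\<^sup>2)" by (rule half)
      also have "\<dots> \<le> t ^ (m\<^sup>2)" using m t by (intro power_decreasing power_mono) auto
      also have "\<dots> \<le> r (m\<^sup>2) * t ^ (m\<^sup>2)" using r1[of m] m t by (simp add: mult_le_cancel_right1)
      finally show "1 / 2 \<le> r (m\<^sup>2) * t ^ (m\<^sup>2)" .
    qed
    also have "\<dots> = (\<Sum>n\<in>A. r (Suc n) * t ^ Suc n)"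
      unfolding A_def sum.reindex[OF inj] o_def by (intro sum.cong refl) (simp only: sq)
    also have "\<dots> \<le> (\<Sum>n. r (Suc n) * t ^ Suc n)"
      using S(1) r0 t by (intro sum_le_suminf sums_summable[OF S(1)]) (auto simp: A_def)
    also have "\<dots> \<le> K" using S sums_unique by metis
    finally show ?thesis .
  qed
  note bounded = this
  obtain n :: nat where "2 * K < real n" using reals_Archimedean2 by blast
  then show False using bounded[of "Suc n"] by simp
qed

section \<open>Dirichlet L-series\<close>

text \<open>The logarithmic bound admits the von Mangoldt function as a coefficient.\<close>

lemma summable_nexp:
  fixes c :: "nat \<Rightarrow> complex"
  assumes c: "\<And>n. n > 0 \<Longrightarrow> norm (c n) \<le> 1 + ln (real n)" and s: "Re s > 1"
  shows "summable (\<lambda>n. norm (c (Suc n) * nexp (Suc n) s))"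
proof -
  define \<epsilon> where "\<epsilon> = (Re s - 1) / 2"
  have \<epsilon>: "\<epsilon> > 0" using s by (simp add: \<epsilon>_def)
  have "summable (\<lambda>n. real n powr (- 1 - \<epsilon>))" using \<epsilon> by (subst summable_real_powr_iff) simp
  then have "summable (\<lambda>n. real (Suc n) powr (- 1 - \<epsilon>))" by (subst summable_Suc_iff)
  then have sm: "summable (\<lambda>n. (1 + 1 / \<epsilon>) * real (Suc n) powr (- 1 - \<epsilon>))" by (rule summable_mult)
  show ?thesis
  proof (rule summable_comparison_test'[OF sm, of 0])
    fix n :: nat
    have "ln (real (Suc n)) \<le> real (Suc n) powr \<epsilon> / \<epsilon>" using \<epsilon> by (intro ln_powr_bound) auto
    moreover have "1 \<le> real (Suc n) powr \<epsilon>" using \<epsilon> by (simp add: ge_one_powr_ge_zero)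
    ultimately have "norm (c (Suc n)) \<le> (1 + 1 / \<epsilon>) * real (Suc n) powr \<epsilon>"
      using c[of "Suc n"] by (simp add: distrib_right)
    then have "norm (c (Suc n)) * norm (nexp (Suc n) s) \<le> (1 + 1 / \<epsilon>) * real (Suc n) powr \<epsilon> * real (Suc n) powr - Re s"
      by (intro mult_mono) (use \<epsilon> in \<open>auto simp: norm_nexp\<close>)
    also have "\<dots> = (1 + 1 / \<epsilon>) * real (Suc n) powr (\<epsilon> + - Re s)" by (simp only: powr_add mult.assoc)
    also have "\<epsilon> + - Re s = - 1 - \<epsilon>" by (simp add: \<epsilon>_def field_simps)
    finally show "norm (norm (c (Suc n) * nexp (Suc n) s)) \<le> (1 + 1 / \<epsilon>) * real (Suc n) powr (- 1 - \<epsilon>)"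
      by (simp add: norm_mult)
  qed
qed

lemma nexp_deriv: "(nexp n has_field_derivative - of_real (ln (real n)) * nexp n s) (at s)"
proof -
  have "((\<lambda>s. nexp n s) has_field_derivative - of_real (ln (real n)) * nexp n s) (at s)"
    unfolding nexp_def by (auto intro!: derivative_eq_intros)
  then show ?thesis by simp
qed

lemma dirichlet_series_derivative:
  fixes c :: "nat \<Rightarrow> complex"
  assumes c: "\<And>n. norm (c n) \<le> 1" and g: "\<And>s. Re s > 1 \<Longrightarrow> (\<lambda>n. c (Suc n) * nexp (Suc n) s) sums g s"
    and s: "Re s > 1"
  shows "(\<lambda>n. of_real (ln (real (Suc n))) * c (Suc n) * nexp (Suc n) s) sums (- deriv g s)"
proof -
  let ?S = "{s. Re s > 1}"
  have op: "open ?S" by (rule open_halfspace_Re_gt)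
  have "\<exists>h h'. \<forall>x\<in>?S. ((\<lambda>n. c (Suc n) * nexp (Suc n) x) sums h x) \<and>
     ((\<lambda>n. c (Suc n) * (- of_real (ln (real (Suc n))) * nexp (Suc n) x)) sums h' x) \<and> (h has_field_derivative h' x) (at x)"
  proof (rule series_and_derivative_comparison_complex[OF op])
    show "((\<lambda>x. c (Suc n) * nexp (Suc n) x) has_field_derivative c (Suc n) * (- of_real (ln (real (Suc n))) * nexp (Suc n) x)) (at x)" for n x
      by (intro DERIV_cmult nexp_deriv)
  next
    fix x assume x: "x \<in> ?S"
    define \<sigma> where "\<sigma> = (Re x - 1) / 2"
    have \<sigma>: "\<sigma> > 0" using x by (simp add: \<sigma>_def)
    define m :: "nat \<Rightarrow> complex" where "m n = of_real (real (Suc n) powr (- 1 - \<sigma>))" for n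
    have "summable (\<lambda>n. real n powr (- 1 - \<sigma>))" using \<sigma> by (subst summable_real_powr_iff) simp
    then have "summable (\<lambda>n. real (Suc n) powr (- 1 - \<sigma>))" by (subst summable_Suc_iff)
    then have "summable m" unfolding m_def by (intro summable_of_real)
    moreover have "range m \<subseteq> \<real>\<^sub>\<ge>\<^sub>0" by (auto simp: m_def)
    moreover have "norm (c (Suc n) * nexp (Suc n) y) \<le> norm (m n)" if y: "y \<in> ball x \<sigma> \<inter> ?S" for n y
    proof -
      have d: "norm (x - y) < \<sigma>" using y by (simp add: dist_norm)
      have re: "Re y \<ge> 1 + \<sigma>" using abs_Re_le_cmod[of "x - y"] d abs_ge_self[of "Re x - Re y"]
        unfolding \<sigma>_def by (simp add: field_simps)
      have "norm (c (Suc n)) * norm (nexp (Suc n) y) \<le> 1 * real (Suc n) powr (- 1 - \<sigma>)"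
      proof (rule mult_mono[OF c])
        have "real (Suc n) powr - Re y \<le> real (Suc n) powr (- 1 - \<sigma>)" using re by (intro powr_mono) auto
        then show "norm (nexp (Suc n) y) \<le> real (Suc n) powr (- 1 - \<sigma>)" by (simp add: norm_nexp)
      qed auto
      then show ?thesis by (simp add: m_def norm_mult)
    qed
    ultimately show "\<exists>d h'. 0 < d \<and> summable h' \<and> range h' \<subseteq> \<real>\<^sub>\<ge>\<^sub>0 \<and> (\<forall>\<^sub>F n in sequentially. \<forall>y\<in>ball x d \<inter> ?S. cmod (c (Suc n) * nexp (Suc n) y) \<le> cmod (h' n))"
      using \<sigma> by (intro exI[of _ \<sigma>] exI[of _ m]) (auto intro!: always_eventually)
  qed
  then obtain h h' where h: "\<And>x. x \<in> ?S \<Longrightarrow> (\<lambda>n. c (Suc n) * nexp (Suc n) x) sums h x"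
     "\<And>x. x \<in> ?S \<Longrightarrow> (\<lambda>n. c (Suc n) * (- of_real (ln (real (Suc n))) * nexp (Suc n) x)) sums h' x"
     "\<And>x. x \<in> ?S \<Longrightarrow> (h has_field_derivative h' x) (at x)" by blast
  have hg: "h x = g x" if "x \<in> ?S" for x using h(1)[OF that] g[of x] that sums_unique2 by blast
  have "(g has_field_derivative h' s) (at s)"
    by (rule has_field_derivative_transform_within_open[OF h(3)[of s] op]) (use s hg in auto)
  then have "deriv g s = h' s" by (rule DERIV_imp_deriv)
  then show ?thesis using sums_minus[OF h(2)[of s]] s by (simp add: mult_ac)
qed

context dirichlet_character
begin

text \<open>The \<open>L\<close>-series without its principal part at \<open>1\<close>; the last clause of \<open>periodic_continuation\<close> makes it
the conditionally convergent series if there is no pole.\<close>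

definition E :: "complex \<Rightarrow> complex" where
  "E = (SOME E. E holomorphic_on {s. Re s > 0} \<and>
    (\<forall>s. Re s > 1 \<longrightarrow> (\<lambda>n. \<xi> (Suc n) * nexp (Suc n) s) sums (mean / (s - 1) + E s)) \<and>
    (mean = 0 \<longrightarrow> (\<forall>s. Re s > 0 \<longrightarrow> (\<lambda>n. \<xi> (Suc n) * nexp (Suc n) s) sums E s)))"

lemma E: "E holomorphic_on {s. Re s > 0}"
    "Re s > 1 \<Longrightarrow> (\<lambda>n. \<xi> (Suc n) * nexp (Suc n) s) sums (mean / (s - 1) + E s)"
    "mean = 0 \<Longrightarrow> Re s > 0 \<Longrightarrow> (\<lambda>n. \<xi> (Suc n) * nexp (Suc n) s) sums E s"
  using someI_ex[OF periodic_continuation[of \<xi> q, OF periodic modulus_pos, folded mean_def]]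
  unfolding E_def by blast+

definition L :: "complex \<Rightarrow> complex" where
  "L s = mean / (s - 1) + E s"

lemma L_sums: "Re s > 1 \<Longrightarrow> (\<lambda>n. \<xi> (Suc n) * nexp (Suc n) s) sums L s"
  unfolding L_def by (rule E(2))

lemma L_holomorphic:
  assumes "mean = 0 \<or> 1 \<notin> A" "A \<subseteq> {s. Re s > 0}"
  shows "L holomorphic_on A"
proof -
  have e: "E holomorphic_on A" using E(1) assms(2) holomorphic_on_subset by blast
  show ?thesis
  proof (cases "mean = 0")
    case True
    then have "L = E" by (simp add: L_def fun_eq_iff)
    then show ?thesis using e by simp
  next
    case False
    then have "\<forall>s\<in>A. s - 1 \<noteq> 0" using assms by auto
    then show ?thesis unfolding L_def by (intro holomorphic_intros e) auto
  qed
qed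

lemma moebius_summable: "Re s > 1 \<Longrightarrow> summable (\<lambda>n. norm (of_int (moebius_mu (Suc n)) * \<xi> (Suc n) * nexp (Suc n) s))"
proof (rule summable_nexp)
  fix n :: nat assume "n > 0"
  have "norm (of_int (moebius_mu n) * \<xi> n) \<le> 1 * 1"
    unfolding norm_mult using abs_moebius_le_1[of n] norm_le_1[of n] by (intro mult_mono) auto
  also have "\<dots> \<le> 1 + ln (real n)" using \<open>n > 0\<close> by simp
  finally show "norm (of_int (moebius_mu n) * \<xi> n) \<le> 1 + ln (real n)" .
qed

lemma character_summable: "Re s > 1 \<Longrightarrow> summable (\<lambda>n. norm (\<xi> (Suc n) * nexp (Suc n) s))"
proof (rule summable_nexp)
  fix n :: nat assume "n > 0"
  then have "0 \<le> ln (real n)" by simp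
  then show "norm (\<xi> n) \<le> 1 + ln (real n)" using norm_le_1[of n] by linarith
qed

text \<open>Complete multiplicativity lets the twist by \<open>\<xi> n * n^(-s)\<close> factor out of every divisor
convolution.\<close>

lemma twisted_divisor_term:
  assumes "d dvd n" "n > 0"
  shows "(x * \<xi> d * nexp d s) * (\<xi> (n div d) * nexp (n div d) s) = x * (\<xi> n * nexp n s)"
proof -
  obtain e where e: "n = d * e" using assms(1) by (elim dvdE)
  then have "d > 0" "e > 0" using assms(2) by (metis mult_is_0 gr0I)+
  then show ?thesis using e by (simp add: mult nexp_mult)
qed

lemma L_times_moebius:
  assumes s: "Re s > 1"
  shows "(\<Sum>n. of_int (moebius_mu (Suc n)) * \<xi> (Suc n) * nexp (Suc n) s) * L s = 1"
proof -
  have "(\<lambda>n. \<Sum>d | d dvd Suc n. (of_int (moebius_mu d) * \<xi> d * nexp d s) * (\<xi> (Suc n div d) * nexp (Suc n div d) s))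
     sums ((\<Sum>n. of_int (moebius_mu (Suc n)) * \<xi> (Suc n) * nexp (Suc n) s) * (\<Sum>n. \<xi> (Suc n) * nexp (Suc n) s))"
    by (rule sums_divisor_convolution[OF moebius_summable[OF s] character_summable[OF s]])
  moreover have "(\<Sum>d | d dvd Suc n. (of_int (moebius_mu d) * \<xi> d * nexp d s) * (\<xi> (Suc n div d) * nexp (Suc n div d) s)) = (if n = 0 then 1 else 0)" for n
  proof -
    have "(\<Sum>d | d dvd Suc n. (of_int (moebius_mu d) * \<xi> d * nexp d s) * (\<xi> (Suc n div d) * nexp (Suc n div d) s))
      = of_int (\<Sum>d | d dvd Suc n. moebius_mu d) * (\<xi> (Suc n) * nexp (Suc n) s)"
      unfolding of_int_sum sum_distrib_right by (intro sum.cong refl twisted_divisor_term) auto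
    then show ?thesis by (simp add: moebius_divisor_sum)
  qed
  ultimately have "(\<lambda>n. if n = 0 then 1 else 0) sums ((\<Sum>n. of_int (moebius_mu (Suc n)) * \<xi> (Suc n) * nexp (Suc n) s) * L s)"
    using sums_unique[OF L_sums[OF s]] by simp
  moreover have "(\<lambda>n::nat. if n = 0 then 1 else 0 :: complex) sums 1" using sums_single[of 0 "\<lambda>_. 1 :: complex"] by simp
  ultimately show ?thesis using sums_unique2 by blast
qed

lemma L_nonzero: "Re s > 1 \<Longrightarrow> L s \<noteq> 0"
  using L_times_moebius[of s] by auto

lemma moebius_sums: "Re s > 1 \<Longrightarrow> (\<lambda>n. of_int (moebius_mu (Suc n)) * \<xi> (Suc n) * nexp (Suc n) s) sums (1 / L s)"
  using summable_sums[OF summable_norm_cancel[OF moebius_summable[of s]]]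
    eq_divide_imp[OF L_nonzero L_times_moebius, of s] by simp

lemma mangoldt_summable: "Re s > 1 \<Longrightarrow> summable (\<lambda>n. norm (mangoldt (Suc n) * \<xi> (Suc n) * nexp (Suc n) s))"
proof (rule summable_nexp)
  fix n :: nat assume "n > 0"
  have "norm (mangoldt n * \<xi> n) \<le> ln (real n) * 1"
    unfolding norm_mult using norm_le_1[of n] mangoldt_le[of n] \<open>n > 0\<close> by (intro mult_mono) auto
  then show "norm (mangoldt n * \<xi> n) \<le> 1 + ln (real n)" by simp
qed

lemma mangoldt_sums:
  assumes s: "Re s > 1"
  shows "(\<lambda>n. mangoldt (Suc n) * \<xi> (Suc n) * nexp (Suc n) s) sums (- deriv L s / L s)"
proof -
  have "(\<lambda>n. \<Sum>d | d dvd Suc n. (mangoldt d * \<xi> d * nexp d s) * (\<xi> (Suc n div d) * nexp (Suc n div d) s))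
     sums ((\<Sum>n. mangoldt (Suc n) * \<xi> (Suc n) * nexp (Suc n) s) * (\<Sum>n. \<xi> (Suc n) * nexp (Suc n) s))"
    by (rule sums_divisor_convolution[OF mangoldt_summable[OF s] character_summable[OF s]])
  moreover have "(\<Sum>d | d dvd Suc n. (mangoldt d * \<xi> d * nexp d s) * (\<xi> (Suc n div d) * nexp (Suc n div d) s)) = of_real (ln (real (Suc n))) * \<xi> (Suc n) * nexp (Suc n) s" for n
  proof -
    have "(\<Sum>d | d dvd Suc n. (mangoldt d * \<xi> d * nexp d s) * (\<xi> (Suc n div d) * nexp (Suc n div d) s))
      = (\<Sum>d | d dvd Suc n. mangoldt d) * (\<xi> (Suc n) * nexp (Suc n) s)"
      unfolding sum_distrib_right by (intro sum.cong refl twisted_divisor_term) auto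
    then show ?thesis by (simp only: mangoldt_sum nat.distinct not_False_eq_True mult.assoc)
  qed
  ultimately have "(\<lambda>n. of_real (ln (real (Suc n))) * \<xi> (Suc n) * nexp (Suc n) s) sums ((\<Sum>n. mangoldt (Suc n) * \<xi> (Suc n) * nexp (Suc n) s) * L s)"
    using sums_unique[OF L_sums[OF s]] by simp
  then have "(\<Sum>n. mangoldt (Suc n) * \<xi> (Suc n) * nexp (Suc n) s) * L s = - deriv L s"
    using dirichlet_series_derivative[OF norm_le_1 L_sums s] sums_unique2 by blast
  from eq_divide_imp[OF L_nonzero[OF s] this] show ?thesis
    using summable_sums[OF summable_norm_cancel[OF mangoldt_summable[OF s]]] by simp
qed

end

section \<open>Non-vanishing on the line of abscissa 1\<close>

text \<open>The limit is the order of \<open>\<Phi>\<close> at \<open>s0\<close>; the approach is from the right, where \<open>\<Phi>\<close> has no zeros.\<close>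

lemma log_derivative_order:
  fixes \<Phi> :: "complex \<Rightarrow> complex"
  assumes hol: "\<Phi> holomorphic_on ball s0 r" and r: "r > 0"
    and nz: "\<And>\<epsilon>. 0 < \<epsilon> \<Longrightarrow> \<epsilon> < r \<Longrightarrow> \<Phi> (s0 + of_real \<epsilon>) \<noteq> 0"
  shows "\<exists>m::nat. (\<Phi> s0 = 0 \<longrightarrow> m > 0) \<and>
     ((\<lambda>\<epsilon>. of_real \<epsilon> * (deriv \<Phi> (s0 + of_real \<epsilon>) / \<Phi> (s0 + of_real \<epsilon>))) \<longlongrightarrow> of_nat m) (at_right 0)"
proof -
  have "\<exists>g \<rho> m. (\<Phi> s0 = 0 \<longrightarrow> m > 0) \<and> 0 < \<rho> \<and> ball s0 \<rho> \<subseteq> ball s0 r \<and> g holomorphic_on ball s0 \<rho> \<and>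
     (\<forall>w\<in>ball s0 \<rho>. \<Phi> w = (w - s0) ^ m * g w) \<and> g s0 \<noteq> 0"
  proof (cases "\<Phi> s0 = 0")
    case True
    have "\<not> \<Phi> constant_on ball s0 r"
    proof
      assume "\<Phi> constant_on ball s0 r"
      then have "\<Phi> (s0 + of_real (r / 2)) = \<Phi> s0"
        using r unfolding constant_on_def by (force simp: dist_norm)
      then show False using nz[of "r / 2"] r True by simp
    qed
    then obtain g \<rho> n where "0 < n" "0 < \<rho>" "ball s0 \<rho> \<subseteq> ball s0 r" "g holomorphic_on ball s0 \<rho>"
       "\<And>w. w \<in> ball s0 \<rho> \<Longrightarrow> \<Phi> w = (w - s0) ^ n * g w" "\<And>w. w \<in> ball s0 \<rho> \<Longrightarrow> g w \<noteq> 0"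
      using holomorphic_factor_zero_nonconstant[OF hol open_ball connected_ball, of s0] r True by (metis centre_in_ball)
    then show ?thesis by (intro exI[of _ g] exI[of _ \<rho>] exI[of _ n]) auto
  next
    case False
    then show ?thesis using hol r by (intro exI[of _ \<Phi>] exI[of _ r] exI[of _ 0]) auto
  qed
  then obtain g \<rho> m where m: "\<Phi> s0 = 0 \<longrightarrow> m > 0" and \<rho>: "0 < \<rho>" "ball s0 \<rho> \<subseteq> ball s0 r"
    and g: "g holomorphic_on ball s0 \<rho>" "\<And>w. w \<in> ball s0 \<rho> \<Longrightarrow> \<Phi> w = (w - s0) ^ m * g w" "g s0 \<noteq> 0" by blast
  have dg: "deriv g holomorphic_on ball s0 \<rho>" using g(1) by (rule holomorphic_deriv) simp
  have cont: "isCont g s0" "isCont (deriv g) s0"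
    using holomorphic_on_imp_continuous_on[OF g(1)] holomorphic_on_imp_continuous_on[OF dg] \<rho>(1)
    by (simp_all add: continuous_on_eq_continuous_at)
  have shift: "filterlim (\<lambda>\<epsilon>. s0 + complex_of_real \<epsilon>) (nhds s0) (at_right 0)"
    by (rule tendsto_eq_intros refl)+ simp
  have "((\<lambda>\<epsilon>. of_nat m + of_real \<epsilon> * (deriv g (s0 + of_real \<epsilon>) / g (s0 + of_real \<epsilon>))) \<longlongrightarrow> of_nat m + of_real 0 * (deriv g s0 / g s0)) (at_right 0)"
    using g(3) cont by (intro tendsto_intros isCont_tendsto_compose[OF _ shift]) auto
  moreover have "eventually (\<lambda>\<epsilon>. of_nat m + of_real \<epsilon> * (deriv g (s0 + of_real \<epsilon>) / g (s0 + of_real \<epsilon>))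
      = of_real \<epsilon> * (deriv \<Phi> (s0 + of_real \<epsilon>) / \<Phi> (s0 + of_real \<epsilon>))) (at_right 0)"
  proof (rule eventually_at_rightI[of 0 \<rho>])
    fix \<epsilon> :: real assume e: "\<epsilon> \<in> {0<..<\<rho>}"
    define w where "w = s0 + complex_of_real \<epsilon>"
    have w: "w \<in> ball s0 \<rho>" "w - s0 = of_real \<epsilon>" using e by (auto simp: w_def dist_norm)
    have "\<rho> \<le> r" using \<rho> by (simp add: ball_subset_ball_iff)
    then have Pw: "\<Phi> w \<noteq> 0" unfolding w_def using e by (intro nz) auto
    have "((\<lambda>w. (w - s0) ^ m * g w) has_field_derivative
        (of_nat m * (w - s0) ^ (m - 1)) * g w + deriv g w * (w - s0) ^ m) (at w)"
      using holomorphic_derivI[OF g(1) open_ball w(1)]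
      by (auto intro!: derivative_eq_intros simp: algebra_simps)
    then have "(\<Phi> has_field_derivative (of_nat m * (w - s0) ^ (m - 1)) * g w + deriv g w * (w - s0) ^ m) (at w)"
      by (rule has_field_derivative_transform_within_open[OF _ open_ball w(1)]) (use g(2) in auto)
    then have d: "deriv \<Phi> w = (of_nat m * (w - s0) ^ (m - 1)) * g w + deriv g w * (w - s0) ^ m"
      by (rule DERIV_imp_deriv)
    have gw: "g w \<noteq> 0" using Pw g(2)[OF w(1)] by auto
    have z: "w - s0 \<noteq> 0" using w e by auto
    have "(w - s0) * deriv \<Phi> w = (of_nat m + (w - s0) * (deriv g w / g w)) * \<Phi> w"
      unfolding d g(2)[OF w(1)] using gw z by (cases m) (simp_all add: field_simps)
    then have "(w - s0) * (deriv \<Phi> w / \<Phi> w) = of_nat m + (w - s0) * (deriv g w / g w)"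
      using Pw by (simp add: field_simps)
    then show "of_nat m + of_real \<epsilon> * (deriv g (s0 + of_real \<epsilon>) / g (s0 + of_real \<epsilon>))
      = of_real \<epsilon> * (deriv \<Phi> (s0 + of_real \<epsilon>) / \<Phi> (s0 + of_real \<epsilon>))"
      unfolding w(2) unfolding w_def by simp
  qed (use \<rho> in simp)
  ultimately have "((\<lambda>\<epsilon>. of_real \<epsilon> * (deriv \<Phi> (s0 + of_real \<epsilon>) / \<Phi> (s0 + of_real \<epsilon>))) \<longlongrightarrow> of_nat m + of_real 0 * (deriv g s0 / g s0)) (at_right 0)"
    by (rule Lim_transform_eventually)
  then show ?thesis using m by (intro exI[of _ m]) simp
qed

context dirichlet_character
begin

lemma log_derivative_limit:
  assumes "mean = 0 \<or> t \<noteq> 0"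
  shows "\<exists>m::nat. (L (Complex 1 t) = 0 \<longrightarrow> m > 0) \<and>
     ((\<lambda>\<epsilon>. \<epsilon> * Re (- deriv L (Complex (1 + \<epsilon>) t) / L (Complex (1 + \<epsilon>) t))) \<longlongrightarrow> - real m) (at_right 0)"
proof -
  define s0 where "s0 = Complex 1 t"
  \<comment> \<open>the ball stays in \<open>Re s > 0\<close> and avoids the possible pole at \<open>1\<close>\<close>
  define r where "r = (if t = 0 then 1 else min 1 \<bar>t\<bar>)"
  have r: "r > 0" "r \<le> 1" by (auto simp: r_def)
  have sub: "ball s0 r \<subseteq> {s. Re s > 0}"
  proof
    fix s assume "s \<in> ball s0 r"
    then show "s \<in> {s. Re s > 0}" using abs_Re_le_cmod[of "s0 - s"] r by (auto simp: dist_norm s0_def)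
  qed
  have "mean = 0 \<or> 1 \<notin> ball s0 r"
    using assms abs_Im_le_cmod[of "s0 - 1"] by (auto simp: dist_norm s0_def r_def)
  then have hol: "L holomorphic_on ball s0 r" by (rule L_holomorphic[OF _ sub])
  have shift: "s0 + complex_of_real \<epsilon> = Complex (1 + \<epsilon>) t" for \<epsilon> by (simp add: s0_def complex_eq_iff)
  have "L (s0 + of_real \<epsilon>) \<noteq> 0" if "0 < \<epsilon>" for \<epsilon> unfolding shift using that by (intro L_nonzero) simp
  then obtain m :: nat where m: "L s0 = 0 \<longrightarrow> m > 0"
     "((\<lambda>\<epsilon>. of_real \<epsilon> * (deriv L (s0 + of_real \<epsilon>) / L (s0 + of_real \<epsilon>))) \<longlongrightarrow> of_nat m) (at_right 0)"
    using log_derivative_order[OF hol r(1)] by blast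
  have "((\<lambda>\<epsilon>. - Re (of_real \<epsilon> * (deriv L (s0 + of_real \<epsilon>) / L (s0 + of_real \<epsilon>)))) \<longlongrightarrow> - Re (of_nat m)) (at_right 0)"
    by (intro tendsto_intros m(2))
  moreover have "- Re (of_real \<epsilon> * (x / y)) = \<epsilon> * Re (- x / y)" for \<epsilon> x y
    unfolding minus_divide_left[symmetric] scaleR_conv_of_real[symmetric] by simp
  ultimately show ?thesis using m(1) unfolding shift s0_def[symmetric] by (intro exI[of _ m]) simp
qed

lemma log_derivative_pole:
  assumes "mean \<noteq> 0"
  shows "((\<lambda>\<epsilon>. \<epsilon> * Re (- deriv L (Complex (1 + \<epsilon>) 0) / L (Complex (1 + \<epsilon>) 0))) \<longlongrightarrow> 1) (at_right 0)"
proof -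
  let ?S = "{s. Re s > 0}"
  have op: "open ?S" by (rule open_halfspace_Re_gt)
  have dE: "deriv E holomorphic_on ?S" using E(1) op by (rule holomorphic_deriv)
  have cont: "isCont E 1" "isCont (deriv E) 1"
    using E(1) dE op by (auto simp: continuous_on_eq_continuous_at dest!: holomorphic_on_imp_continuous_on)
  have shift: "filterlim (\<lambda>\<epsilon>. 1 + complex_of_real \<epsilon>) (nhds 1) (at_right 0)"
    by (rule tendsto_eq_intros refl)+ simp
  have "((\<lambda>\<epsilon>. (mean - (of_real \<epsilon>)\<^sup>2 * deriv E (1 + of_real \<epsilon>)) / (mean + of_real \<epsilon> * E (1 + of_real \<epsilon>))) \<longlongrightarrow> (mean - (of_real 0)\<^sup>2 * deriv E 1) / (mean + of_real 0 * E 1)) (at_right 0)"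
    using assms cont by (intro tendsto_intros isCont_tendsto_compose[OF _ shift]) auto
  then have "((\<lambda>\<epsilon>. (mean - (of_real \<epsilon>)\<^sup>2 * deriv E (1 + of_real \<epsilon>)) / (mean + of_real \<epsilon> * E (1 + of_real \<epsilon>))) \<longlongrightarrow> 1) (at_right 0)"
    using assms by simp
  moreover have "eventually (\<lambda>\<epsilon>. (mean - (of_real \<epsilon>)\<^sup>2 * deriv E (1 + of_real \<epsilon>)) / (mean + of_real \<epsilon> * E (1 + of_real \<epsilon>))
      = of_real \<epsilon> * (- deriv L (1 + of_real \<epsilon>) / L (1 + of_real \<epsilon>))) (at_right 0)"
  proof (rule eventually_at_rightI[of 0 1])
    fix \<epsilon> :: real assume e: "\<epsilon> \<in> {0<..<1}"
    define w where "w = complex_of_real \<epsilon>"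
    have w: "w \<noteq> 0" using e by (simp add: w_def)
    have "(E has_field_derivative deriv E (1 + w)) (at (1 + w))"
      by (rule holomorphic_derivI[OF E(1) op]) (use e in \<open>simp add: w_def\<close>)
    then have "(L has_field_derivative - mean / w\<^sup>2 + deriv E (1 + w)) (at (1 + w))"
      unfolding L_def[abs_def] using w
      by (auto intro!: derivative_eq_intros simp: power2_eq_square)
    then have d: "deriv L (1 + w) = - mean / w\<^sup>2 + deriv E (1 + w)" by (rule DERIV_imp_deriv)
    have l: "L (1 + w) = mean / w + E (1 + w)" by (simp add: L_def)
    have "L (1 + w) \<noteq> 0" by (rule L_nonzero) (use e in \<open>simp add: w_def\<close>)
    have "- deriv L (1 + w) * w\<^sup>2 = mean - w\<^sup>2 * deriv E (1 + w)" unfolding d using w by (simp add: field_simps)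
    moreover have "L (1 + w) * w = mean + w * E (1 + w)" unfolding l using w by (simp add: field_simps)
    ultimately have "(mean - w\<^sup>2 * deriv E (1 + w)) / (mean + w * E (1 + w)) = (- deriv L (1 + w) * w\<^sup>2) / (L (1 + w) * w)" by simp
    also have "\<dots> = w * (- deriv L (1 + w) / L (1 + w))" using w by (simp add: power2_eq_square)
    finally show "(mean - (of_real \<epsilon>)\<^sup>2 * deriv E (1 + of_real \<epsilon>)) / (mean + of_real \<epsilon> * E (1 + of_real \<epsilon>))
      = of_real \<epsilon> * (- deriv L (1 + of_real \<epsilon>) / L (1 + of_real \<epsilon>))" unfolding w_def .
  qed simp
  ultimately have "((\<lambda>\<epsilon>. of_real \<epsilon> * (- deriv L (1 + of_real \<epsilon>) / L (1 + of_real \<epsilon>))) \<longlongrightarrow> 1) (at_right 0)"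
    by (rule Lim_transform_eventually)
  then have "((\<lambda>\<epsilon>. Re (\<epsilon> *\<^sub>R (- deriv L (1 + of_real \<epsilon>) / L (1 + of_real \<epsilon>)))) \<longlongrightarrow> Re 1) (at_right 0)"
    unfolding scaleR_conv_of_real by (rule tendsto_Re)
  moreover have "1 + complex_of_real \<epsilon> = Complex (1 + \<epsilon>) 0" for \<epsilon> by (simp add: complex_eq_iff)
  ultimately show ?thesis by simp
qed

end

lemma nexp_Complex:
  assumes "n > 0"
  shows "nexp n (Complex \<sigma> t) = of_real (real n powr - \<sigma>) * nexp n (Complex 0 t)"
proof -
  have "nexp n (Complex \<sigma> t) = nexp n (of_real \<sigma>) * nexp n (Complex 0 t)"
  proof -
    have "Complex \<sigma> t = of_real \<sigma> + Complex 0 t" by (simp add: complex_eq_iff)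
    then show ?thesis by (simp only: nexp_add)
  qed
  also have "nexp n (of_real \<sigma>) = of_real (real n powr - \<sigma>)"
    using assms by (simp add: nexp_def powr_def exp_of_real[symmetric])
  finally show ?thesis .
qed

lemma three_four_one:
  fixes w :: complex
  assumes "norm w = 1"
  shows "3 + 4 * Re w + Re (w * w) \<ge> 0"
proof -
  have "(Re w)\<^sup>2 + (Im w)\<^sup>2 = 1" using assms by (simp add: cmod_power2[symmetric])
  then have "3 + 4 * Re w + Re (w * w) = 2 * (1 + Re w)\<^sup>2" by (simp add: power2_eq_square algebra_simps)
  then show ?thesis by simp
qed

definition principal :: "nat \<Rightarrow> nat \<Rightarrow> complex" where
  "principal q n = (if coprime n q then 1 else 0)"

lemma principal_character: "q > 0 \<Longrightarrow> dirichlet_character q (principal q)"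
proof unfold_locales
  fix n
  have "coprime (n + q) q \<longleftrightarrow> coprime n q" by (simp only: coprime_iff_gcd_eq_1 gcd_add1)
  then show "principal q (n + q) = principal q n" by (simp add: principal_def)
qed (auto simp: principal_def)

context dirichlet_character
begin

text \<open>For \<open>n\<close> prime to \<open>q\<close> and \<open>w = \<xi> n * n^(- \<i> t)\<close>, the three logarithmic derivatives contribute
\<open>mangoldt n * n^(-\<sigma>)\<close> times \<open>3 + 4 Re w + Re w\<^sup>2\<close>, which \<open>three_four_one\<close> bounds below.\<close>

lemma three_four_one_L:
  assumes \<sigma>: "\<sigma> > 1"
  defines "LP \<equiv> dirichlet_character.L q (principal q)" and "LS \<equiv> dirichlet_character.L q (\<lambda>n. \<xi> n * \<xi> n)"
  shows "3 * Re (- deriv LP (Complex \<sigma> 0) / LP (Complex \<sigma> 0)) + 4 * Re (- deriv L (Complex \<sigma> t) / L (Complex \<sigma> t))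
    + Re (- deriv LS (Complex \<sigma> (2 * t)) / LS (Complex \<sigma> (2 * t))) \<ge> 0"
proof -
  interpret P: dirichlet_character q "principal q" by (rule principal_character[OF modulus_pos])
  interpret S: dirichlet_character q "\<lambda>n. \<xi> n * \<xi> n" by (rule character_mult) unfold_locales
  define trm where "trm n = 3 * Re (mangoldt (Suc n) * principal q (Suc n) * nexp (Suc n) (Complex \<sigma> 0))
     + 4 * Re (mangoldt (Suc n) * \<xi> (Suc n) * nexp (Suc n) (Complex \<sigma> t))
     + Re (mangoldt (Suc n) * (\<xi> (Suc n) * \<xi> (Suc n)) * nexp (Suc n) (Complex \<sigma> (2 * t)))" for n
  have "trm sums (3 * Re (- deriv LP (Complex \<sigma> 0) / LP (Complex \<sigma> 0)) + 4 * Re (- deriv L (Complex \<sigma> t) / L (Complex \<sigma> t))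
    + Re (- deriv LS (Complex \<sigma> (2 * t)) / LS (Complex \<sigma> (2 * t))))"
    unfolding trm_def LP_def LS_def using \<sigma>
    by (intro sums_add sums_mult sums_Re P.mangoldt_sums mangoldt_sums S.mangoldt_sums) simp_all
  moreover have "trm k \<ge> 0" for k
  proof -
    define n where "n = Suc k"
    have n: "n > 0" by (simp add: n_def)
    show ?thesis
    proof (cases "coprime n q")
      case True
      define x where "x = mangoldt n * real n powr - \<sigma>"
      define w where "w = \<xi> n * nexp n (Complex 0 t)"
      have "norm w = 1" using True n by (simp add: w_def norm_mult norm_eq norm_nexp)
      have "Complex 0 (2 * t) = Complex 0 t + Complex 0 t" by (simp add: complex_eq_iff)
      then have n2: "nexp n (Complex 0 (2 * t)) = nexp n (Complex 0 t) * nexp n (Complex 0 t)" by (metis nexp_add)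
      have n0: "nexp n (Complex 0 0) = 1" using nexp_0_right[of n] by (simp add: complex_of_real_def zero_complex.code)
      have "trm k = 3 * Re (of_real x) + 4 * Re (of_real x * w) + Re (of_real x * (w * w))"
        unfolding trm_def n_def[symmetric] nexp_Complex[OF n, of \<sigma>] n2 n0 x_def w_def principal_def
        using True by (simp add: mult_ac)
      also have "\<dots> = x * (3 + 4 * Re w + Re (w * w))" by (simp add: algebra_simps)
      also have "\<dots> \<ge> 0" unfolding x_def
        by (intro mult_nonneg_nonneg mangoldt_nonneg three_four_one \<open>norm w = 1\<close>) simp
      finally show ?thesis .
    next
      case False
      then have "\<xi> n = 0" "principal q n = 0" using support by (auto simp: principal_def)
      then show ?thesis unfolding trm_def n_def[symmetric] by simp
    qed
  qed
  ultimately show ?thesis using sums_le[OF _ sums_zero] by blast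
qed

text \<open>Multiply \<open>three_four_one_L\<close> by \<open>\<sigma> - 1\<close> and let \<open>\<sigma>\<close> tend to \<open>1\<close>. The principal character contributes
\<open>3\<close>, a zero of order \<open>k\<close> at \<open>1 + \<i> t\<close> contributes \<open>- 4 k\<close>, and the squared character contributes \<open>- l \<le> 0\<close> unless
it has a pole at \<open>1 + 2 \<i> t\<close>. The hypothesis \<open>m2\<close> excludes this pole.\<close>

lemma L_nonzero_line_complex:
  assumes m: "mean = 0 \<or> t \<noteq> 0" and m2: "dirichlet_character.mean q (\<lambda>n. \<xi> n * \<xi> n) = 0 \<or> t \<noteq> 0"
  shows "L (Complex 1 t) \<noteq> 0"
proof
  assume zero: "L (Complex 1 t) = 0"
  interpret P: dirichlet_character q "principal q" by (rule principal_character[OF modulus_pos])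
  interpret S: dirichlet_character q "\<lambda>n. \<xi> n * \<xi> n" by (rule character_mult) unfold_locales
  have "P.mean \<noteq> 0" by (rule P.mean_principal) (simp add: principal_def)
  note lP = P.log_derivative_pole[OF this]
  obtain k :: nat where k: "k > 0"
    "((\<lambda>\<epsilon>. \<epsilon> * Re (- deriv L (Complex (1 + \<epsilon>) t) / L (Complex (1 + \<epsilon>) t))) \<longlongrightarrow> - real k) (at_right 0)"
    using log_derivative_limit[OF m] zero by blast
  obtain l :: nat where l:
    "((\<lambda>\<epsilon>. \<epsilon> * Re (- deriv S.L (Complex (1 + \<epsilon>) (2 * t)) / S.L (Complex (1 + \<epsilon>) (2 * t)))) \<longlongrightarrow> - real l) (at_right 0)"
    using S.log_derivative_limit[of "2 * t"] m2 by auto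
  define h where "h \<epsilon> = 3 * (\<epsilon> * Re (- deriv P.L (Complex (1 + \<epsilon>) 0) / P.L (Complex (1 + \<epsilon>) 0)))
     + 4 * (\<epsilon> * Re (- deriv L (Complex (1 + \<epsilon>) t) / L (Complex (1 + \<epsilon>) t)))
     + \<epsilon> * Re (- deriv S.L (Complex (1 + \<epsilon>) (2 * t)) / S.L (Complex (1 + \<epsilon>) (2 * t)))" for \<epsilon>
  have "(h \<longlongrightarrow> 3 * 1 + 4 * (- real k) + - real l) (at_right 0)"
    unfolding h_def by (intro tendsto_add tendsto_mult_left lP k l)
  moreover have "eventually (\<lambda>\<epsilon>. 0 \<le> h \<epsilon>) (at_right 0)"
  proof (rule eventually_at_rightI[of 0 1])
    fix \<epsilon> :: real assume e: "\<epsilon> \<in> {0<..<1}"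
    have "h \<epsilon> = \<epsilon> * (3 * Re (- deriv P.L (Complex (1 + \<epsilon>) 0) / P.L (Complex (1 + \<epsilon>) 0))
     + 4 * Re (- deriv L (Complex (1 + \<epsilon>) t) / L (Complex (1 + \<epsilon>) t))
     + Re (- deriv S.L (Complex (1 + \<epsilon>) (2 * t)) / S.L (Complex (1 + \<epsilon>) (2 * t))))"
      unfolding h_def by (simp only: distrib_left mult.left_commute[of \<epsilon>])
    also have "\<dots> \<ge> 0" using e three_four_one_L[of "1 + \<epsilon>" t] by (intro mult_nonneg_nonneg) auto
    finally show "0 \<le> h \<epsilon>" .
  qed simp
  ultimately have "0 \<le> 3 * 1 + 4 * (- real k) + - real l"
    by (intro tendsto_lowerbound) auto
  then show False using k(1) by linarith
qed

text \<open>If the square of \<open>\<xi>\<close> is principal, \<open>\<xi>\<close> takes the values \<open>- 1\<close>, \<open>0\<close> and \<open>1\<close>.\<close>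

lemma L_nonzero_real:
  assumes m: "mean = 0" and m2: "dirichlet_character.mean q (\<lambda>n. \<xi> n * \<xi> n) \<noteq> 0"
  shows "L 1 \<noteq> 0"
proof
  assume zero: "L 1 = 0"
  interpret S: dirichlet_character q "\<lambda>n. \<xi> n * \<xi> n" by (rule character_mult) unfold_locales
  have sq: "\<xi> n = 1 \<or> \<xi> n = - 1" if "coprime n q" for n
    using S.mean_nonzero_imp_principal[OF m2 that] square_eq_1_iff[of "\<xi> n"] by simp
  define c where "c n = Re (\<xi> n)" for n
  have \<xi>c: "\<xi> n = of_real (c n)" and val: "c n \<in> {- 1, 0, 1}" for n
    using sq[of n] support[of n] by (cases "coprime n q"; force simp: c_def)+
  have "\<not> (\<lambda>n. c (Suc n) / real (Suc n)) sums 0"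
  proof (rule real_character_sum_nonzero)
    show "c (m * n) = c m * c n" for m n
    proof -
      have "complex_of_real (c (m * n)) = of_real (c m * c n)" using mult[of m n] \<xi>c by simp
      then show ?thesis by (simp only: of_real_eq_iff)
    qed
    show "c 1 = 1" by (simp add: c_def)
    have "(\<Sum>n<q. \<xi> n) = 0" using m modulus_pos by (simp add: mean_def)
    then have b: "norm (\<Sum>n<N. \<xi> (Suc n)) \<le> 2 * (\<Sum>n<q. norm (\<xi> n))" for N
      by (rule periodic_partial_sums_bounded[where c = \<xi>, OF periodic modulus_pos])
    have "\<bar>\<Sum>n<N. c (Suc n)\<bar> = norm (\<Sum>n<N. \<xi> (Suc n))" for N
      unfolding \<xi>c of_real_sum[symmetric] norm_of_real ..
    then show "\<bar>\<Sum>n<N. c (Suc n)\<bar> \<le> 2 * (\<Sum>n<q. norm (\<xi> n))" for N using b by simp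
  qed (rule val)
  moreover have "(\<lambda>n. \<xi> (Suc n) * nexp (Suc n) 1) sums 0"
    using E(3)[OF m, of 1] zero m by (simp add: L_def)
  then have "(\<lambda>n. complex_of_real (c (Suc n) / real (Suc n))) sums of_real 0"
    by (simp add: \<xi>c nexp_1_right)
  then have "(\<lambda>n. c (Suc n) / real (Suc n)) sums 0" by (simp only: sums_of_real_iff)
  ultimately show False by blast
qed

theorem L_nonzero_line:
  assumes "mean = 0 \<or> t \<noteq> 0"
  shows "L (Complex 1 t) \<noteq> 0"
proof (cases "dirichlet_character.mean q (\<lambda>n. \<xi> n * \<xi> n) = 0 \<or> t \<noteq> 0")
  case True
  then show ?thesis by (rule L_nonzero_line_complex[OF assms])
next
  case False
  then have "L 1 \<noteq> 0" using assms by (intro L_nonzero_real) auto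
  moreover have "Complex 1 t = 1" using False by (simp add: complex_eq_iff)
  ultimately show ?thesis by simp
qed

text \<open>On \<open>Re s \<ge> 1\<close> the quotient \<open>num / den\<close> continues \<open>1 / L\<close>: for the principal character the factor \<open>s - 1\<close>
removes the pole of \<open>L\<close> from the denominator.\<close>

theorem moebius_character_series_converges:
  "\<exists>S. (\<lambda>n. of_int (moebius_mu (Suc n)) * \<xi> (Suc n) / of_nat (Suc n)) sums S"
proof -
  define num where "num s = (if mean = 0 then 1 else s - 1)" for s :: complex
  define den where "den s = (if mean = 0 then E s else mean + (s - 1) * E s)" for s
  let ?S = "{s. Re s > 0}"
  define W where "W = ?S \<inter> den -` (- {0})"
  have denh: "den holomorphic_on ?S"
    unfolding den_def by (cases "mean = 0") (auto intro!: holomorphic_intros E(1))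
  have L_eq: "L s * num s = den s" if "mean = 0 \<or> s \<noteq> 1" for s
    using that by (auto simp: L_def num_def den_def divide_simps distrib_right)
  have dz: "den s \<noteq> 0" if s: "Re s \<ge> 1" for s
  proof (cases "mean = 0 \<or> s \<noteq> 1")
    case True
    then have "num s \<noteq> 0" by (auto simp: num_def)
    moreover have "L s \<noteq> 0"
    proof (cases "Re s > 1")
      case False
      then have "s = Complex 1 (Im s)" "mean = 0 \<or> Im s \<noteq> 0" using s True by (auto simp: complex_eq_iff)
      then show ?thesis using L_nonzero_line by metis
    qed (rule L_nonzero)
    ultimately show ?thesis using L_eq[OF True] by auto
  next
    case False
    then show ?thesis by (simp add: den_def)
  qed
  show ?thesis
  proof (rule exI, rule newman_tauberian)
    show "norm (of_int (moebius_mu n) * \<xi> n) \<le> 1" for n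
    proof -
      have "norm (of_int (moebius_mu n) * \<xi> n) \<le> 1 * 1"
        unfolding norm_mult using abs_moebius_le_1[of n] norm_le_1[of n] by (intro mult_mono) auto
      then show ?thesis by simp
    qed
    show "open W" unfolding W_def
      by (intro continuous_open_preimage holomorphic_on_imp_continuous_on denh open_halfspace_Re_gt) auto
    show "{s. Re s \<ge> 1} \<subseteq> W" using dz by (force simp: W_def)
    show "(\<lambda>s. num s / den s) holomorphic_on W"
    proof (rule holomorphic_on_divide)
      show "num holomorphic_on W" unfolding num_def by (cases "mean = 0") (auto intro!: holomorphic_intros)
      show "den holomorphic_on W" using denh by (rule holomorphic_on_subset) (auto simp: W_def)
    qed (auto simp: W_def)
    fix s :: complex assume s: "Re s > 1"
    have "num s / den s = 1 / L s"
    proof -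
      have "mean = 0 \<or> s \<noteq> 1" "s \<noteq> 1" using s by auto
      then have "L s * num s = den s" "num s \<noteq> 0" using L_eq by (auto simp: num_def)
      then show ?thesis by (simp add: \<open>L s * num s = den s\<close>[symmetric])
    qed
    then show "(\<lambda>n. of_int (moebius_mu (Suc n)) * \<xi> (Suc n) * nexp (Suc n) s) sums (num s / den s)"
      using moebius_sums[OF s] by simp
  qed
qed

end

section \<open>From logarithmic to natural averages\<close>

lemma cesaro_mean:
  fixes X :: "nat \<Rightarrow> complex"
  assumes "X \<longlonglongrightarrow> S"
  shows "(\<lambda>N. (1 / of_nat N) * (\<Sum>n<N. X n)) \<longlonglongrightarrow> S"
proof (rule LIMSEQ_I)
  fix \<epsilon> :: real assume \<epsilon>: "\<epsilon> > 0"
  obtain N0 where N0: "\<And>n. n \<ge> N0 \<Longrightarrow> norm (X n - S) < \<epsilon> / 2"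
    using LIMSEQ_D[OF assms, of "\<epsilon> / 2"] \<epsilon> by auto
  define C where "C = (\<Sum>n<N0. norm (X n - S))"
  obtain N1 :: nat where N1: "2 * C / \<epsilon> < real N1" using reals_Archimedean2 by blast
  have C0: "C \<ge> 0" unfolding C_def by (intro sum_nonneg) auto
  have "norm ((1 / of_nat N) * (\<Sum>n<N. X n) - S) < \<epsilon>" if N: "N \<ge> max 1 (max N0 N1)" for N
  proof -
    have N': "N > 0" "N \<ge> N0" "N \<ge> N1" using N by auto
    have "norm (\<Sum>n<N. X n - S) \<le> (\<Sum>n<N. norm (X n - S))" by (rule norm_sum)
    also have "\<dots> = C + (\<Sum>n=N0..<N. norm (X n - S))"
      unfolding C_def lessThan_atLeast0 using N' by (subst sum.atLeastLessThan_concat) auto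
    also have "(\<Sum>n=N0..<N. norm (X n - S)) \<le> (\<Sum>n=N0..<N. \<epsilon> / 2)"
      using N0 by (intro sum_mono less_imp_le) auto
    also have "\<dots> = real (N - N0) * (\<epsilon> / 2)" by simp
    also have "\<dots> \<le> real N * (\<epsilon> / 2)" using \<epsilon> by (intro mult_right_mono) auto
    finally have b: "norm (\<Sum>n<N. X n - S) \<le> C + real N * (\<epsilon> / 2)" by simp
    have "(1 / of_nat N) * (\<Sum>n<N. X n) - S = (1 / of_nat N) * (\<Sum>n<N. X n - S)"
      using N' by (simp add: sum_subtractf field_simps)
    then have "norm ((1 / of_nat N) * (\<Sum>n<N. X n) - S) = (1 / N) * norm (\<Sum>n<N. X n - S)"
      by (simp add: norm_mult norm_divide)
    also have "\<dots> \<le> (1 / N) * (C + real N * (\<epsilon> / 2))" by (intro mult_left_mono b) simp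
    also have "\<dots> = C / N + \<epsilon> / 2" using N' by (simp add: field_simps)
    also have "C / N < \<epsilon> / 2"
    proof -
      have "2 * C / \<epsilon> < real N" using N1 N' by simp
      then show ?thesis using \<epsilon> N' by (simp add: field_simps)
    qed
    finally show ?thesis by simp
  qed
  then show "\<exists>no. \<forall>n\<ge>no. norm ((1 / of_nat n) * (\<Sum>n<n. X n) - S) < \<epsilon>" by blast
qed

text \<open>With the partial sums \<open>T\<close> of the convergent series, summation by parts writes the average as \<open>T N\<close>
minus the mean of \<open>T 0\<close>, \<dots>, \<open>T (N - 1)\<close>, and both have the same limit.\<close>

lemma kronecker_average:
  fixes a :: "nat \<Rightarrow> complex"
  assumes "(\<lambda>n. a (Suc n) / of_nat (Suc n)) sums S"
  shows "(\<lambda>N. (1 / of_nat N) * (\<Sum>n=1..N. a n)) \<longlonglongrightarrow> 0"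
proof -
  define T where "T N = (\<Sum>n<N. a (Suc n) / of_nat (Suc n))" for N
  have T: "T \<longlonglongrightarrow> S" using assms unfolding T_def[abs_def] sums_def .
  have abel: "(\<Sum>n=1..N. a n) = of_nat N * T N - (\<Sum>n<N. T n)" for N
  proof (induction N)
    case (Suc N)
    have "a (Suc N) = of_nat (Suc N) * (T (Suc N) - T N)" by (simp add: T_def del: of_nat_Suc)
    then show ?case using Suc by (simp add: algebra_simps)
  qed simp
  have "(\<lambda>N. T N - (1 / of_nat N) * (\<Sum>n<N. T n)) \<longlonglongrightarrow> S - S"
    by (intro tendsto_diff T cesaro_mean)
  moreover have "eventually (\<lambda>N. T N - (1 / of_nat N) * (\<Sum>n<N. T n) = (1 / of_nat N) * (\<Sum>n=1..N. a n)) sequentially"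
    unfolding abel by (rule eventually_sequentiallyI[of 1]) (simp add: field_simps)
  ultimately show ?thesis by (simp add: Lim_transform_eventually)
qed

lemma (in dirichlet_character) moebius_character_average:
  "(\<lambda>N. (1 / of_nat N) * (\<Sum>n=1..N. of_int (moebius_mu n) * \<xi> n)) \<longlonglongrightarrow> 0"
  using moebius_character_series_converges kronecker_average[of "\<lambda>n. of_int (moebius_mu n) * \<xi> n"] by blast

section \<open>The Moebius function in residue classes\<close>

definition moebius_negligible :: "(nat \<Rightarrow> complex) \<Rightarrow> bool" where
  "moebius_negligible F \<longleftrightarrow> (\<lambda>N. (1 / of_nat N) * (\<Sum>n=1..N. of_int (moebius_mu n) * F n)) \<longlonglongrightarrow> 0"

lemma moebius_negligible_sum:
  assumes "\<And>j. j \<in> J \<Longrightarrow> moebius_negligible (F j)"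
  shows "moebius_negligible (\<lambda>n. \<Sum>j\<in>J. c j * F j n)"
proof -
  have "(\<lambda>N. \<Sum>j\<in>J. c j * ((1 / of_nat N) * (\<Sum>n=1..N. of_int (moebius_mu n) * F j n))) \<longlonglongrightarrow> (\<Sum>j\<in>J. c j * 0)"
    using assms unfolding moebius_negligible_def by (intro tendsto_sum tendsto_mult_left) auto
  moreover have "(\<Sum>j\<in>J. c j * ((1 / of_nat N) * (\<Sum>n=1..N. of_int (moebius_mu n) * F j n)))
     = (1 / of_nat N) * (\<Sum>n=1..N. of_int (moebius_mu n) * (\<Sum>j\<in>J. c j * F j n))" for N
    unfolding sum_distrib_left by (subst sum.swap) (simp add: mult_ac)
  ultimately show ?thesis unfolding moebius_negligible_def by simp
qed

lemma moebius_negligible_scale: "moebius_negligible F \<Longrightarrow> moebius_negligible (\<lambda>n. c * F n)"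
  using moebius_negligible_sum[of "{()}" "\<lambda>_. F" "\<lambda>_. c"] by simp

text \<open>Functions on the group of units modulo \<open>q\<close>, extended by zero.\<close>

definition unit_function :: "nat \<Rightarrow> (nat \<Rightarrow> complex) \<Rightarrow> bool" where
  "unit_function q F \<longleftrightarrow> (\<forall>n. F (n + q) = F n) \<and> (\<forall>n. \<not> coprime n q \<longrightarrow> F n = 0)"

definition dilation_eigenfunction :: "nat \<Rightarrow> (nat \<Rightarrow> complex) \<Rightarrow> bool" where
  "dilation_eigenfunction g F \<longleftrightarrow> (\<exists>\<zeta>. \<forall>n. F (g * n) = \<zeta> * F n)"

lemma unit_function_mod: "unit_function q F \<Longrightarrow> F (n mod q) = F n"
proof -
  assume "unit_function q F"
  then have p: "F (m + q) = F m" for m by (simp add: unit_function_def)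
  have "F (r + q * k) = F r" for r k
    by (induction k) (simp_all add: p add.assoc[symmetric] add.commute[of q])
  from this[of "n mod q" "n div q"] show ?thesis by simp
qed

lemma unit_function_cong: "unit_function q F \<Longrightarrow> [m = n] (mod q) \<Longrightarrow> F m = F n"
  by (metis cong_def unit_function_mod)

text \<open>A joint eigenfunction is determined by its value at \<open>1\<close>: it is that value times a Dirichlet character.\<close>

lemma eigenfunction_negligible:
  assumes q: "q > 0" and F: "unit_function q F" and eig: "\<And>g. coprime g q \<Longrightarrow> dilation_eigenfunction g F"
  shows "moebius_negligible F"
proof -
  have mul: "F (g * n) * F 1 = F g * F n" if cg: "coprime g q" for g n
  proof -
    obtain \<zeta> where "\<And>n. F (g * n) = \<zeta> * F n" using eig[OF cg] unfolding dilation_eigenfunction_def by blast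
    from this[of n] this[of 1] show ?thesis by simp
  qed
  have zero: "F n = 0" if "\<not> coprime n q" for n using F that by (simp add: unit_function_def)
  show ?thesis
  proof (cases "F 1 = 0")
    case True
    have "F n = 0" for n
    proof (cases "coprime n q")
      case c: True
      obtain \<zeta> where "\<And>n'. F (n * n') = \<zeta> * F n'" using eig[OF c] unfolding dilation_eigenfunction_def by blast
      from this[of 1] show ?thesis using True by simp
    qed (rule zero)
    then show ?thesis by (simp add: moebius_negligible_def)
  next
    case False
    define \<xi> where "\<xi> n = F n / F 1" for n
    have "dirichlet_character q \<xi>"
    proof
      show "q > 0" by (rule q)
      show "\<xi> (n + q) = \<xi> n" for n using F by (simp add: \<xi>_def unit_function_def)
      show "\<xi> (m * n) = \<xi> m * \<xi> n" for m n
      proof (cases "coprime m q")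
        case True
        then show ?thesis using mul[OF True, of n] False by (simp add: \<xi>_def field_simps)
      next
        case c: False
        then show ?thesis using zero[of m] zero[of "m * n"] by (simp add: \<xi>_def)
      qed
      show "\<xi> n \<noteq> 0 \<longleftrightarrow> coprime n q" for n
      proof
        assume c: "coprime n q"
        have t: "totient q > 0" using q by (simp add: totient_gt_0_iff)
        have "[n * n ^ (totient q - 1) = 1] (mod q)" using euler_theorem[OF c] t by (simp add: power_eq_if)
        then have "F (n * n ^ (totient q - 1)) = F 1" by (rule unit_function_cong[OF F])
        then have "F 1 * F 1 = F n * F (n ^ (totient q - 1))" using mul[OF c] by metis
        then show "\<xi> n \<noteq> 0" using False by (auto simp: \<xi>_def)
      qed (use zero in \<open>auto simp: \<xi>_def\<close>)
    qed
    then have "moebius_negligible \<xi>"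
      unfolding moebius_negligible_def by (rule dirichlet_character.moebius_character_average)
    then have "moebius_negligible (\<lambda>n. F 1 * \<xi> n)" by (rule moebius_negligible_scale)
    then show ?thesis using False by (simp add: \<xi>_def)
  qed
qed

lemma cis_root_of_unity: "m > 0 \<Longrightarrow> cis (2 * pi / real m) ^ m = 1"
  unfolding Complex.DeMoivre by simp

lemma root_of_unity_sum:
  fixes m i :: nat
  assumes "m > 0" "i < m"
  shows "(\<Sum>j<m. (cis (2 * pi / m) ^ j) ^ i) = (if i = 0 then of_nat m else 0)"
proof (cases "i = 0")
  case False
  define x where "x = cis (2 * pi / m) ^ i"
  have xc: "x = cis (i * (2 * pi / m))" by (simp only: x_def Complex.DeMoivre)
  have "x \<noteq> 1"
  proof
    assume "x = 1"
    then have "cos (i * (2 * pi / m)) = 1" unfolding xc by (metis cis.sel(1) one_complex.sel(1))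
    then obtain k :: int where k: "real i * (2 * pi / real m) = real_of_int k * 2 * pi"
      unfolding cos_one_2pi_int by blast
    then have "real i = real_of_int k * m" using assms by (simp add: field_simps)
    then have ik: "int i = k * int m" by (metis of_int_eq_iff of_int_mult of_int_of_nat_eq)
    then have "int m dvd int i" by simp
    then have "m dvd i" by simp
    then show False using assms False by (auto dest: dvd_imp_le)
  qed
  moreover have "x ^ m = 1"
  proof -
    have "x ^ m = (cis (2 * pi / m) ^ m) ^ i" by (simp add: x_def power_mult[symmetric] mult.commute)
    also have "cis (2 * pi / m) ^ m = 1" using assms(1) by (rule cis_root_of_unity)
    finally show ?thesis by simp
  qed
  moreover have "(\<Sum>j<m. (cis (2 * pi / m) ^ j) ^ i) = (\<Sum>j<m. x ^ j)"
    by (simp add: x_def power_mult[symmetric] mult.commute)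
  ultimately show ?thesis using False geometric_sum[of x m] by simp
qed simp

text \<open>The dilation \<open>n \<mapsto> g n\<close> has order dividing \<open>m = totient q\<close>, so averaging over its powers with the weights
of an \<open>m\<close>-th root of unity projects onto an eigenspace. These projections sum to the identity and commute with
all other dilations.\<close>

lemma dilation_decomposition:
  assumes q: "q > 0" and F: "unit_function q F" and g: "coprime g q"
  shows "\<exists>P m. m > 0 \<and> (\<forall>n. F n = (\<Sum>j<m. (1 / of_nat m) * P j n)) \<and>
    (\<forall>j<m::nat. unit_function q (P j) \<and> dilation_eigenfunction g (P j) \<and>
      (\<forall>h. dilation_eigenfunction h F \<longrightarrow> dilation_eigenfunction h (P j)))"
proof -
  define m where "m = totient q"
  have m: "m > 0" using q by (simp add: m_def totient_gt_0_iff)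
  define z where "z j = cis (2 * pi / m) ^ j" for j
  have zm: "z j ^ m = 1" for j
  proof -
    have "z j ^ m = (cis (2 * pi / m) ^ m) ^ j" by (simp add: z_def power_mult[symmetric] mult.commute)
    also have "cis (2 * pi / m) ^ m = 1" using m by (rule cis_root_of_unity)
    finally show ?thesis by simp
  qed
  have z0: "z j \<noteq> 0" for j by (simp add: z_def)
  define P where "P j n = (\<Sum>i<m. z j ^ i * F (g ^ i * n))" for j n
  have cyc: "F (g ^ m * n) = F n" for n
  proof (rule unit_function_cong[OF F])
    have "[g ^ m * n = 1 * n] (mod q)" using euler_theorem[OF g] unfolding m_def by (rule cong_scalar_right)
    then show "[g ^ m * n = n] (mod q)" by simp
  qed
  have "F n = (\<Sum>j<m. (1 / of_nat m) * P j n)" for n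
  proof -
    have "(\<Sum>j<m. P j n) = (\<Sum>i<m. (\<Sum>j<m. z j ^ i) * F (g ^ i * n))"
      unfolding P_def by (subst sum.swap) (simp add: sum_distrib_right)
    also have "\<dots> = (\<Sum>i<m. if i = 0 then of_nat m * F n else 0)"
      unfolding z_def by (intro sum.cong refl) (simp add: root_of_unity_sum)
    also have "\<dots> = of_nat m * F n" using m by simp
    finally show ?thesis using m by (simp add: sum_divide_distrib[symmetric])
  qed
  moreover have "unit_function q (P j)" for j
    unfolding unit_function_def
  proof (intro conjI allI impI)
    fix n
    have "F (g ^ i * (n + q)) = F (g ^ i * n)" for i
      by (rule unit_function_cong[OF F]) (simp add: distrib_left cong_def)
    then show "P j (n + q) = P j n" by (simp add: P_def)
    assume "\<not> coprime n q"
    then have "F (g ^ i * n) = 0" for i using F by (simp add: unit_function_def)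
    then show "P j n = 0" by (simp add: P_def)
  qed
  moreover have "dilation_eigenfunction g (P j)" for j
    unfolding dilation_eigenfunction_def
  proof (intro exI allI)
    fix n
    have "z j * P j (g * n) = (\<Sum>i<m. z j ^ Suc i * F (g ^ Suc i * n))"
      unfolding P_def sum_distrib_left by (intro sum.cong refl) (simp add: mult_ac)
    also have "\<dots> = (\<Sum>i<Suc m. z j ^ i * F (g ^ i * n)) - F n"
      by (subst sum.lessThan_Suc_shift) simp
    also have "\<dots> = P j n" using cyc[of n] zm[of j] by (simp add: P_def)
    finally show "P j (g * n) = inverse (z j) * P j n" using z0[of j] by (simp add: field_simps)
  qed
  moreover have "dilation_eigenfunction h (P j)" if h: "dilation_eigenfunction h F" for h j
  proof -
    obtain \<zeta> where "\<And>n. F (h * n) = \<zeta> * F n" using h unfolding dilation_eigenfunction_def by blast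
    then have "F (g ^ i * (h * n)) = \<zeta> * F (g ^ i * n)" for i n by (metis mult.left_commute)
    then have "P j (h * n) = \<zeta> * P j n" for n
      unfolding P_def sum_distrib_left by (intro sum.cong refl) (simp only: mult.left_commute)
    then show ?thesis unfolding dilation_eigenfunction_def by blast
  qed
  ultimately show ?thesis using m by (intro exI[of _ P] exI[of _ m]) blast
qed

text \<open>Induction on the set of dilations for which the function is not yet an eigenfunction; each step
splits it into eigenfunctions of one more dilation.\<close>

lemma unit_function_negligible:
  assumes q: "q > 0" and F: "unit_function q F"
  shows "moebius_negligible F"
proof -
  define G where "G = {g. g < q \<and> coprime g q}"
  have "\<forall>F. unit_function q F \<and> (\<forall>g\<in>G - S. dilation_eigenfunction g F) \<longrightarrow> moebius_negligible F"
    if "finite S" "S \<subseteq> G" for S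
    using that
  proof (induction S rule: finite_induct)
    case empty
    show ?case
    proof (intro allI impI)
      fix F assume F: "unit_function q F \<and> (\<forall>g\<in>G - {}. dilation_eigenfunction g F)"
      show "moebius_negligible F"
      proof (rule eigenfunction_negligible[OF q])
        show "unit_function q F" using F by blast
        fix g assume g: "coprime g q"
        then have "g mod q \<in> G" using q by (simp add: G_def)
        then obtain \<zeta> where "\<And>n. F (g mod q * n) = \<zeta> * F n"
          using F unfolding dilation_eigenfunction_def by blast
        moreover have "F (g mod q * n) = F (g * n)" for n
          by (rule unit_function_cong) (use F in \<open>auto simp: cong_def mod_mult_left_eq\<close>)
        ultimately show "dilation_eigenfunction g F" unfolding dilation_eigenfunction_def by auto
      qed
    qed
  next
    case (insert g S)
    show ?case
    proof (intro allI impI)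
      fix F assume F: "unit_function q F \<and> (\<forall>h\<in>G - insert g S. dilation_eigenfunction h F)"
      have g: "coprime g q" using insert.prems by (auto simp: G_def)
      obtain P m where P: "\<And>n. F n = (\<Sum>j<m. (1 / of_nat m) * P j n)"
        "\<And>j. j < m \<Longrightarrow> unit_function q (P j) \<and> dilation_eigenfunction g (P j) \<and>
          (\<forall>h. dilation_eigenfunction h F \<longrightarrow> dilation_eigenfunction h (P j))"
        using dilation_decomposition[OF q _ g, of F] F by blast
      have "moebius_negligible (P j)" if "j < m" for j
        using insert.IH insert.prems P(2)[OF that] F by blast
      then have "moebius_negligible (\<lambda>n. \<Sum>j<m. (1 / of_nat m) * P j n)"
        by (intro moebius_negligible_sum) auto
      then show "moebius_negligible F" using P(1) by presburger
    qed
  qed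
  from this[of G] F show ?thesis by (simp add: G_def)
qed

text \<open>If \<open>g = gcd a q\<close>, the integers congruent to \<open>a\<close> modulo \<open>q\<close> are \<open>g m\<close> with \<open>m\<close> in a residue class
modulo \<open>q div g\<close> that is prime to this modulus. If \<open>m\<close> shares a prime with \<open>g\<close>, then \<open>g m\<close> is not squarefree.\<close>

lemma moebius_residue_term:
  fixes a q g :: nat
  assumes q: "q > 0" and g: "g = gcd a q" and m: "m > 0"
  shows "(if (g * m) mod q = a mod q then moebius_mu (g * m) else 0) =
     (if coprime m g \<and> m mod (q div g) = (a div g) mod (q div g) then moebius_mu g * moebius_mu m else 0)"
proof -
  have g0: "g > 0" using g q by simp
  have qa: "q = g * (q div g)" "a = g * (a div g)" using g by simp_all
  have iff: "(g * m) mod q = a mod q \<longleftrightarrow> m mod (q div g) = (a div g) mod (q div g)"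
  proof -
    have "(g * m) mod q = g * (m mod (q div g))" using qa(1) mult_mod_right by metis
    moreover have "a mod q = g * ((a div g) mod (q div g))" using qa mult_mod_right by metis
    ultimately show ?thesis using g0 by simp
  qed
  show ?thesis
  proof (cases "coprime m g")
    case True
    then show ?thesis using iff moebius_coprime_mult[of g m] g0 m by (simp add: coprime_commute)
  next
    case False
    then obtain p where p: "prime p" "p dvd m" "p dvd g" 
      by (metis coprime_iff_gcd_eq_1 gcd_nat.bounded_iff prime_factor_nat)
    then have "p\<^sup>2 dvd g * m" by (simp add: power2_eq_square mult_dvd_mono)
    then have "moebius_mu (g * m) = 0" by (rule moebius_eq_0[OF p(1)])
    then show ?thesis using False by simp
  qed
qed

text \<open>By \<open>moebius_residue_term\<close> the sum up to \<open>N\<close> reduces to a sum up to \<open>N div g\<close> of the Moebius function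
weighted with a function \<open>H\<close> on the units modulo \<open>q\<close>.\<close>

theorem moebius_residue_class:
  assumes q: "q > 0"
  shows "moebius_negligible (\<lambda>n. if n mod q = a mod q then 1 else 0)"
proof -
  define g where "g = gcd a q"
  have g0: "g > 0" using q by (simp add: g_def)
  define q' a' where "q' = q div g" and "a' = a div g"
  have qq: "q = g * q'" by (simp add: q'_def g_def)
  have co: "coprime a' q'" unfolding a'_def q'_def g_def using q by (intro div_gcd_coprime) auto
  define H :: "nat \<Rightarrow> complex" where "H m = (if coprime m g \<and> m mod q' = a' mod q' then 1 else 0)" for m
  have "unit_function q H"
    unfolding unit_function_def
  proof (intro conjI allI impI)
    fix n
    have "(n + q) mod q' = n mod q'" unfolding qq by simp
    moreover have "coprime (n + q) g \<longleftrightarrow> coprime n g"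
      unfolding qq coprime_iff_gcd_eq_1 by (metis gcd.commute gcd_add_mult mult.commute add.commute)
    ultimately show "H (n + q) = H n" by (simp add: H_def)
  next
    fix n assume nc: "\<not> coprime n q"
    show "H n = 0"
    proof (rule ccontr)
      assume "H n \<noteq> 0"
      then have n: "coprime n g" "n mod q' = a' mod q'" by (auto simp: H_def split: if_splits)
      then have "coprime n q'" using co by (metis coprime_iff_gcd_eq_1 gcd_mod_left gcd.commute coprime_mod_left_iff mod_0 gcd_0_left_nat gcd_red_nat)
      then have "coprime n q" using n(1) by (simp add: qq)
      then show False using nc by simp
    qed
  qed
  then have negl: "moebius_negligible H" by (rule unit_function_negligible[OF q])
  define A where "A N = (\<Sum>n=1..N. of_int (moebius_mu n) * H n)" for N
  have lim: "(\<lambda>N. (1 / of_nat N) * A N) \<longlonglongrightarrow> 0" using negl by (simp add: A_def moebius_negligible_def)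
  have red: "(\<Sum>n=1..N. of_int (moebius_mu n) * (if n mod q = a mod q then 1 else 0)) = of_int (moebius_mu g) * A (N div g)" for N
  proof -
    let ?f = "\<lambda>n. complex_of_int (if n mod q = a mod q then moebius_mu n else 0)"
    have img: "(*) g ` {1..N div g} = {n \<in> {1..N}. g dvd n}"
    proof (intro equalityI subsetI)
      fix n assume "n \<in> {n \<in> {1..N}. g dvd n}"
      then obtain m where m: "n = g * m" "1 \<le> n" "n \<le> N" by (auto elim!: dvdE)
      then have "m \<in> {1..N div g}" using g0 by (auto simp: less_eq_div_iff_mult_less_eq mult.commute intro: Suc_leI)
      then show "n \<in> (*) g ` {1..N div g}" using m by blast
    qed (use g0 in \<open>auto simp: less_eq_div_iff_mult_less_eq mult.commute\<close>)
    have "(\<Sum>n=1..N. of_int (moebius_mu n) * (if n mod q = a mod q then 1 else 0)) = (\<Sum>n\<in>{1..N}. ?f n)"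
      by (intro sum.cong) auto
    also have "\<dots> = (\<Sum>n\<in>{n \<in> {1..N}. g dvd n}. ?f n)"
    proof (rule sum.mono_neutral_right)
      show "\<forall>n\<in>{1..N} - {n \<in> {1..N}. g dvd n}. ?f n = 0"
      proof
        fix n assume n: "n \<in> {1..N} - {n \<in> {1..N}. g dvd n}"
        have "g dvd q" "g dvd a" by (simp_all add: g_def)
        then have "n mod q \<noteq> a mod q" using n by (metis (no_types, lifting) DiffD1 DiffD2 dvd_mod_iff mem_Collect_eq)
        then show "?f n = 0" by simp
      qed
    qed auto
    also have "\<dots> = (\<Sum>m=1..N div g. ?f (g * m))"
      unfolding img[symmetric] by (subst sum.reindex) (use g0 in \<open>auto simp: inj_on_def\<close>)
    also have "\<dots> = (\<Sum>m=1..N div g. of_int (moebius_mu g) * (of_int (moebius_mu m) * H m))"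
    proof (intro sum.cong refl)
      fix m assume "m \<in> {1..N div g}"
      then have "m > 0" by simp
      from moebius_residue_term[OF q g_def this]
      show "?f (g * m) = of_int (moebius_mu g) * (of_int (moebius_mu m) * H m)"
        unfolding H_def q'_def a'_def by simp
    qed
    also have "\<dots> = of_int (moebius_mu g) * A (N div g)" by (simp only: A_def sum_distrib_left)
    finally show ?thesis .
  qed
  have fl: "filterlim (\<lambda>N. N div g) at_top sequentially"
    unfolding filterlim_at_top
  proof
    fix Z :: nat
    have "Z \<le> N div g" if "N \<ge> Z * g" for N using that g0 by (simp add: less_eq_div_iff_mult_less_eq)
    then show "\<forall>\<^sub>F N in sequentially. Z \<le> N div g" by (rule eventually_sequentiallyI)
  qed
  have lim': "(\<lambda>N. norm ((1 / of_nat (N div g)) * A (N div g))) \<longlonglongrightarrow> 0"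
    using tendsto_norm_zero[OF filterlim_compose[OF lim fl]] .
  show ?thesis
    unfolding moebius_negligible_def red
  proof (rule Lim_null_comparison[OF _ lim'])
    show "\<forall>\<^sub>F N in sequentially. norm ((1 / of_nat N) * (of_int (moebius_mu g) * A (N div g))) \<le> norm ((1 / of_nat (N div g)) * A (N div g))"
    proof (rule eventually_sequentiallyI[of g])
      fix N assume N: "g \<le> N"
      have M: "N div g > 0" "N div g \<le> N" using N g0 by (auto simp: div_greater_zero_iff)
      have "norm ((1 / of_nat N) * (of_int (moebius_mu g) * A (N div g))) = (1 / N) * (norm (complex_of_int (moebius_mu g)) * norm (A (N div g)))"
        by (simp add: norm_mult norm_divide)
      also have "\<dots> \<le> (1 / real (N div g)) * (1 * norm (A (N div g)))"
        using M abs_moebius_le_1[of g] by (intro mult_mono frac_le) auto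
      also have "\<dots> = norm ((1 / of_nat (N div g)) * A (N div g))" by (simp add: norm_mult norm_divide)
      finally show "norm ((1 / of_nat N) * (of_int (moebius_mu g) * A (N div g))) \<le> norm ((1 / of_nat (N div g)) * A (N div g))" .
    qed
  qed
qed

corollary moebius_periodic:
  assumes q: "q > 0"
  shows "moebius_negligible (\<lambda>n. c (n mod q))"
proof -
  have "moebius_negligible (\<lambda>n. \<Sum>r<q. c r * (if n mod q = r mod q then 1 else 0))"
    by (intro moebius_negligible_sum moebius_residue_class[OF q])
  moreover have "(\<Sum>r<q. c r * (if n mod q = r mod q then 1 else 0)) = c (n mod q)" for n
  proof -
    have "(\<Sum>r<q. c r * (if n mod q = r mod q then 1 else 0)) = (\<Sum>r<q. if r = n mod q then c r else 0)"
      by (intro sum.cong) auto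
    then show ?thesis using q by simp
  qed
  ultimately show ?thesis by simp
qed

section \<open>Almost periodic sequences\<close>

lemma count_residues:
  fixes q T :: nat
  assumes "finite B"
  shows "card {n \<in> {1..T}. n mod q \<in> B} \<le> card B * (T div q + 1)"
proof -
  have "card {n \<in> {1..T}. n mod q \<in> B} \<le> card (B \<times> {..T div q})"
  proof (rule card_inj_on_le[of "\<lambda>n. (n mod q, n div q)"])
    show "inj_on (\<lambda>n. (n mod q, n div q)) {n \<in> {1..T}. n mod q \<in> B}"
      by (rule inj_onI) (metis Pair_inject mod_mult_div_eq)
    show "(\<lambda>n. (n mod q, n div q)) ` {n \<in> {1..T}. n mod q \<in> B} \<subseteq> B \<times> {..T div q}"
      by (auto intro: div_le_mono)
  qed (use assms in auto)
  then show ?thesis by (simp add: card_cartesian_product)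
qed

text \<open>The difference to the periodic sequence is at most \<open>\<epsilon>'\<close> except before time \<open>N\<close> and on the residues in \<open>B\<close>,
where it is at most \<open>2 M\<close>; among the first \<open>T\<close> integers the latter have proportion about \<open>\<epsilon>'\<close>. The constant \<open>\<epsilon>'\<close> is
chosen so that both contributions add up to \<open>\<epsilon> / 4\<close> on average.\<close>

theorem almost_periodic_negligible:
  fixes u :: "nat \<Rightarrow> complex"
  assumes bd: "\<And>n. norm (u n) \<le> M"
    and ap: "\<And>\<epsilon> :: real. \<epsilon> > 0 \<Longrightarrow> \<exists>q::nat. q > 0 \<and> (\<exists>N B c. B \<subseteq> {..<q} \<and> real (card B) \<le> \<epsilon> * q \<and>
        (\<forall>r. norm (c r) \<le> M) \<and> (\<forall>n\<ge>N. n mod q \<notin> B \<longrightarrow> norm (u n - c (n mod q)) \<le> \<epsilon>))"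
  shows "moebius_negligible u"
  unfolding moebius_negligible_def
proof (rule LIMSEQ_I)
  fix \<epsilon> :: real assume \<epsilon>: "\<epsilon> > 0"
  have M: "M \<ge> 0" using bd[of 0] norm_ge_zero order_trans by blast
  define \<epsilon>' where "\<epsilon>' = \<epsilon> / (4 * (1 + 2 * M))"
  have \<epsilon>': "\<epsilon>' > 0" using \<epsilon> M by (simp add: \<epsilon>'_def)
  obtain q :: nat and N B c where q: "q > 0" and B: "B \<subseteq> {..<q}" "real (card B) \<le> \<epsilon>' * q"
    and c: "\<And>r. norm (c r) \<le> M" "\<And>n. n \<ge> N \<Longrightarrow> n mod q \<notin> B \<Longrightarrow> norm (u n - c (n mod q)) \<le> \<epsilon>'"
    using ap[OF \<epsilon>'] by blast
  have finB: "finite B" using B(1) finite_subset by blast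
  have cB: "card B \<le> q" using card_mono[OF _ B(1)] by simp
  define e where "e n = u n - c (n mod q)" for n
  have pointwise: "norm (of_int (moebius_mu n) * e n) \<le> \<epsilon>' + (2 * M * (if n < N then 1 else 0) + 2 * M * (if n mod q \<in> B then 1 else 0))" for n
  proof -
    have "norm (of_int (moebius_mu n) * e n) \<le> 1 * norm (e n)"
      unfolding norm_mult using abs_moebius_le_1[of n] by (intro mult_right_mono) auto
    moreover have "norm (e n) \<le> 2 * M"
      unfolding e_def using norm_triangle_ineq4[of "u n" "c (n mod q)"] bd[of n] c(1)[of "n mod q"] by simp
    moreover have "norm (e n) \<le> \<epsilon>'" if "n \<ge> N" "n mod q \<notin> B" using c(2)[OF that] by (simp add: e_def)
    ultimately show ?thesis using M \<epsilon>' by (cases "n < N"; cases "n mod q \<in> B") auto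
  qed
  have err: "norm (\<Sum>n=1..T. of_int (moebius_mu n) * e n) \<le> T * (\<epsilon> / 4) + 2 * M * (N + q)" for T
  proof -
    have "norm (\<Sum>n=1..T. of_int (moebius_mu n) * e n) \<le> (\<Sum>n=1..T. \<epsilon>' + (2 * M * (if n < N then 1 else 0) + 2 * M * (if n mod q \<in> B then 1 else 0)))"
      by (intro sum_norm_le pointwise)
    also have "\<dots> = T * \<epsilon>' + (2 * M * (\<Sum>n=1..T. if n < N then 1 else 0) + 2 * M * (\<Sum>n=1..T. if n mod q \<in> B then 1 else 0))"
      by (simp add: sum.distrib sum_distrib_left)
    also have "(\<Sum>n=1..T. if n < N then 1 else 0 :: real) = card {n \<in> {1..T}. n < N}"
      by (simp add: sum.If_cases Int_def)
    also have "(\<Sum>n=1..T. if n mod q \<in> B then 1 else 0 :: real) = card {n \<in> {1..T}. n mod q \<in> B}"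
      by (simp add: sum.If_cases Int_def)
    also have "T * \<epsilon>' + (2 * M * card {n \<in> {1..T}. n < N} + 2 * M * card {n \<in> {1..T}. n mod q \<in> B})
      \<le> T * \<epsilon>' + (2 * M * N + 2 * M * (T * \<epsilon>' + q))"
    proof (intro add_mono mult_left_mono order_refl)
      have "card {n \<in> {1..T}. n < N} \<le> card {..<N}" by (intro card_mono) auto
      then show "real (card {n \<in> {1..T}. n < N}) \<le> real N" by simp
      have "real (card {n \<in> {1..T}. n mod q \<in> B}) \<le> real (card B) * (real (T div q) + 1)"
        using count_residues[OF finB, of T q] by (metis of_nat_1 of_nat_add of_nat_le_iff of_nat_mult)
      also have "\<dots> = real (card B) * real (T div q) + real (card B)" by (simp add: distrib_left)
      also have "real (card B) * real (T div q) \<le> (\<epsilon>' * q) * (T / q)"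
      proof (rule mult_mono[OF B(2)])
        have "real (T div q) * real q \<le> real T"
          by (metis of_nat_mult of_nat_le_iff div_times_less_eq_dividend)
        then show "real (T div q) \<le> T / q" using q by (simp add: le_divide_eq)
      qed (use \<epsilon>' in auto)
      also have "(\<epsilon>' * q) * (T / q) = T * \<epsilon>'" using q by simp
      finally show "real (card {n \<in> {1..T}. n mod q \<in> B}) \<le> T * \<epsilon>' + q" using cB by simp
    qed (use M in auto)
    also have "\<dots> = T * (\<epsilon>' * (1 + 2 * M)) + 2 * M * (N + q)" by (simp add: algebra_simps)
    also have "\<epsilon>' * (1 + 2 * M) = \<epsilon> / 4" using M by (simp add: \<epsilon>'_def divide_simps)
    finally show ?thesis .
  qed
  have periodic: "(\<lambda>N. (1 / of_nat N) * (\<Sum>n=1..N. of_int (moebius_mu n) * c (n mod q))) \<longlonglongrightarrow> 0"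
    using moebius_periodic[OF q, of c] unfolding moebius_negligible_def .
  have "\<epsilon> / 4 > 0" using \<epsilon> by simp
  from LIMSEQ_D[OF periodic this]
  obtain T1 where T1: "\<And>T. T \<ge> T1 \<Longrightarrow> norm ((1 / of_nat T) * (\<Sum>n=1..T. of_int (moebius_mu n) * c (n mod q))) < \<epsilon> / 4"
    unfolding diff_zero by blast
  obtain T2 :: nat where T2: "2 * M * (N + q) / (\<epsilon> / 4) < T2" using reals_Archimedean2 by blast
  have "norm ((1 / of_nat T) * (\<Sum>n=1..T. of_int (moebius_mu n) * u n) - 0) < \<epsilon>" if "T \<ge> max 1 (max T1 T2)" for T
  proof -
    have T: "T > 0" "T \<ge> T1" "T \<ge> T2" using that by auto
    have "(\<Sum>n=1..T. of_int (moebius_mu n) * u n) = (\<Sum>n=1..T. of_int (moebius_mu n) * c (n mod q)) + (\<Sum>n=1..T. of_int (moebius_mu n) * e n)"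
      unfolding sum.distrib[symmetric] by (intro sum.cong) (simp_all add: e_def algebra_simps)
    then have "norm ((1 / of_nat T) * (\<Sum>n=1..T. of_int (moebius_mu n) * u n)) \<le>
        norm ((1 / of_nat T) * (\<Sum>n=1..T. of_int (moebius_mu n) * c (n mod q))) + norm ((1 / of_nat T) * (\<Sum>n=1..T. of_int (moebius_mu n) * e n))"
      by (simp only: distrib_left norm_triangle_ineq)
    also have "norm ((1 / of_nat T) * (\<Sum>n=1..T. of_int (moebius_mu n) * e n)) = (1 / T) * norm (\<Sum>n=1..T. of_int (moebius_mu n) * e n)"
      by (simp add: norm_mult norm_divide)
    also have "\<dots> \<le> (1 / T) * (T * (\<epsilon> / 4) + 2 * M * (N + q))" by (intro mult_left_mono err) simp
    also have "\<dots> = \<epsilon> / 4 + 2 * M * (N + q) / T" using T by (simp add: field_simps)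
    also have "2 * M * (N + q) / T < \<epsilon> / 4"
    proof -
      have "2 * M * (N + q) / (\<epsilon> / 4) < T" using T2 T by simp
      then show ?thesis using \<epsilon> T by (simp add: field_simps)
    qed
    finally show ?thesis using T1[OF T(2)] \<epsilon> by simp
  qed
  then show "\<exists>no. \<forall>T\<ge>no. norm ((1 / of_nat T) * (\<Sum>n=1..T. of_int (moebius_mu n) * u n) - 0) < \<epsilon>" by blast
qed

theorem corollary2:
  fixes a b :: real and f :: "real \<Rightarrow> real"
  assumes "a \<le> b"
    and "continuous_on {a..b} f"
    and "f ` {a..b} \<subseteq> {a..b}"
    and "topological_entropy {a..b} f = 0"
  shows "linearly_disjoint (\<lambda>n. of_int (moebius_mu n)) {a..b} f"
  unfolding linearly_disjoint_def
proof (intro allI impI ballI)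
  fix \<phi> :: "real \<Rightarrow> complex" and x :: real
  assume \<phi>: "continuous_on {a..b} \<phi>" and x: "x \<in> {a..b}"
  interpret no_horseshoe a b f
    using assms horseshoe_imp_positive_entropy[where f = f and X = "{a..b}"] by unfold_locales auto
  have "bounded (\<phi> ` {a..b})" by (intro compact_imp_bounded compact_continuous_image[OF \<phi>]) simp
  then obtain M where "\<forall>w\<in>\<phi> ` {a..b}. norm w \<le> M" unfolding bounded_iff by blast
  then have M: "norm (\<phi> y) \<le> M" if "y \<in> {a..b}" for y using that by simp
  have unif: "uniformly_continuous_on {a..b} \<phi>" by (rule compact_uniformly_continuous[OF \<phi>]) simp
  have "moebius_negligible (\<lambda>n. \<phi> ((f ^^ n) x))"
  proof (rule almost_periodic_negligible)
    show "norm (\<phi> ((f ^^ n) x)) \<le> M" for n by (rule M[OF funpow_maps[OF x]])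
    fix \<epsilon> :: real assume \<epsilon>: "\<epsilon> > 0"
    obtain d where d: "d > 0" "\<And>y y'. y \<in> {a..b} \<Longrightarrow> y' \<in> {a..b} \<Longrightarrow> dist y' y < d \<Longrightarrow> dist (\<phi> y') (\<phi> y) < \<epsilon>"
      using unif \<epsilon> unfolding uniformly_continuous_on_def by metis
    have "d / 2 > 0" using d(1) by simp
    from orbit_almost_periodic[OF x this \<epsilon>]
    obtain q :: nat and N B where q: "q > 0" and B: "B \<subseteq> {..<q}" "real (card B) \<le> \<epsilon> * q"
      and close: "\<And>n m. n \<ge> N \<Longrightarrow> m \<ge> N \<Longrightarrow> n mod q = m mod q \<Longrightarrow> n mod q \<notin> B \<Longrightarrow> \<bar>(f ^^ n) x - (f ^^ m) x\<bar> \<le> d / 2"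
      by blast
    \<comment> \<open>the index \<open>r + q * N\<close> is in the class of \<open>r\<close> and beyond \<open>N\<close>\<close>
    define c where "c r = \<phi> ((f ^^ (r + q * N)) x)" for r
    have "norm (\<phi> ((f ^^ n) x) - c (n mod q)) \<le> \<epsilon>" if n: "n \<ge> N" "n mod q \<notin> B" for n
    proof -
      have "N \<le> n mod q + q * N" using q by (simp add: trans_le_add2)
      then have "\<bar>(f ^^ n) x - (f ^^ (n mod q + q * N)) x\<bar> \<le> d / 2" using n by (intro close) auto
      then have "dist ((f ^^ n) x) ((f ^^ (n mod q + q * N)) x) < d" using d(1) by (simp add: dist_real_def)
      then have "dist (\<phi> ((f ^^ n) x)) (c (n mod q)) < \<epsilon>"
        unfolding c_def by (intro d(2) funpow_maps[OF x])
      then show ?thesis by (simp add: dist_norm)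
    qed
    moreover have "norm (c r) \<le> M" for r unfolding c_def by (rule M[OF funpow_maps[OF x]])
    ultimately show "\<exists>q::nat. q > 0 \<and> (\<exists>N B c. B \<subseteq> {..<q} \<and> real (card B) \<le> \<epsilon> * q \<and>
        (\<forall>r. norm (c r) \<le> M) \<and> (\<forall>n\<ge>N. n mod q \<notin> B \<longrightarrow> norm (\<phi> ((f ^^ n) x) - c (n mod q)) \<le> \<epsilon>))"
      using q B by blast
  qed
  then show "(\<lambda>N. (1 / of_nat N) * (\<Sum>n=1..N. of_int (moebius_mu n) * \<phi> ((f ^^ n) x))) \<longlonglongrightarrow> 0"
    unfolding moebius_negligible_def .
qed

end
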